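(* Let $m$, $n$ and $\mathbf r=(r_1,\dots,r_n)$, with all $r_i>0$, be fixed. On $M^0_{\mathbf r}$ the action variables $\mu_{ij}=\sum_{k=1}^j\lambda_{ik}$ and the angle variables $\theta_{ij}$, $(i,j)\in\mathcal I$, are conjugate: for $(i,j),(k,l)\in\mathcal I$, $$\{\mu_{ij},\theta_{kl}\}=\begin{cases}1,& i=k,\ j=l,\\ 0,&\text{otherwise.}\end{cases}$$
   Context: $(\cdot,\cdot)$ is the standard Hermitian inner product on $\mathbb C^{m+1}$, linear in the first argument; for a unit vector $w$, $w\otimes w^*$ is the projection $v\mapsto(v,w)w$; for $r>0$, $\mathcal O_r=\{r\,w\otimes w^*:\|w\|=1\}$, a set of Hermitian $(m+1)\times(m+1)$ matrices. $\Lambda=\frac1{m+1}\sum_{i=1}^n r_i$, $\widetilde N_{\mathbf r}=\prod_i\mathcal O_{r_i}$, $\widetilde M_{\mathbf r}=\{\mathbf e\in\widetilde N_{\mathbf r}:\sum_ie_i=\Lambda\mathbb I\}$, $M_{\mathbf r}=\widetilde M_{\mathbf r}/U(m+1)$ (simultaneous conjugation). For $\mathbf e\in\widetilde M_{\mathbf r}$ write $e_k=r_k\,w_k\otimes w_k^*$ with $\|w_k\|=1$ and $A_i=e_1+\cdots+e_{i+1}$; let $\lambda_{ij}$ ($0\le i\le n-1$, $1\le j\le i+1$) be the $j$-th largest eigenvalue of $A_i$ if $j\le m+1$, and $0$ if $j\ge m+2$. These satisfy the interlacing inequalities $\lambda_{ij}\ge\lambda_{i-1,j}\ge\lambda_{i,j+1}$.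 Since $A_{n-1}=\Lambda\mathbb I$, the entry $(i,j)$ is forced to be $\Lambda$ if $j\le m+2+i-n$, and it is forced to be $0$ if $j\ge m+2$; otherwise it is unforced. $\mathcal I$ is the set of $(i,j)$ with $1\le i\le n-1$, $1\le j\le i$, such that $\lambda_{ij}$ is not forced to be $0$ or $\Lambda$ and $\lambda_{i,j+1}$ is not forced to be $0$. $\widetilde M_{\mathbf r}^0$ is the open subset of $\widetilde M_{\mathbf r}$ where the interlacing inequalities are strict (except between two entries both forced to be $\Lambda$ or both forced to be $0$), and $M_{\mathbf r}^0$ is its image in $M_{\mathbf r}$. Angle variables: for $(i,j)\in\mathcal I$, let $u_{ij}$ be a unit $\lambda_{ij}$-eigenvector of $A_i$ (and likewise $u_{i,j+1}$), and $\theta_{ij}=\arg\big[(w_{i+1},u_{ij})(u_{ij},w_{i+2})(w_{i+2},u_{i,j+1})(u_{i,j+1},w_{i+1})\big]$; the bracketed quantity is nonzero on $\widetilde M^0_{\mathbf r}$, independent of the phases of the vectors, and $U(m+1)$-invariant. Poisson bracket: $M_{\mathbf r}$ is the symplectic quotient at $\Lambda\mathbb I$ of $\widetilde N_{\mathbf r}$ by $U(m+1)$ with momentum map $\mathbf e\mapsto\sum_ie_i$, and $\{\cdot,\cdot\}$ on $M_{\mathbf r}^0$ is the bracket induced from the sum of the Lie–Poisson brackets of the orbits. The paper's conventions are: $\nabla f(X)\in\mathfrak u(m+1)$ is defined by $\operatorname{Im}\operatorname{Tr}(\nabla f(X)Y)=\frac d{dt}|_{t=0}f(X+tY)$ for all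 Hermitian $Y$; $\{f,g\}(X)=\operatorname{Im}\operatorname{Tr}(X[\nabla f(X),\nabla g(X)])$; Hamilton's equations for $f$ are $\dot X=[\nabla f(X),X]$.
   Formalization: The bracket is taken with the opposite sign, {f,g}(X)=Im Tr(X[∇g,∇f]), i.e. the derivative of g along Hamilton's equations X'=[∇f,X]; with the stated Im Tr(X[∇f,∇g]) the value for i=k, j=l would be −1 instead of 1. *)

theory Defs
  imports "HOL-Analysis.Analysis" "HOL-Library.Multiset"
begin

text \<open>
  The type \<open>'d\<close> indexes the coordinates of \<open>\<complex>\<^sup>m\<^sup>+\<^sup>1\<close>, so \<open>CARD('d) = m + 1\<close>; the type \<open>'n\<close>
  indexes the \<open>n = CARD('n)\<close> members of a tuple, its linear order giving their numbering.
\<close>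

type_synonym ('d, 'n) tuple = "(((complex, 'd) vec, 'd) vec, 'n) vec"

subsection \<open>Hermitian linear algebra\<close>

definition hinner :: "complex^'d \<Rightarrow> complex^'d \<Rightarrow> complex" where
  "hinner v w = (\<Sum>a\<in>UNIV. v $ a * cnj (w $ a))"

definition cadjoint :: "complex^'d^'d \<Rightarrow> complex^'d^'d" where
  "cadjoint A = (\<chi> a b. cnj (A $ b $ a))"

definition hermitian :: "complex^'d^'d \<Rightarrow> bool" where
  "hermitian A \<longleftrightarrow> cadjoint A = A"

definition skew_hermitian :: "complex^'d^'d \<Rightarrow> bool" where
  "skew_hermitian A \<longleftrightarrow> cadjoint A = - A"

definition unitary :: "complex^'d^'d \<Rightarrow> bool" where
  "unitary g \<longleftrightarrow> g ** cadjoint g = mat 1"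

definition commutator :: "complex^'d^'d \<Rightarrow> complex^'d^'d \<Rightarrow> complex^'d^'d" where
  "commutator A B = A ** B - B ** A"

text \<open>\<open>w \<otimes> w\<^sup>*\<close>\<close>
definition outer :: "complex^'d \<Rightarrow> complex^'d^'d" where
  "outer w = (\<chi> a b. w $ a * cnj (w $ b))"

lemma outer_mult_vec: "outer w *v v = hinner v w *s w"
  by (simp add: outer_def hinner_def matrix_vector_mult_def vec_eq_iff sum_distrib_left
      mult.commute mult.left_commute)

definition scale_mat :: "real \<Rightarrow> complex^'d^'d \<Rightarrow> complex^'d^'d" where
  "scale_mat t A = (\<chi> a b. complex_of_real t * A $ a $ b)"

definition eigenspace :: "complex^'d^'d \<Rightarrow> real \<Rightarrow> (complex^'d) set" where
  "eigenspace A x = {v. A *v v = complex_of_real x *s v}"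

definition real_eigenvalues :: "complex^'d^'d \<Rightarrow> real set" where
  "real_eigenvalues A = {x. \<exists>v\<in>eigenspace A x. v \<noteq> 0}"

text \<open>
  The eigenvalues of a Hermitian matrix, in decreasing order and repeated according to
  multiplicity (geometric and algebraic multiplicity agree); \<open>vec.dim\<close> is the dimension over the
  complex numbers.
\<close>
definition eigenvalue_list :: "complex^'d^'d \<Rightarrow> real list" where
  "eigenvalue_list A = rev (sorted_list_of_multiset
     (\<Sum>x\<in>real_eigenvalues A. replicate_mset (vec.dim (eigenspace A x)) x))"

subsection \<open>The spaces\<close>

definition conj_act :: "complex^'d^'d \<Rightarrow> ('d::finite, 'n::finite) tuple \<Rightarrow> ('d, 'n) tuple" where
  "conj_act g e = (\<chi> k. g ** e $ k ** cadjoint g)"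

definition coadjoint_orbit :: "real \<Rightarrow> (complex^'d^'d) set" where
  "coadjoint_orbit t = {scale_mat t (outer w) | w. norm w = 1}"

definition N_tilde :: "real^'n::finite \<Rightarrow> ('d::finite, 'n) tuple set" where
  "N_tilde r = {e. \<forall>k. e $ k \<in> coadjoint_orbit (r $ k)}"

definition M_tilde :: "real^'n::finite \<Rightarrow> ('d::finite, 'n) tuple set" where
  "M_tilde r = {e \<in> N_tilde r.
     (\<Sum>k\<in>UNIV. e $ k) = mat (complex_of_real ((\<Sum>k\<in>UNIV. r $ k) / real CARD('d)))}"

text \<open>The \<open>k\<close>-th index, counted from 1.\<close>
definition ix :: "nat \<Rightarrow> 'n::{finite,linorder}" where
  "ix k = sorted_list_of_set UNIV ! (k - 1)"

definition partial_sum :: "('d::finite, 'n::{finite,linorder}) tuple \<Rightarrow> nat \<Rightarrow> complex^'d^'d" where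
  "partial_sum e i = (\<Sum>k = 1..i + 1. e $ ix k)"

definition lam :: "('d::finite, 'n::{finite,linorder}) tuple \<Rightarrow> nat \<Rightarrow> nat \<Rightarrow> real" where
  "lam e i j = (if j \<le> CARD('d) then eigenvalue_list (partial_sum e i) ! (j - 1) else 0)"

definition forced_Lambda :: "nat \<Rightarrow> nat \<Rightarrow> nat \<Rightarrow> nat \<Rightarrow> bool" where
  "forced_Lambda m n i j \<longleftrightarrow> j + n \<le> m + 2 + i"

definition forced_zero :: "nat \<Rightarrow> nat \<Rightarrow> bool" where
  "forced_zero m j \<longleftrightarrow> j \<ge> m + 2"

text \<open>The entries \<open>(i, j)\<close> and \<open>(i', j')\<close> are forced to the same value.\<close>
definition both_forced :: "nat \<Rightarrow> nat \<Rightarrow> nat \<Rightarrow> nat \<Rightarrow> nat \<Rightarrow> nat \<Rightarrow> bool" where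
  "both_forced m n i j i' j' \<longleftrightarrow>
     forced_Lambda m n i j \<and> forced_Lambda m n i' j' \<or> forced_zero m j \<and> forced_zero m j'"

definition index_set :: "nat \<Rightarrow> nat \<Rightarrow> (nat \<times> nat) set" where
  "index_set m n = {(i, j). 1 \<le> i \<and> i \<le> n - 1 \<and> 1 \<le> j \<and> j \<le> i \<and>
     \<not> forced_Lambda m n i j \<and> \<not> forced_zero m j \<and> \<not> forced_zero m (j + 1)}"

definition M_tilde0 :: "real^'n::{finite,linorder} \<Rightarrow> ('d::finite, 'n) tuple set" where
  "M_tilde0 r = {e \<in> M_tilde r. \<forall>i j. 1 \<le> i \<and> i \<le> CARD('n) - 1 \<and> 1 \<le> j \<and> j \<le> i \<longrightarrow>
     (lam e i j > lam e (i - 1) j \<or>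
        both_forced (CARD('d) - 1) CARD('n) i j (i - 1) j) \<and>
     (lam e (i - 1) j > lam e i (j + 1) \<or>
        both_forced (CARD('d) - 1) CARD('n) (i - 1) j i (j + 1))}"

text \<open>Points of the quotient by simultaneous conjugation are orbits, i.e. sets of tuples.\<close>
definition orbit :: "('d::finite, 'n::finite) tuple \<Rightarrow> ('d, 'n) tuple set" where
  "orbit e = {conj_act g e | g. unitary g}"

definition M_quot0 :: "real^'n::{finite,linorder} \<Rightarrow> ('d::finite, 'n) tuple set set" where
  "M_quot0 r = orbit ` M_tilde0 r"

subsection \<open>Action and angle variables\<close>

text \<open>
  The eigenvalues are constant on orbits, so the image below is a singleton for every point of
  the quotient.
\<close>
definition action :: "nat \<Rightarrow> nat \<Rightarrow> ('d::finite, 'n::{finite,linorder}) tuple set \<Rightarrow> real" where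
  "action i j p = the_elem ((\<lambda>e. \<Sum>k = 1..j. lam e i k) ` p)"

text \<open>
  The angle is defined modulo \<open>2\<pi>\<close>. As a real-valued function it is given by continuous branches
  of the argument over open subsets \<open>V\<close> of the quotient (with the quotient topology). The number
  whose argument is taken does not depend on the unit vectors chosen.
\<close>
definition angle_branch :: "real^'n::{finite,linorder} \<Rightarrow> nat \<Rightarrow> nat \<Rightarrow>
    ('d::finite, 'n) tuple set set \<Rightarrow> (('d, 'n) tuple set \<Rightarrow> real) \<Rightarrow> bool" where
  "angle_branch r i j V \<theta> \<longleftrightarrow>
     V \<subseteq> M_quot0 r \<and>
     openin (top_of_set (M_tilde0 r)) {e \<in> M_tilde0 r. orbit e \<in> V} \<and>
     continuous_on {e \<in> M_tilde0 r. orbit e \<in> V} (\<theta> \<circ> orbit) \<and>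
     (\<forall>e \<in> M_tilde0 r. orbit e \<in> V \<longrightarrow>
       (\<forall>w w' u u'.
          norm w = 1 \<and> e $ ix (i + 1) = scale_mat (r $ ix (i + 1)) (outer w) \<and>
          norm w' = 1 \<and> e $ ix (i + 2) = scale_mat (r $ ix (i + 2)) (outer w') \<and>
          norm u = 1 \<and> u \<in> eigenspace (partial_sum e i) (lam e i j) \<and>
          norm u' = 1 \<and> u' \<in> eigenspace (partial_sum e i) (lam e i (j + 1)) \<longrightarrow>
          is_Arg (hinner w u * hinner u w' * hinner w' u' * hinner u' w) (\<theta> (orbit e))))"

subsection \<open>The Poisson bracket\<close>

definition hermitian_tuples :: "('d::finite, 'n::finite) tuple set" where
  "hermitian_tuples = {e. \<forall>k. hermitian (e $ k)}"

text \<open>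
  \<open>D\<close> is the tuple of gradients, one for each factor: skew-Hermitian matrices representing the
  differential of \<open>F\<close> on tuples of Hermitian matrices by \<open>Im Tr\<close>.
\<close>
definition has_gradient ::
    "(('d::finite, 'n::finite) tuple \<Rightarrow> real) \<Rightarrow> ('d, 'n) tuple \<Rightarrow> ('d, 'n) tuple \<Rightarrow> bool" where
  "has_gradient F D e \<longleftrightarrow> (\<forall>k. skew_hermitian (D $ k)) \<and>
     (F has_derivative (\<lambda>Y. \<Sum>k\<in>UNIV. Im (trace (D $ k ** Y $ k))))
       (at e within hermitian_tuples)"

text \<open>The right-hand side of Hamilton's equations for a function with gradient \<open>D\<close>.\<close>
definition hamiltonian_field ::
    "('d::finite, 'n::finite) tuple \<Rightarrow> ('d, 'n) tuple \<Rightarrow> ('d, 'n) tuple" where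
  "hamiltonian_field D e = (\<chi> k. commutator (D $ k) (e $ k))"

text \<open>
  The bracket \<open>{F, G}\<close> at \<open>e\<close> of functions with gradients \<open>D\<close> and \<open>D'\<close>, for the sum of the
  Lie-Poisson structures. The overall sign is the one for which \<open>{F, G}\<close> is the derivative of \<open>G\<close>
  along the solutions of Hamilton's equations of \<open>F\<close>, which are \<open>X' = [\<nabla>F, X]\<close>; thus an
  angle that increases at unit speed under the flow of its action has bracket \<open>{action, angle} = 1\<close>.
  On each factor it is \<open>Im Tr (X [\<nabla>G, \<nabla>F])\<close>, as shown below. The other common convention,
  \<open>Im Tr (X [\<nabla>F, \<nabla>G])\<close>, is its negative and would give \<open>-1\<close>.
\<close>
definition lie_poisson ::
    "('d::finite, 'n::finite) tuple \<Rightarrow> ('d, 'n) tuple \<Rightarrow> ('d, 'n) tuple \<Rightarrow> real" where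
  "lie_poisson D D' e = (\<Sum>k\<in>UNIV. Im (trace (D' $ k ** hamiltonian_field D e $ k)))"

lemma lie_poisson_alt:
  fixes D D' e :: "('d::finite, 'n::finite) tuple"
  shows "lie_poisson D D' e = (\<Sum>k\<in>UNIV. Im (trace (e $ k ** commutator (D' $ k) (D $ k))))"
proof -
  have "trace (A ** commutator B X) = trace (X ** commutator A B)"
    for A B X :: "complex^'d^'d"
  proof -
    have "trace (A ** (B ** X)) = trace (X ** (A ** B))"
      by (metis matrix_mul_assoc trace_mul_sym)
    moreover have "trace (A ** (X ** B)) = trace (X ** (B ** A))"
      by (metis matrix_mul_assoc trace_mul_sym)
    moreover have "A ** commutator B X = A ** (B ** X) - A ** (X ** B)"
      "X ** commutator A B = X ** (A ** B) - X ** (B ** A)"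
      by (simp_all add: commutator_def matrix_matrix_mult_def vec_eq_iff right_diff_distrib
          sum_subtractf)
    ultimately show ?thesis
      by (simp add: trace_sub)
  qed
  from this[of "D' $ _" "D $ _" "e $ _"] show ?thesis
    unfolding lie_poisson_def hamiltonian_field_def vec_lambda_beta by (simp only:)
qed

text \<open>
  \<open>F\<close> is a unitarily invariant differentiable function, on an invariant neighbourhood of \<open>e\<close>,
  that lifts and extends the function \<open>f\<close> on the quotient.
\<close>
definition invariant_extension :: "real^'n::{finite,linorder} \<Rightarrow>
    (('d::finite, 'n) tuple set \<Rightarrow> real) \<Rightarrow> ('d, 'n) tuple \<Rightarrow>
    (('d, 'n) tuple \<Rightarrow> real) \<Rightarrow> bool" where
  "invariant_extension r f e F \<longleftrightarrow> (\<exists>V. open V \<and> e \<in> V \<and>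
     (\<forall>g x. unitary g \<and> x \<in> V \<longrightarrow> conj_act g x \<in> V) \<and>
     (\<forall>g x. unitary g \<and> x \<in> V \<inter> N_tilde r \<longrightarrow> F (conj_act g x) = F x) \<and>
     (\<forall>x \<in> V \<inter> M_tilde0 r. F x = f (orbit x)) \<and>
     (\<forall>x \<in> V \<inter> hermitian_tuples. \<exists>D. has_gradient F D x))"

text \<open>
  The bracket on the symplectic quotient: \<open>{f, g}\<close> at \<open>p\<close> is computed from local invariant
  extensions of \<open>f\<close> and \<open>g\<close>; these must exist, and the value must be the same for all of them
  and for all points of the orbit \<open>p\<close>.
\<close>
definition has_reduced_bracket :: "real^'n::{finite,linorder} \<Rightarrow>
    (('d::finite, 'n) tuple set \<Rightarrow> real) \<Rightarrow> (('d, 'n) tuple set \<Rightarrow> real) \<Rightarrow>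
    ('d, 'n) tuple set \<Rightarrow> real \<Rightarrow> bool" where
  "has_reduced_bracket r f g p c \<longleftrightarrow>
     (\<exists>e\<in>p. (\<exists>F. invariant_extension r f e F) \<and> (\<exists>G. invariant_extension r g e G)) \<and>
     (\<forall>e\<in>p. \<forall>F G D D'. invariant_extension r f e F \<and> invariant_extension r g e G \<and>
        has_gradient F D e \<and> has_gradient G D' e \<longrightarrow> lie_poisson D D' e = c)"

end

(*
  Write I for the imaginary unit. The action mu_ij is the sum of the j largest eigenvalues of A_i.
  Its gradient is I P on the factors 1, ..., i+1, where P is the projection onto the corresponding
  eigenvectors, so its flow conjugates e_1, ..., e_{i+1} by 1 + (exp(I t) - 1) P and fixes the other
  factors. This preserves every eigenvalue of every partial sum. Along it the number whose argument
  is theta_kl is constant, except that for (k, l) = (i, j) it is multiplied by exp(I t).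

  Any other invariant extension of mu_ij gives the same bracket: by Noether's theorem the
  Hamiltonian field of an invariant function is tangent to the level set of the momentum map, and a
  function that vanishes on a level set has derivative zero along the kernel of the derivative of
  the momentum map, wherever that derivative is onto the trace-zero Hermitian matrices. The strict
  interlacing inequalities force a Hermitian matrix with all w_k as eigenvectors to be scalar, which
  gives this surjectivity; they also make the relevant eigenvalues simple, hence the spectral
  projections differentiable, and the number defining the angle nonzero.
*)
theory Submission
  imports Defs
begin

text \<open>The extensions in \<open>invariant_extension\<close> are assumed differentiable, not
  continuously differentiable, so the level set of the momentum map is out of reach of the implicit
  function theorem; a multiplier rule for functions differentiable at one point replaces it, applied
  after the orbits are parametrised by renormalised vectors. Different extensions are compared only
  for the action. Once its extension is the eigenvalue sum, the bracket is the derivative of the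
  other extension along a curve inside \<open>M_tilde0 r\<close>, where that extension coincides
  with the angle; so no gradient of the angle is ever computed, and only the existence of an
  extension of it has to be shown. Smoothness of eigenvalue data rests on estimates: sums of the
  largest eigenvalues are maxima of linear functions, which yields Lipschitz bounds, then bounds for
  projections across a spectral gap, then derivatives with quadratic error. All of this holds at any
  Hermitian matrix with the gap, hence at the Hermitian points of an open set of tuples, as
  extensions require.\<close>

section \<open>Lagrange multipliers\<close>

text \<open>
  Only differentiability at one point is needed: Brouwer's theorem corrects the points
  \<open>a + t \<xi>\<close> by \<open>o(t)\<close> to points of the level set.
\<close>
lemma derivative_zero_on_level_set:
  fixes f :: "'a::real_normed_vector \<Rightarrow> 'b::euclidean_space" and h :: "'a \<Rightarrow> real"
  assumes f: "(f has_derivative f') (at a)" and h: "(h has_derivative h') (at a)"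
    and U: "open U" "a \<in> U" and cont: "continuous_on U f"
    and rng: "\<And>x. x \<in> U \<Longrightarrow> f x - f a \<in> range f'"
    and lev: "\<And>x. x \<in> U \<Longrightarrow> f x = f a \<Longrightarrow> h x = h a"
    and \<xi>: "f' \<xi> = 0"
  shows "h' \<xi> = 0"
proof -
  have lin: "linear f'" "linear h'" and bl: "bounded_linear h'"
    using f h has_derivative_bounded_linear bounded_linear.linear by blast+
  have sub: "subspace (range f')"
    using lin(1) linear_subspace_image subspace_UNIV by blast
  obtain L where L: "linear L" "\<And>y. y \<in> range f' \<Longrightarrow> f' (L y) = y"
    using linear_exists_right_inverse_on[OF lin(1) subspace_UNIV] by auto
  obtain K where K: "K > 0" "\<And>y. norm (L y) \<le> norm y * K"
    using bounded_linear.pos_bounded[of L] L(1) linear_conv_bounded_linear by blast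
  obtain M where M: "M > 0" "\<And>x. norm (h' x) \<le> norm x * M"
    using bounded_linear.pos_bounded[OF bl] by blast
  \<comment> \<open>\<open>c * t\<close> bounds \<open>norm (X s - a)\<close> for \<open>s\<close>
    in \<open>S\<close>: there \<open>norm s \<le> \<epsilon> * t \<le> t\<close>, so
    \<open>norm (L s) \<le> t * K\<close>. The tolerance \<open>\<epsilon> / c\<close> below thus
    becomes an error of \<open>\<epsilon> * t\<close>.\<close>
  define c where "c = norm \<xi> + K"
  have c: "c > 0" using K(1) by (simp add: c_def add_nonneg_pos)
  have est: "\<bar>h' \<xi>\<bar> \<le> \<epsilon> * (1 + M * K)" if \<epsilon>: "0 < \<epsilon>" "\<epsilon> \<le> 1" for \<epsilon>
  proof -
    have ec: "\<epsilon> / c > 0" using \<epsilon> c by simp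
    obtain d1 where d1: "d1 > 0"
      "\<And>y. norm (y - a) < d1 \<Longrightarrow> norm (f y - f a - f' (y - a)) \<le> \<epsilon> / c * norm (y - a)"
      using f ec unfolding has_derivative_at_alt by blast
    obtain d2 where d2: "d2 > 0"
      "\<And>y. norm (y - a) < d2 \<Longrightarrow> norm (h y - h a - h' (y - a)) \<le> \<epsilon> / c * norm (y - a)"
      using h ec unfolding has_derivative_at_alt by blast
    obtain d3 where d3: "d3 > 0" "ball a d3 \<subseteq> U" using U open_contains_ball by blast
    define d where "d = min d1 (min d2 d3)"
    have d: "d > 0" using d1 d2 d3 by (simp add: d_def)
    define t where "t = d / (2 * c)"
    have t: "t > 0" "c * t < d" using d c by (simp_all add: t_def)
    define X where "X s = a + (t *\<^sub>R \<xi> + L s)" for s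
    have Xa: "X s - a = t *\<^sub>R \<xi> + L s" for s by (simp add: X_def)
    define S where "S = cball 0 (\<epsilon> * t) \<inter> range f'"
    have nX: "norm (X s - a) \<le> c * t" if "s \<in> S" for s
    proof -
      have "norm s \<le> \<epsilon> * t" using that by (simp add: S_def)
      also have "\<dots> \<le> t" using \<epsilon> t by simp
      finally have "norm (L s) \<le> t * K"
        using K(2)[of s] K(1) mult_right_mono[of "norm s" t K] by linarith
      then have "norm (t *\<^sub>R \<xi> + L s) \<le> t * norm \<xi> + t * K"
        using norm_triangle_ineq[of "t *\<^sub>R \<xi>" "L s"] t by simp
      then show ?thesis by (simp add: Xa c_def algebra_simps)
    qed
    have XU: "X s \<in> U" if "s \<in> S" for s
      using nX[OF that] t d3 by (auto simp: d_def dist_norm norm_minus_commute)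
    have f'X: "f' (X s - a) = s" if "s \<in> S" for s
      using that L(2) \<xi> lin(1) unfolding Xa
      by (simp add: linear_add linear_scale S_def)
    have "compact S" unfolding S_def
      using closed_subspace[OF sub] compact_cball by (intro compact_Int_closed) auto
    moreover have "convex S" unfolding S_def
      using sub subspace_imp_convex by (intro convex_Int) auto
    moreover have "0 \<in> S" unfolding S_def using sub \<epsilon> t subspace_0 by auto
    \<comment> \<open>Fixed points of this map are zeros of \<open>f (X s) - f a\<close>. As
      \<open>f' (X s - a) = s\<close>, its value is minus the linearisation error of
      \<open>f\<close>, at most \<open>\<epsilon> * t\<close>; \<open>rng\<close> keeps it in
      \<open>range f'\<close>.\<close>
    moreover have "continuous_on S (\<lambda>s. s - (f (X s) - f a))"
    proof -
      have "continuous_on S X"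
        unfolding X_def using linear_continuous_on[of L S] L(1)
        by (intro continuous_intros) (simp add: linear_conv_bounded_linear)
      then have "continuous_on S (f \<circ> X)"
        using XU cont by (intro continuous_on_compose continuous_on_subset[OF cont]) auto
      then show ?thesis by (intro continuous_intros) (simp add: o_def)
    qed
    moreover have "(\<lambda>s. s - (f (X s) - f a)) \<in> S \<rightarrow> S"
    proof
      fix s assume s: "s \<in> S"
      have "norm (f (X s) - f a - s) \<le> \<epsilon> / c * norm (X s - a)"
        using d1(2)[of "X s"] nX[OF s] t f'X[OF s] by (simp add: d_def)
      also have "\<dots> \<le> \<epsilon> / c * (c * t)"
        using nX[OF s] ec by (intro mult_left_mono) auto
      also have "\<dots> = \<epsilon> * t" using c by simp
      finally have "norm (s - (f (X s) - f a)) \<le> \<epsilon> * t"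
        by (simp add: norm_minus_commute)
      moreover have "s - (f (X s) - f a) \<in> range f'"
        using s rng[OF XU[OF s]] sub by (auto simp: S_def intro: subspace_diff)
      ultimately show "s - (f (X s) - f a) \<in> S" by (simp add: S_def)
    qed
    ultimately obtain s where s: "s \<in> S" "s - (f (X s) - f a) = s"
      using brouwer[of S "\<lambda>s. s - (f (X s) - f a)"] by blast
    then have "h (X s) = h a" using lev[OF XU] by simp
    then have "\<bar>h' (X s - a)\<bar> \<le> \<epsilon> / c * norm (X s - a)"
      using d2(2)[of "X s"] nX[OF s(1)] t by (simp add: d_def)
    also have "\<dots> \<le> \<epsilon> / c * (c * t)"
      using nX[OF s(1)] ec by (intro mult_left_mono) auto
    finally have 1: "\<bar>h' (X s - a)\<bar> \<le> \<epsilon> * t" using c by simp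
    \<comment> \<open>Dividing by \<open>t\<close> isolates \<open>h' \<xi>\<close>, because the
      correction \<open>h' (L s)\<close> is of order \<open>\<epsilon> * t\<close>.\<close>
    have "h' (X s - a) = t * h' \<xi> + h' (L s)"
      unfolding Xa using lin(2) by (simp add: linear_add linear_scale)
    moreover have "\<bar>h' (L s)\<bar> \<le> \<epsilon> * t * K * M"
    proof -
      have "\<bar>h' (L s)\<bar> \<le> norm s * K * M"
        using order_trans[OF M(2)[of "L s"] mult_right_mono[OF K(2)[of s], of M]] M(1) by simp
      also have "\<dots> \<le> \<epsilon> * t * K * M"
        using s(1) K(1) M(1) by (intro mult_right_mono) (auto simp: S_def)
      finally show ?thesis .
    qed
    moreover have "\<bar>t * h' \<xi>\<bar> = t * \<bar>h' \<xi>\<bar>" using t by (simp add: abs_mult)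
    ultimately have "t * \<bar>h' \<xi>\<bar> \<le> \<epsilon> * t + \<epsilon> * t * K * M"
      using 1 by linarith
    then have "t * \<bar>h' \<xi>\<bar> \<le> t * (\<epsilon> * (1 + M * K))" by (simp add: algebra_simps)
    then show ?thesis using t by simp
  qed
  show ?thesis
  proof (rule ccontr)
    assume nz: "h' \<xi> \<noteq> 0"
    have q: "1 + M * K > 0" using M(1) K(1) by (simp add: add_pos_pos)
    have half: "x / (2 * y) * y = x / 2" if "y > 0" for x y :: real using that by simp
    \<comment> \<open>Chosen so that \<open>est\<close> bounds \<open>\<bar>h' \<xi>\<bar>\<close>
      by half of itself.\<close>
    define \<epsilon> where "\<epsilon> = min 1 (\<bar>h' \<xi>\<bar> / (2 * (1 + M * K)))"
    have "\<bar>h' \<xi>\<bar> \<le> \<epsilon> * (1 + M * K)" using est[of \<epsilon>] nz q by (simp add: \<epsilon>_def)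
    also have "\<dots> \<le> \<bar>h' \<xi>\<bar> / (2 * (1 + M * K)) * (1 + M * K)"
      using q by (intro mult_right_mono) (auto simp: \<epsilon>_def)
    also have "\<dots> = \<bar>h' \<xi>\<bar> / 2" by (rule half[OF q])
    finally show False using nz by simp
  qed
qed

section \<open>Hermitian matrices\<close>

lemma matrix_diff_ldistrib: "(A::'a::ring_1^'n^'m) ** (B - C) = A ** B - A ** C"
  by (simp add: matrix_matrix_mult_def vec_eq_iff right_diff_distrib sum_subtractf)

lemma matrix_diff_rdistrib: "(B - C) ** (A::'a::ring_1^'n^'m) = B ** A - C ** A"
  by (simp add: matrix_matrix_mult_def vec_eq_iff left_diff_distrib sum_subtractf)

lemma matrix_add_rdistrib: "(B + C) ** (A::'a::semiring_1^'n^'m) = B ** A + C ** A"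
  by (simp add: matrix_matrix_mult_def vec_eq_iff distrib_right sum.distrib)

lemma matrix_mul_sum_right: "(A::'a::semiring_1^'n^'m) ** (\<Sum>k\<in>I. B k) = (\<Sum>k\<in>I. A ** B k)"
  by (induction I rule: infinite_finite_induct) (simp_all add: matrix_add_ldistrib)

lemma matrix_mul_sum_left: "(\<Sum>k\<in>I. B k) ** (A::'a::semiring_1^'n^'m) = (\<Sum>k\<in>I. B k ** A)"
  by (induction I rule: infinite_finite_induct) (simp_all add: matrix_add_rdistrib)

lemma matrix_vector_mul_sum: "(\<Sum>k\<in>I. B k) *v v = (\<Sum>k\<in>I. (B k :: 'a::semiring_1^'n^'m) *v v)"
  by (induction I rule: infinite_finite_induct) (simp_all add: matrix_vector_mult_add_rdistrib)

lemma mat_mult_component: "(mat c ** A) $ a $ b = c * (A :: 'a::semiring_1^'n^'n) $ a $ b"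
  by (simp add: matrix_matrix_mult_def mat_def if_distrib[of "\<lambda>x. x * _"] cong: if_cong)

lemma mat_mult_vec: "mat c *v v = c *s (v :: 'a::semiring_1^'n)"
  by (simp add: matrix_vector_mult_def mat_def vec_eq_iff if_distrib[of "\<lambda>x. x * _"] cong: if_cong)

lemma mat_mult_commute: "mat c ** A = A ** mat (c :: 'a::comm_semiring_1)"
  by (simp add: vec_eq_iff mat_mult_component)
    (simp add: matrix_matrix_mult_def mat_def if_distrib[of "\<lambda>x. _ * x"] mult.commute cong: if_cong)

lemma mat_mult_mat: "mat c ** mat d = (mat (c * d) :: 'a::semiring_1^'n^'n)"
  by (simp add: vec_eq_iff mat_mult_component) (simp add: mat_def)

lemma mat_add: "mat (c + d) = (mat c + mat d :: 'a::semiring_1^'n^'n)"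
  by (simp add: vec_eq_iff mat_def)

lemma matrix_scaleR_left: "(c *\<^sub>R A) ** B = c *\<^sub>R (A ** B :: complex^'n^'m)"
  by (simp add: matrix_matrix_mult_def vec_eq_iff scaleR_sum_right)

lemma matrix_scaleR_right: "A ** (c *\<^sub>R B) = c *\<^sub>R (A ** B :: complex^'n^'m)"
  by (simp add: matrix_matrix_mult_def vec_eq_iff scaleR_sum_right)

lemma matrix_minus_left: "(- A) ** B = - (A ** B :: 'a::ring_1^'n^'m)"
  by (simp add: matrix_matrix_mult_def vec_eq_iff sum_negf)

lemma matrix_minus_right: "A ** (- B) = - (A ** B :: 'a::ring_1^'n^'m)"
  by (simp add: matrix_matrix_mult_def vec_eq_iff sum_negf)

lemma scale_mat_eq: "scale_mat t A = t *\<^sub>R A"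
  unfolding scale_mat_def vec_eq_iff vec_lambda_beta vector_scaleR_component
  by (simp add: scaleR_conv_of_real)

lemma cadjoint_cadjoint [simp]: "cadjoint (cadjoint A) = A"
  by (simp add: cadjoint_def vec_eq_iff)

lemma cadjoint_add: "cadjoint (A + B) = cadjoint A + cadjoint B"
  by (simp add: cadjoint_def vec_eq_iff)

lemma cadjoint_diff: "cadjoint (A - B) = cadjoint A - cadjoint B"
  by (simp add: cadjoint_def vec_eq_iff)

lemma cadjoint_scaleR: "cadjoint (c *\<^sub>R A) = c *\<^sub>R cadjoint A"
  by (simp add: cadjoint_def vec_eq_iff)

lemma cadjoint_0 [simp]: "cadjoint 0 = 0"
  by (simp add: cadjoint_def vec_eq_iff)

lemma cadjoint_sum: "cadjoint (\<Sum>k\<in>I. A k) = (\<Sum>k\<in>I. cadjoint (A k))"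
  by (induction I rule: infinite_finite_induct) (simp_all add: cadjoint_add)

lemma cadjoint_mat [simp]: "cadjoint (mat c) = mat (cnj c)"
  by (simp add: cadjoint_def vec_eq_iff mat_def)

lemma cadjoint_mult: "cadjoint (A ** B) = cadjoint B ** cadjoint (A :: complex^'d^'d)"
  by (simp add: cadjoint_def vec_eq_iff matrix_matrix_mult_def mult.commute)

lemma cadjoint_outer [simp]: "cadjoint (outer v) = outer v"
  by (simp add: cadjoint_def outer_def vec_eq_iff mult.commute)

lemma hermitian_outer: "hermitian (outer v)"
  by (simp add: hermitian_def)

lemma hermitian_diff: "hermitian A \<Longrightarrow> hermitian B \<Longrightarrow> hermitian (A - B)"
  by (simp add: hermitian_def cadjoint_diff)

lemma hermitian_scaleR: "hermitian A \<Longrightarrow> hermitian (c *\<^sub>R A)"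
  by (simp add: hermitian_def cadjoint_scaleR)

lemma hermitian_sum: "(\<And>k. k \<in> I \<Longrightarrow> hermitian (A k)) \<Longrightarrow> hermitian (\<Sum>k\<in>I. A k)"
  by (simp add: hermitian_def cadjoint_sum)

lemma hermitian_conj: "hermitian A \<Longrightarrow> hermitian (g ** A ** cadjoint g)"
  by (simp add: hermitian_def cadjoint_mult matrix_mul_assoc)

section \<open>The Hermitian inner product and the norms of vectors and matrices\<close>

lemma hinner_add_left: "hinner (u + v) w = hinner u w + hinner v w"
  by (simp add: hinner_def distrib_right sum.distrib)

lemma hinner_add_right: "hinner w (u + v) = hinner w u + hinner w v"
  by (simp add: hinner_def distrib_left sum.distrib)

lemma hinner_diff_left: "hinner (u - v) w = hinner u w - hinner v w"
  by (simp add: hinner_def left_diff_distrib sum_subtractf)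

lemma hinner_diff_right: "hinner w (u - v) = hinner w u - hinner w v"
  by (simp add: hinner_def right_diff_distrib sum_subtractf)

lemma hinner_scale_left: "hinner (c *s v) w = c * hinner v w"
  by (simp add: hinner_def sum_distrib_left mult.assoc)

lemma hinner_scale_right: "hinner v (c *s w) = cnj c * hinner v w"
  by (simp add: hinner_def sum_distrib_left mult_ac)

lemma hinner_scaleR_left: "hinner (c *\<^sub>R v) w = of_real c * hinner v w"
  by (simp add: hinner_def sum_distrib_left mult.assoc) (simp add: scaleR_conv_of_real mult.assoc)

lemma hinner_scaleR_right: "hinner v (c *\<^sub>R w) = of_real c * hinner v w"
  by (simp add: hinner_def sum_distrib_left mult_ac) (simp add: scaleR_conv_of_real mult_ac)

lemma hinner_0_left [simp]: "hinner 0 w = 0"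
  by (simp add: hinner_def)

lemma hinner_0_right [simp]: "hinner w 0 = 0"
  by (simp add: hinner_def)

lemma hinner_sum_left: "hinner (\<Sum>k\<in>I. f k) w = (\<Sum>k\<in>I. hinner (f k) w)"
  by (induction I rule: infinite_finite_induct) (simp_all add: hinner_add_left)

lemma hinner_sum_right: "hinner w (\<Sum>k\<in>I. f k) = (\<Sum>k\<in>I. hinner w (f k))"
  by (induction I rule: infinite_finite_induct) (simp_all add: hinner_add_right)

lemma hinner_commute: "hinner w v = cnj (hinner v w)"
  by (simp add: hinner_def mult.commute)

lemma inner_eq_Re_hinner: "v \<bullet> w = Re (hinner v w)"
  by (simp add: hinner_def inner_vec_def inner_complex_def)

lemma hinner_self: "hinner v v = of_real ((norm v)\<^sup>2)"
proof (rule complex_eqI)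
  show "Re (hinner v v) = Re (of_real ((norm v)\<^sup>2))"
    by (simp add: power2_norm_eq_inner inner_eq_Re_hinner)
  show "Im (hinner v v) = Im (of_real ((norm v)\<^sup>2))"
    using hinner_commute[of v v] by (simp add: complex_eq_iff)
qed

lemma hinner_adjoint: "hinner (A *v v) w = hinner v (cadjoint A *v (w :: complex^'d))"
proof -
  have "hinner (A *v v) w = (\<Sum>a\<in>UNIV. \<Sum>b\<in>UNIV. A $ a $ b * v $ b * cnj (w $ a))"
    by (simp add: hinner_def matrix_vector_mult_def sum_distrib_right)
  also have "\<dots> = (\<Sum>b\<in>UNIV. \<Sum>a\<in>UNIV. A $ a $ b * v $ b * cnj (w $ a))"
    by (rule sum.swap)
  also have "\<dots> = hinner v (cadjoint A *v w)"
    by (simp add: hinner_def matrix_vector_mult_def cadjoint_def sum_distrib_left mult_ac)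
  finally show ?thesis .
qed

lemma hinner_hermitian: "hermitian A \<Longrightarrow> hinner (A *v v) w = hinner v (A *v w)"
  by (simp add: hinner_adjoint hermitian_def)

lemma norm_eq_1_hinner: "norm v = 1 \<longleftrightarrow> hinner v v = 1"
  by (metis hinner_self norm_ge_zero of_real_eq_1_iff power2_eq_1_iff norm_eq_1 norm_eq_sqrt_inner
      power2_norm_eq_inner)

lemma scaleR_eq_scale: "c *\<^sub>R v = of_real c *s (v :: complex^'d)"
  unfolding vec_eq_iff vec_lambda_beta vector_scaleR_component vector_smult_component
  by (simp add: scaleR_conv_of_real)

lemma norm_scale: "norm (c *s (v :: complex^'d)) = cmod c * norm v"
proof -
  have "complex_of_real ((cmod c * norm v)\<^sup>2) = of_real ((cmod c)\<^sup>2) * of_real ((norm v)\<^sup>2)"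
    by (simp add: power_mult_distrib)
  also have "\<dots> = hinner (c *s v) (c *s v)"
    by (simp only: complex_norm_square hinner_self[symmetric] hinner_scale_left hinner_scale_right
        mult_ac)
  finally have "(cmod c * norm v)\<^sup>2 = (norm (c *s v))\<^sup>2"
    unfolding hinner_self of_real_eq_iff .
  then show ?thesis by (simp add: power2_eq_iff_nonneg)
qed

text \<open>Multiplying \<open>v\<close> by a phase makes the product real and nonnegative, which
  reduces the claim to the real inequality.\<close>

lemma hinner_Cauchy_Schwarz: "cmod (hinner v w) \<le> norm v * norm w"
proof (cases "hinner v w = 0")
  case False
  define c where "c = cnj (sgn (hinner v w))"
  have c: "cmod c = 1" using False by (simp add: c_def norm_sgn)
  have "hinner (c *s v) w = of_real (cmod (hinner v w))"
    unfolding hinner_scale_left c_def using False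
    by (simp add: sgn_eq complex_norm_square[symmetric] power2_eq_square mult.commute)
  then have "cmod (hinner v w) = (c *s v) \<bullet> w" by (simp add: inner_eq_Re_hinner)
  also have "\<dots> \<le> norm (c *s v) * norm w" by (rule norm_cauchy_schwarz)
  finally show ?thesis by (simp add: norm_scale c)
qed simp

text \<open>The Euclidean inner product of matrices is the real Hilbert-Schmidt product. Derivatives
  are first written with it and then turned into gradients for \<open>Im Tr\<close>.\<close>

lemma inner_eq_trace: "A \<bullet> B = Re (trace (A ** cadjoint (B :: complex^'d^'d)))"
  by (simp add: inner_vec_def inner_complex_def trace_def matrix_matrix_mult_def cadjoint_def)

lemma trace_mult_outer: "trace (A ** outer v) = hinner (A *v v) v"
  by (simp add: trace_def matrix_matrix_mult_def outer_def hinner_def matrix_vector_mult_def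
      sum_distrib_right mult.assoc)

lemma inner_outer: "A \<bullet> outer v = Re (hinner (A *v v) v)"
  by (simp add: inner_eq_trace trace_mult_outer)

lemma trace_scaleR: "trace (c *\<^sub>R A) = of_real c * trace (A :: complex^'d^'d)"
  unfolding trace_def by (simp add: sum_distrib_left) (simp add: scaleR_conv_of_real)

lemma scaleR_matrix_mult_vec: "(c *\<^sub>R A) *v v = c *\<^sub>R (A *v v :: complex^'d)"
  by (simp add: matrix_vector_mult_def vec_eq_iff scaleR_sum_right)

lemma outer_unitary: "g ** outer w ** cadjoint g = outer (g *v w)"
  by (simp add: vec_eq_iff outer_def cadjoint_def matrix_matrix_mult_def matrix_vector_mult_def
      sum_product sum_distrib_left sum_distrib_right mult_ac)

lemma bilinear_matrix_mult: "bilinear (\<lambda>A B :: complex^'d^'d. A ** B)"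
  by (auto simp: bilinear_def matrix_add_ldistrib matrix_add_rdistrib matrix_scaleR_left matrix_scaleR_right
      intro!: linearI)

lemma norm_outer: "norm (outer v) = (norm v)\<^sup>2"
proof -
  have "(norm (outer v))\<^sup>2 = ((norm v)\<^sup>2)\<^sup>2"
    by (simp add: power2_norm_eq_inner inner_outer outer_mult_vec hinner_scale_left)
      (simp add: hinner_self power2_eq_square dot_square_norm)
  then show ?thesis by (rule power2_eq_imp_eq) simp_all
qed

text \<open>\<open>norm A\<close> is the Frobenius norm, so this is Cauchy-Schwarz applied to each
  row.\<close>

lemma norm_matrix_vector: "norm (A *v v) \<le> norm A * norm (v :: complex^'d)" for A :: "complex^'d^'d"
proof -
  have "(norm (A *v v))\<^sup>2 = (\<Sum>a\<in>UNIV. (cmod ((A *v v) $ a))\<^sup>2)"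
    by (simp add: norm_vec_def L2_set_def sum_nonneg)
  also have "\<dots> \<le> (\<Sum>a\<in>UNIV. (norm (A $ a) * norm v)\<^sup>2)"
  proof (intro sum_mono power_mono)
    fix a
    have "(A *v v) $ a = hinner v (\<chi> b. cnj (A $ a $ b))"
      by (simp add: matrix_vector_mult_def hinner_def mult.commute)
    moreover have "norm (\<chi> b. cnj (A $ a $ b)) = norm (A $ a)"
      by (simp add: norm_vec_def)
    ultimately show "cmod ((A *v v) $ a) \<le> norm (A $ a) * norm v"
      using hinner_Cauchy_Schwarz[of v "\<chi> b. cnj (A $ a $ b)"] by (simp add: mult.commute)
  qed simp
  also have "\<dots> = (norm A * norm v)\<^sup>2"
    by (simp add: power_mult_distrib sum_distrib_right[symmetric])
      (simp add: norm_vec_def[of A] L2_set_def sum_nonneg)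
  finally show ?thesis by (simp add: power2_le_iff_abs_le)
qed

section \<open>The spectral theorem\<close>

lemma matrix_vector_mult_scaleR_vec: "(A :: complex^'d^'d) *v (c *\<^sub>R v) = c *\<^sub>R (A *v v)"
  by (simp add: scaleR_eq_scale vector_scalar_commute)

text \<open>Families are indexed by \<open>nat\<close> and only the first \<open>k\<close> members
  are constrained: the top eigenvectors are then a prefix of an eigenbasis, and a vector is appended
  by a function update.\<close>

definition orthonormal :: "(nat \<Rightarrow> complex^'d) \<Rightarrow> nat \<Rightarrow> bool" where
  "orthonormal u k \<longleftrightarrow> (\<forall>i<k. \<forall>j<k. hinner (u i) (u j) = (if i = j then 1 else 0))"

lemma orthonormalD:
  "orthonormal u k \<Longrightarrow> i < k \<Longrightarrow> j < k \<Longrightarrow> hinner (u i) (u j) = (if i = j then 1 else 0)"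
  by (simp add: orthonormal_def)

lemma orthonormal_norm: "orthonormal u k \<Longrightarrow> i < k \<Longrightarrow> norm (u i) = 1"
  by (simp add: orthonormalD norm_eq_1_hinner)

lemma orthonormal_mono: "orthonormal u k \<Longrightarrow> j \<le> k \<Longrightarrow> orthonormal u j"
  by (simp add: orthonormal_def)

text \<open>Complex orthogonality to \<open>u i\<close> is real orthogonality to both
  \<open>u i\<close> and \<open>\<i> *s u i\<close>. These are at most \<open>2 * k\<close> vectors
  in a real space of dimension \<open>2 * CARD('d)\<close>.\<close>

lemma ex_unit_orthogonal:
  fixes u :: "nat \<Rightarrow> complex^'d"
  assumes "k < CARD('d)"
  obtains v where "norm v = 1" "\<And>i. i < k \<Longrightarrow> hinner v (u i) = 0"
proof -
  define S where "S = u ` {..<k} \<union> (\<lambda>i. \<i> *s u i) ` {..<k}"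
  have "card S \<le> k + k"
    using card_Un_le[of "u ` {..<k}" "(\<lambda>i. \<i> *s u i) ` {..<k}"] card_image_le[of "{..<k}" u]
      card_image_le[of "{..<k}" "\<lambda>i. \<i> *s u i"] by (simp add: S_def)
  then have "dim S < DIM(complex^'d)"
    using assms dim_le_card'[of S] by (simp add: S_def)
  then obtain x where x: "x \<noteq> 0" "\<And>y. y \<in> span S \<Longrightarrow> orthogonal x y"
    using orthogonal_to_subspace_exists by blast
  have "hinner x (u i) = 0" if "i < k" for i
  proof -
    have "u i \<in> span S" "\<i> *s u i \<in> span S"
      using that by (auto simp: S_def intro!: span_base)
    then have "Re (hinner x (u i)) = 0" "Re (hinner x (\<i> *s u i)) = 0"
      using x(2) by (auto simp: orthogonal_def inner_eq_Re_hinner)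
    then show ?thesis by (simp add: hinner_scale_right complex_eq_iff)
  qed
  then show ?thesis using that[of "(1 / norm x) *\<^sub>R x"] x(1) by (simp add: hinner_scaleR_left)
qed

text \<open>The vectors are the columns of a square \<open>U\<close> with
  \<open>cadjoint U ** U = mat 1\<close>. A left inverse is also a right inverse, and
  \<open>U ** cadjoint U\<close> is the sum of the outer products.\<close>

lemma sum_outer_orthonormal:
  fixes u :: "nat \<Rightarrow> complex^'d"
  assumes "orthonormal u CARD('d)"
  shows "(\<Sum>i<CARD('d). outer (u i)) = mat 1"
proof -
  obtain f :: "'d \<Rightarrow> nat" where f: "bij_betw f UNIV {..<CARD('d)}"
    using ex_bij_betw_finite_nat[of "UNIV :: 'd set"] by (auto simp: atLeast0LessThan)
  define U :: "complex^'d^'d" where "U = (\<chi> a b. u (f b) $ a)"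
  have fb: "f b < CARD('d)" for b using f by (auto simp: bij_betw_def)
  have "(cadjoint U ** U) $ a $ b = mat 1 $ a $ b" for a b
  proof -
    have "(cadjoint U ** U) $ a $ b = hinner (u (f b)) (u (f a))"
      by (simp add: cadjoint_def U_def matrix_matrix_mult_def hinner_def mult.commute)
    then show ?thesis
      using f by (auto simp: orthonormalD[OF assms fb fb] mat_def bij_betw_def inj_on_def)
  qed
  then have "cadjoint U ** U = mat 1" by (simp add: vec_eq_iff)
  then have "U ** cadjoint U = mat 1" using matrix_left_right_inverse by blast
  moreover have "U ** cadjoint U = (\<Sum>b\<in>UNIV. outer (u (f b)))"
    by (simp add: vec_eq_iff U_def cadjoint_def matrix_matrix_mult_def outer_def)
  moreover have "\<dots> = (\<Sum>i<CARD('d). outer (u i))"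
    using sum.reindex_bij_betw[OF f, of "\<lambda>i. outer (u i)"] .
  ultimately show ?thesis by simp
qed

lemma orthonormal_expand:
  fixes u :: "nat \<Rightarrow> complex^'d"
  assumes "orthonormal u CARD('d)"
  shows "v = (\<Sum>i<CARD('d). hinner v (u i) *s u i)"
proof -
  have "v = (\<Sum>i<CARD('d). outer (u i)) *v v"
    using sum_outer_orthonormal[OF assms] by simp
  then show ?thesis by (simp add: matrix_vector_mul_sum outer_mult_vec)
qed

lemma orthonormal_Parseval:
  fixes u :: "nat \<Rightarrow> complex^'d"
  assumes "orthonormal u CARD('d)"
  shows "hinner v w = (\<Sum>i<CARD('d). hinner v (u i) * hinner (u i) w)"
proof -
  have "hinner v w = hinner (\<Sum>i<CARD('d). hinner v (u i) *s u i) w"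
    by (rule arg_cong[OF orthonormal_expand[OF assms]])
  then show ?thesis by (simp only: hinner_sum_left hinner_scale_left)
qed

text \<open>\<open>v\<close> maximises the quadratic form of \<open>A\<close> on the unit sphere of
  the orthogonal complement of the given eigenvectors, which \<open>A\<close> preserves. The
  maximality clause is exported because it orders the eigenvalues later.\<close>

lemma hermitian_eigenvector_orthogonal:
  fixes u :: "nat \<Rightarrow> complex^'d"
  assumes A: "hermitian A" and k: "k < CARD('d)"
    and eig: "\<And>i. i < k \<Longrightarrow> A *v u i = of_real (\<alpha> i) *s u i"
  shows "\<exists>v x. norm v = 1 \<and> (\<forall>i<k. hinner v (u i) = 0) \<and> A *v v = of_real x *s v \<and>
    (\<forall>w. (\<forall>i<k. hinner w (u i) = 0) \<longrightarrow> Re (hinner (A *v w) w) \<le> x * (norm w)\<^sup>2)"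
proof -
  define W where "W = {w. \<forall>i<k. hinner w (u i) = 0}"
  define q where "q w = Re (hinner (A *v w) w)" for w
  have contq: "continuous_on X q" for X
    unfolding q_def inner_eq_Re_hinner[symmetric]
    by (intro continuous_intros linear_continuous_on matrix_vector_mul_bounded_linear)
  have "closed {w. hinner w (u i) = 0}" for i
    unfolding hinner_def
    by (intro closed_Collect_eq continuous_intros) 
  then have "closed (\<Inter>i\<in>{..<k}. {w. hinner w (u i) = 0})" by (intro closed_INT) auto
  moreover have "W = (\<Inter>i\<in>{..<k}. {w. hinner w (u i) = 0})" by (auto simp: W_def)
  ultimately have "closed W" by simp
  then have "compact (sphere 0 1 \<inter> W)" by (intro compact_Int_closed) auto
  moreover obtain v0 where "norm v0 = 1" "\<And>i. i < k \<Longrightarrow> hinner v0 (u i) = 0"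
    using ex_unit_orthogonal[OF k, of u] by metis
  then have "v0 \<in> sphere 0 1 \<inter> W" by (simp add: W_def)
  then have "sphere 0 1 \<inter> W \<noteq> {}" by blast
  ultimately obtain v where v': "v \<in> sphere 0 1 \<inter> W" "\<forall>w \<in> sphere 0 1 \<inter> W. q w \<le> q v"
    using continuous_attains_sup[OF _ _ contq] by blast
  then have v: "norm v = 1" "v \<in> W" "\<And>w. norm w = 1 \<Longrightarrow> w \<in> W \<Longrightarrow> q w \<le> q v"
    by auto
  have scaleW: "c *\<^sub>R w \<in> W" if "w \<in> W" for c w
    using that by (simp add: W_def hinner_scaleR_left)
  have q_scale: "q (c *\<^sub>R w) = c\<^sup>2 * q w" for c w
    by (simp add: q_def matrix_vector_mult_scaleR_vec hinner_scaleR_left hinner_scaleR_right power2_eq_square)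
  have max: "q w \<le> q v * (norm w)\<^sup>2" if "w \<in> W" for w
  proof (cases "w = 0")
    case False
    have "q ((1 / norm w) *\<^sub>R w) \<le> q v"
      using False by (intro v(3) scaleW[OF that]) simp
    then have "q w / (norm w)\<^sup>2 \<le> q v" by (simp add: q_scale power_divide)
    then show ?thesis using False by (simp add: pos_divide_le_eq)
  qed (simp add: q_def)
  \<comment> \<open>The residual of the maximiser is a direction of ascent: moving along it by
    \<open>t\<close> gains \<open>2 * t * (norm z)\<^sup>2\<close> to first order, which contradicts
    maximality unless \<open>z = 0\<close>.\<close>
  define z where "z = A *v v - of_real (q v) *s v"
  have zW: "z \<in> W"
  proof -
    have "hinner (A *v v) (u i) = 0" if "i < k" for i
      using that v(2) by (simp add: hinner_hermitian[OF A] eig hinner_scale_right W_def)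
    then show ?thesis using v(2) by (simp add: W_def z_def hinner_diff_left hinner_scale_left)
  qed
  have pert: "2 * t * (norm z)\<^sup>2 + t\<^sup>2 * (q z - q v * (norm z)\<^sup>2) \<le> 0" for t :: real
  proof -
    have "v + t *\<^sub>R z \<in> W"
      using v(2) zW by (simp add: W_def hinner_add_left hinner_scaleR_left)
    then have "q (v + t *\<^sub>R z) \<le> q v * (norm (v + t *\<^sub>R z))\<^sup>2" by (rule max)
    moreover have "q (v + t *\<^sub>R z) = q v + 2 * t * ((A *v v) \<bullet> z) + t\<^sup>2 * q z"
    proof -
      have e: "(x + t *\<^sub>R y) \<bullet> (v + t *\<^sub>R z) = x \<bullet> v + t * (x \<bullet> z) + t * (y \<bullet> v) + t\<^sup>2 * (y \<bullet> z)"
        for x y by (simp add: inner_add_left inner_add_right power2_eq_square distrib_left)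
      have "q (v + t *\<^sub>R z) = (A *v v + t *\<^sub>R (A *v z)) \<bullet> (v + t *\<^sub>R z)"
        by (simp add: q_def inner_eq_Re_hinner matrix_vector_right_distrib matrix_vector_mult_scaleR_vec)
      moreover have "(A *v z) \<bullet> v = (A *v v) \<bullet> z"
        by (metis hinner_hermitian[OF A] inner_eq_Re_hinner inner_commute)
      ultimately show ?thesis by (simp add: e) (simp add: q_def inner_eq_Re_hinner)
    qed
    moreover have "(norm (v + t *\<^sub>R z))\<^sup>2 = 1 + 2 * t * (v \<bullet> z) + t\<^sup>2 * (norm z)\<^sup>2"
    proof -
      have "(norm (v + t *\<^sub>R z))\<^sup>2 = v \<bullet> v + 2 * t * (v \<bullet> z) + t\<^sup>2 * (norm z)\<^sup>2"
        unfolding power2_norm_eq_inner unfolding inner_add_left inner_add_right inner_scaleR_left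
          inner_scaleR_right inner_commute[of z v] by (simp only: power2_eq_square distrib_left mult_ac mult_2)
      then show ?thesis using v(1) by (simp add: norm_eq_1)
    qed
    moreover have "(A *v v) \<bullet> z - q v * (v \<bullet> z) = (norm z)\<^sup>2"
    proof -
      have "(A *v v) \<bullet> z - q v * (v \<bullet> z) = (A *v v - q v *\<^sub>R v) \<bullet> z"
        by (simp only: inner_diff_left inner_scaleR_left)
      then show ?thesis by (simp only: z_def scaleR_eq_scale power2_norm_eq_inner)
    qed
    then have "(A *v v) \<bullet> z = q v * (v \<bullet> z) + (norm z)\<^sup>2" by linarith
    ultimately have "q v + 2 * t * (q v * (v \<bullet> z) + (norm z)\<^sup>2) + t\<^sup>2 * q z
        \<le> q v * (1 + 2 * t * (v \<bullet> z) + t\<^sup>2 * (norm z)\<^sup>2)" by (simp only:)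
    then show ?thesis by (simp add: distrib_left right_diff_distrib mult_ac)
  qed
  have "norm z = 0"
  proof (rule ccontr)
    assume "norm z \<noteq> 0"
    then have pos: "(norm z)\<^sup>2 > 0" by simp
    define D where "D = \<bar>q z - q v * (norm z)\<^sup>2\<bar> + 1"
    \<comment> \<open>With this \<open>t\<close> the quadratic term can cancel at most half of the
      linear gain \<open>2 * t * (norm z)\<^sup>2\<close>.\<close>
    define t where "t = (norm z)\<^sup>2 / D"
    have D: "D > 0" "- D \<le> q z - q v * (norm z)\<^sup>2" by (auto simp: D_def)
    have t: "t > 0" "t * D = (norm z)\<^sup>2" using pos D(1) by (simp_all add: t_def)
    have "t\<^sup>2 * (- D) \<le> t\<^sup>2 * (q z - q v * (norm z)\<^sup>2)"
      using D(2) by (intro mult_left_mono) auto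
    moreover have "t\<^sup>2 * (- D) = - (t * (norm z)\<^sup>2)"
      using t(2) by (simp add: power2_eq_square mult.assoc)
    ultimately have "t * (norm z)\<^sup>2 \<le> 0" using pert[of t] by linarith
    moreover have "t * (norm z)\<^sup>2 > 0" using t pos by simp
    ultimately show False by linarith
  qed
  then have "A *v v = of_real (q v) *s v" by (simp add: z_def)
  moreover have "\<forall>w. (\<forall>i<k. hinner w (u i) = 0) \<longrightarrow> Re (hinner (A *v w) w) \<le> q v * (norm w)\<^sup>2"
    using max by (simp add: W_def q_def)
  moreover have "\<forall>i<k. hinner v (u i) = 0" using v(2) by (simp add: W_def)
  ultimately show ?thesis using v(1) by blast
qed

text \<open>The induction keeps the maximality of each eigenvalue on the complement of its
  predecessors. A later vector lies in that complement, so its eigenvalue is no larger.\<close>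

lemma hermitian_eigenbasis:
  fixes A :: "complex^'d^'d"
  assumes A: "hermitian A"
  shows "\<exists>u \<alpha>. orthonormal u CARD('d) \<and> (\<forall>i<CARD('d). A *v u i = of_real (\<alpha> i) *s u i) \<and>
    (\<forall>j<CARD('d). \<forall>i\<le>j. \<alpha> j \<le> \<alpha> i)"
proof -
  have "\<exists>u \<alpha>. orthonormal u k \<and> (\<forall>i<k. A *v u i = of_real (\<alpha> i) *s u i) \<and>
    (\<forall>i<k. \<forall>w. (\<forall>j<i. hinner w (u j) = 0) \<longrightarrow> Re (hinner (A *v w) w) \<le> \<alpha> i * (norm w)\<^sup>2)"
    if "k \<le> CARD('d)" for k
    using that
  proof (induction k)
    case 0
    show ?case by (simp add: orthonormal_def)
  next
    case (Suc k)
    then have k: "k \<le> CARD('d)" "k < CARD('d)" by simp_all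
    obtain u \<alpha> where u: "orthonormal u k" "\<forall>i<k. A *v u i = of_real (\<alpha> i) *s u i"
      "\<forall>i<k. \<forall>w. (\<forall>j<i. hinner w (u j) = 0) \<longrightarrow> Re (hinner (A *v w) w) \<le> \<alpha> i * (norm w)\<^sup>2"
      using Suc.IH[OF k(1)] by blast
    obtain v x where v: "norm v = 1" "\<forall>i<k. hinner v (u i) = 0" "A *v v = of_real x *s v"
      "\<forall>w. (\<forall>i<k. hinner w (u i) = 0) \<longrightarrow> Re (hinner (A *v w) w) \<le> x * (norm w)\<^sup>2"
      using hermitian_eigenvector_orthogonal[OF A k(2), of u \<alpha>] u(2) by blast
    have "hinner (u i) v = 0" if "i < k" for i
      using v(2) that hinner_commute[of "u i" v] by simp
    then have "orthonormal (u(k := v)) (Suc k)"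
      using u(1) v(1,2) by (auto simp: orthonormal_def norm_eq_1_hinner less_Suc_eq)
    moreover have "\<forall>i<Suc k. A *v (u(k := v)) i = of_real ((\<alpha>(k := x)) i) *s (u(k := v)) i"
      using u(2) v(3) by (auto simp: less_Suc_eq)
    moreover have "\<forall>i<Suc k. \<forall>w. (\<forall>j<i. hinner w ((u(k := v)) j) = 0) \<longrightarrow>
        Re (hinner (A *v w) w) \<le> (\<alpha>(k := x)) i * (norm w)\<^sup>2"
      using u(3) v(4) by (auto simp: less_Suc_eq)
    ultimately show ?case by blast
  qed
  then obtain u \<alpha> where u: "orthonormal u CARD('d)" "\<forall>i<CARD('d). A *v u i = of_real (\<alpha> i) *s u i"
    "\<forall>i<CARD('d). \<forall>w. (\<forall>j<i. hinner w (u j) = 0) \<longrightarrow> Re (hinner (A *v w) w) \<le> \<alpha> i * (norm w)\<^sup>2"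
    by blast
  have "\<alpha> j \<le> \<alpha> i" if "j < CARD('d)" "i \<le> j" for i j
  proof -
    have "\<forall>l<i. hinner (u j) (u l) = 0" using that orthonormalD[OF u(1)] by auto
    then have "Re (hinner (A *v u j) (u j)) \<le> \<alpha> i * (norm (u j))\<^sup>2"
      using u(3) that by auto
    then show ?thesis
      using that u(2) orthonormal_norm[OF u(1)] by (simp add: hinner_scale_left hinner_self)
  qed
  then show ?thesis using u by blast
qed

lemma eigenvector_in_eigenbasis:
  fixes A :: "complex^'d^'d"
  assumes u: "orthonormal u CARD('d)" and eig: "\<And>i. i < CARD('d) \<Longrightarrow> A *v u i = of_real (\<alpha> i) *s u i"
    and v: "A *v v = of_real x *s v" and i: "i < CARD('d)" "\<alpha> i \<noteq> x"
  shows "hinner v (u i) = 0"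
proof -
  have "A *v v = A *v (\<Sum>j<CARD('d). hinner v (u j) *s u j)"
    by (rule arg_cong[OF orthonormal_expand[OF u]])
  also have "\<dots> = (\<Sum>j<CARD('d). A *v (hinner v (u j) *s u j))"
    by (rule vec.linear_sum[OF matrix_vector_mul_linear_gen])
  also have "\<dots> = (\<Sum>j<CARD('d). (of_real (\<alpha> j) * hinner v (u j)) *s u j)"
    by (intro sum.cong) (simp_all add: vector_scalar_commute eig mult.commute)
  finally have "A *v v = (\<Sum>j<CARD('d). (of_real (\<alpha> j) * hinner v (u j)) *s u j)" .
  then have "hinner (A *v v) (u i) = of_real (\<alpha> i) * hinner v (u i)"
    using i(1) by (simp add: hinner_sum_left hinner_scale_left orthonormalD[OF u] if_distrib cong: if_cong)
  then show ?thesis using i(2) by (simp add: v hinner_scale_left)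
qed

lemma orthonormal_inj: "orthonormal u k \<Longrightarrow> inj_on u {..<k}"
  by (auto simp: inj_on_def orthonormal_def) (metis zero_neq_one)

lemma orthonormal_independent:
  assumes "orthonormal u k" "I \<subseteq> {..<k}"
  shows "vec.independent (u ` I)"
proof -
  have fin: "finite I" using assms(2) finite_subset by blast
  have inj: "inj_on u I" using orthonormal_inj[OF assms(1)] assms(2) inj_on_subset by blast
  have "\<forall>v\<in>u ` I. c v = 0" if c: "(\<Sum>v\<in>u ` I. c v *s v) = 0" for c
  proof
    fix v assume "v \<in> u ` I"
    then obtain i where i: "i \<in> I" "v = u i" by blast
    have "0 = hinner (\<Sum>j\<in>I. c (u j) *s u j) (u i)"
      using c inj by (simp add: sum.reindex)
    also have "\<dots> = (\<Sum>j\<in>I. c (u j) * (if j = i then 1 else 0))"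
    proof -
      have "hinner (u j) (u i) = (if j = i then 1 else 0)" if "j \<in> I" for j
        using that i(1) assms(2) by (intro orthonormalD[OF assms(1)]) auto
      then show ?thesis by (simp add: hinner_sum_left hinner_scale_left)
    qed
    also have "\<dots> = c v" using i fin by (simp add: if_distrib cong: if_cong)
    finally show "c v = 0" by simp
  qed
  then show ?thesis using fin by (simp add: vec.independent_if_scalars_zero vec.dependent_finite) blast
qed

text \<open>Any ordered orthonormal eigenbasis computes \<open>eigenvalue_list\<close>: the
  eigenspace of \<open>x\<close> is spanned by the \<open>u i\<close> with
  \<open>\<alpha> i = x\<close>, so dimensions count occurrences in \<open>\<alpha>\<close>, and
  both sides are sorted in decreasing order.\<close>

lemma eigenvalue_list_eqI:
  fixes A :: "complex^'d^'d"
  assumes u: "orthonormal u CARD('d)" and eig: "\<And>i. i < CARD('d) \<Longrightarrow> A *v u i = of_real (\<alpha> i) *s u i"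
    and anti: "\<And>i j. i \<le> j \<Longrightarrow> j < CARD('d) \<Longrightarrow> \<alpha> j \<le> \<alpha> i"
  shows "eigenvalue_list A = map \<alpha> [0..<CARD('d)]"
proof -
  define I where "I x = {i \<in> {..<CARD('d)}. \<alpha> i = x}" for x
  have espan: "eigenspace A x = vec.span (u ` I x)" for x
  proof
    show "eigenspace A x \<subseteq> vec.span (u ` I x)"
    proof
      fix v assume "v \<in> eigenspace A x"
      then have v: "A *v v = of_real x *s v" by (simp add: eigenspace_def)
      have "v = (\<Sum>i<CARD('d). hinner v (u i) *s u i)" by (rule orthonormal_expand[OF u])
      also have "\<dots> = (\<Sum>i\<in>I x. hinner v (u i) *s u i)"
        using eigenvector_in_eigenbasis[OF u eig v] by (intro sum.mono_neutral_right) (auto simp: I_def)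
      also have "\<dots> \<in> vec.span (u ` I x)"
        by (intro vec.span_sum vec.span_scale vec.span_base) auto
      finally show "v \<in> vec.span (u ` I x)" .
    qed
    have "vec.subspace (eigenspace A x)"
      by (auto simp: eigenspace_def vec.subspace_def matrix_vector_right_distrib vec.scale
          vector_scalar_commute vector_add_ldistrib vector_smult_assoc mult.commute)
    moreover have "u ` I x \<subseteq> eigenspace A x" using eig by (auto simp: I_def eigenspace_def)
    ultimately show "vec.span (u ` I x) \<subseteq> eigenspace A x" by (rule vec.span_minimal[rotated])
  qed
  have edim: "vec.dim (eigenspace A x) = card (I x)" for x
  proof -
    have "vec.independent (u ` I x)" by (rule orthonormal_independent[OF u]) (auto simp: I_def)
    then have "vec.dim (eigenspace A x) = card (u ` I x)"
      by (simp add: espan vec.dim_eq_card_independent)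
    also have "\<dots> = card (I x)"
      by (rule card_image, rule inj_on_subset[OF orthonormal_inj[OF u]]) (auto simp: I_def)
    finally show ?thesis .
  qed
  have ev: "real_eigenvalues A = \<alpha> ` {..<CARD('d)}"
  proof -
    have "x \<in> real_eigenvalues A \<longleftrightarrow> I x \<noteq> {}" for x
    proof
      assume "x \<in> real_eigenvalues A"
      then obtain v where "v \<in> vec.span (u ` I x)" "v \<noteq> 0"
        by (auto simp: real_eigenvalues_def espan)
      then show "I x \<noteq> {}" by auto
    next
      assume "I x \<noteq> {}"
      then obtain i where i: "i \<in> I x" by blast
      then have "u i \<in> eigenspace A x" unfolding espan by (simp add: vec.span_base)
      moreover have "u i \<noteq> 0" using orthonormal_norm[OF u] i by (force simp: I_def)
      ultimately show "x \<in> real_eigenvalues A" by (auto simp: real_eigenvalues_def)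
    qed
    then show ?thesis by (auto simp: I_def)
  qed
  have "(\<Sum>x\<in>real_eigenvalues A. replicate_mset (vec.dim (eigenspace A x)) x)
      = mset (map \<alpha> [0..<CARD('d)])"
  proof (rule multiset_eqI)
    fix y
    have "count (\<Sum>x\<in>real_eigenvalues A. replicate_mset (vec.dim (eigenspace A x)) x) y
        = (\<Sum>x\<in>\<alpha> ` {..<CARD('d)}. if x = y then card (I y) else 0)"
      by (auto simp: count_sum ev edim intro!: sum.cong)
    also have "\<dots> = card (I y)" by (auto simp: I_def)
    also have "\<dots> = count (mset (map \<alpha> [0..<CARD('d)])) y"
      by (simp add: count_image_mset_eq_card_vimage I_def atLeast0LessThan)
    finally show "count (\<Sum>x\<in>real_eigenvalues A. replicate_mset (vec.dim (eigenspace A x)) x) y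
        = count (mset (map \<alpha> [0..<CARD('d)])) y" .
  qed
  moreover have "sort (map \<alpha> [0..<CARD('d)]) = rev (map \<alpha> [0..<CARD('d)])"
  proof (rule properties_for_sort)
    show "sorted (rev (map \<alpha> [0..<CARD('d)]))"
      using anti by (auto simp: sorted_iff_nth_mono rev_nth)
  qed simp
  ultimately show ?thesis
    unfolding eigenvalue_list_def by (simp only: sorted_list_of_multiset_mset rev_rev_ident)
qed

text \<open>Indexed from \<open>0\<close>, unlike \<^const>\<open>lam\<close>.\<close>
definition eigenvalue :: "complex^'d^'d \<Rightarrow> nat \<Rightarrow> real" where
  "eigenvalue A i = eigenvalue_list A ! i"

definition eigenbasis :: "complex^'d^'d \<Rightarrow> (nat \<Rightarrow> complex^'d) \<Rightarrow> bool" where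
  "eigenbasis A u \<longleftrightarrow> orthonormal u CARD('d) \<and>
     (\<forall>i<CARD('d). A *v u i = of_real (eigenvalue A i) *s u i)"

lemma ex_eigenbasis: "hermitian A \<Longrightarrow> \<exists>u. eigenbasis A u"
proof -
  assume "hermitian A"
  from hermitian_eigenbasis[OF this] obtain u \<alpha> where u: "orthonormal u CARD('a)"
    "\<And>i. i < CARD('a) \<Longrightarrow> A *v u i = of_real (\<alpha> i) *s u i"
    "\<And>i j. i \<le> j \<Longrightarrow> j < CARD('a) \<Longrightarrow> \<alpha> j \<le> \<alpha> i" by blast
  then show ?thesis
    using eigenvalue_list_eqI[OF u] by (auto simp: eigenbasis_def eigenvalue_def)
qed

lemma eigenvalue_antimono:
  assumes "hermitian (A :: complex^'d^'d)" "i \<le> j" "j < CARD('d)"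
  shows "eigenvalue A j \<le> eigenvalue A i"
proof -
  from hermitian_eigenbasis[OF assms(1)] obtain u \<alpha> where u: "orthonormal u CARD('d)"
    "\<And>i. i < CARD('d) \<Longrightarrow> A *v u i = of_real (\<alpha> i) *s u i"
    "\<And>i j. i \<le> j \<Longrightarrow> j < CARD('d) \<Longrightarrow> \<alpha> j \<le> \<alpha> i" by blast
  then show ?thesis using assms by (simp add: eigenvalue_def eigenvalue_list_eqI[OF u])
qed

lemma eigenbasisD:
  assumes "eigenbasis (A :: complex^'d^'d) u"
  shows "orthonormal u CARD('d)" "i < CARD('d) \<Longrightarrow> A *v u i = of_real (eigenvalue A i) *s u i"
  using assms by (simp_all add: eigenbasis_def)

lemma eigenvalue_unitary_conj:
  assumes A: "hermitian (A :: complex^'d^'d)" and g: "unitary g" and u: "eigenbasis A u"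
  shows "eigenvalue (g ** A ** cadjoint g) = eigenvalue A"
    and "eigenbasis (g ** A ** cadjoint g) (\<lambda>i. g *v u i)"
proof -
  have g': "cadjoint g ** g = mat 1"
    using g matrix_left_right_inverse by (auto simp: unitary_def)
  have on: "orthonormal (\<lambda>i. g *v u i) CARD('d)"
    using eigenbasisD(1)[OF u] g'
    by (simp add: orthonormal_def hinner_adjoint matrix_vector_mul_assoc)
  have eig: "(g ** A ** cadjoint g) *v (g *v u i) = of_real (eigenvalue A i) *s (g *v u i)"
    if "i < CARD('d)" for i
  proof -
    have "(g ** A ** cadjoint g) *v (g *v u i) = g *v (A *v (cadjoint g ** g *v u i))"
      by (simp add: matrix_vector_mul_assoc matrix_mul_assoc)
    then show ?thesis using eigenbasisD(2)[OF u that] g' by (simp add: vector_scalar_commute)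
  qed
  have *: "eigenvalue_list (g ** A ** cadjoint g) = map (eigenvalue A) [0..<CARD('d)]"
    using eigenvalue_antimono[OF A] by (intro eigenvalue_list_eqI[OF on eig]) auto
  moreover have "eigenvalue_list A = map (eigenvalue A) [0..<CARD('d)]"
    using eigenvalue_antimono[OF A] by (intro eigenvalue_list_eqI[OF eigenbasisD[OF u]]) auto
  ultimately show e: "eigenvalue (g ** A ** cadjoint g) = eigenvalue A"
    by (intro ext) (metis eigenvalue_def)
  show "eigenbasis (g ** A ** cadjoint g) (\<lambda>i. g *v u i)"
    using on eig by (simp add: eigenbasis_def e)
qed

lemma eigenvalue_of_eigenvector:
  assumes A: "hermitian (A :: complex^'d^'d)" and v: "A *v v = of_real x *s v" "v \<noteq> 0"
  obtains i where "i < CARD('d)" "eigenvalue A i = x"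
proof -
  obtain u where u: "eigenbasis A u" using ex_eigenbasis[OF A] ..
  have "\<exists>i<CARD('d). eigenvalue A i = x"
  proof (rule ccontr)
    assume "\<not> ?thesis"
    then have "hinner v (u i) = 0" if "i < CARD('d)" for i
      using eigenvector_in_eigenbasis[OF eigenbasisD[OF u] v(1)] that by blast
    then have "v = 0" using orthonormal_expand[OF eigenbasisD(1)[OF u], of v] by simp
    then show False using v(2) by simp
  qed
  then show ?thesis using that by blast
qed

section \<open>Spectral projections\<close>

text \<open>The sesquilinear form whose diagonal is \<open>outer\<close>; it expresses products with
  \<open>outer\<close> and its derivative.\<close>

definition rank1 :: "complex^'d \<Rightarrow> complex^'d \<Rightarrow> complex^'d^'d" where
  "rank1 v w = (\<chi> a b. v $ a * cnj (w $ b))"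

lemma rank1_mult_vec: "rank1 v w *v x = hinner x w *s v"
  by (simp add: rank1_def hinner_def matrix_vector_mult_def vec_eq_iff sum_distrib_left
      mult.commute mult.left_commute)

lemma rank1_add_left: "rank1 (v + v') w = rank1 v w + rank1 v' w"
  by (simp add: rank1_def vec_eq_iff distrib_right)

lemma rank1_scaleR_left: "rank1 (c *\<^sub>R v) w = c *\<^sub>R rank1 v w"
  by (simp add: rank1_def vec_eq_iff)

lemma mult_outer: "A ** outer v = rank1 (A *v v) v"
  by (simp add: rank1_def outer_def matrix_matrix_mult_def matrix_vector_mult_def vec_eq_iff
      sum_distrib_right mult.assoc)

lemma norm_rank1: "norm (rank1 v w) = norm v * norm w"
proof -
  have "(norm (rank1 v w))\<^sup>2 = (\<Sum>a\<in>UNIV. \<Sum>b\<in>UNIV. (cmod (v $ a))\<^sup>2 * (cmod (w $ b))\<^sup>2)"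
    by (simp add: norm_vec_def L2_set_def sum_nonneg rank1_def norm_mult power_mult_distrib)
  also have "\<dots> = (norm v * norm w)\<^sup>2"
    by (simp add: norm_vec_def L2_set_def sum_nonneg power_mult_distrib sum_product)
  finally show ?thesis by (rule power2_eq_imp_eq) simp_all
qed

lemma matrix_eq_sum_rank1:
  fixes u :: "nat \<Rightarrow> complex^'d" and M :: "complex^'d^'d"
  assumes "orthonormal u CARD('d)"
  shows "M = (\<Sum>i<CARD('d). rank1 (M *v u i) (u i))"
proof -
  have "M = M ** (\<Sum>i<CARD('d). outer (u i))" by (simp add: sum_outer_orthonormal[OF assms])
  then show ?thesis by (simp add: matrix_mul_sum_right mult_outer)
qed

lemma matrix_eqI_orthonormal:
  fixes u :: "nat \<Rightarrow> complex^'d" and M N :: "complex^'d^'d"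
  assumes "orthonormal u CARD('d)" "\<And>i. i < CARD('d) \<Longrightarrow> M *v u i = N *v u i"
  shows "M = N"
proof -
  have "(\<Sum>i<CARD('d). rank1 (M *v u i) (u i)) = (\<Sum>i<CARD('d). rank1 (N *v u i) (u i))"
    using assms(2) by (intro sum.cong) auto
  then show ?thesis using matrix_eq_sum_rank1[OF assms(1)] by metis
qed

lemma norm_matrix_le_sum_entries:
  fixes u :: "nat \<Rightarrow> complex^'d" and M :: "complex^'d^'d"
  assumes u: "orthonormal u CARD('d)"
  shows "norm M \<le> (\<Sum>a<CARD('d). \<Sum>b<CARD('d). cmod (hinner (M *v u a) (u b)))"
proof -
  have "norm M \<le> (\<Sum>a<CARD('d). norm (rank1 (M *v u a) (u a)))"
    by (subst matrix_eq_sum_rank1[OF u, of M]) (rule norm_sum)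
  also have "\<dots> \<le> (\<Sum>a<CARD('d). \<Sum>b<CARD('d). cmod (hinner (M *v u a) (u b)))"
  proof (rule sum_mono)
    fix a assume a: "a \<in> {..<CARD('d)}"
    have "norm (M *v u a) \<le> (\<Sum>b<CARD('d). norm (hinner (M *v u a) (u b) *s u b))"
      by (subst orthonormal_expand[OF u, of "M *v u a"]) (rule norm_sum)
    then show "norm (rank1 (M *v u a) (u a)) \<le> (\<Sum>b<CARD('d). cmod (hinner (M *v u a) (u b)))"
      using a by (simp add: norm_rank1 norm_scale orthonormal_norm[OF u])
  qed
  finally show ?thesis .
qed

lemma orthonormal_norm_Parseval:
  fixes u :: "nat \<Rightarrow> complex^'d"
  assumes "orthonormal u CARD('d)"
  shows "(norm x)\<^sup>2 = (\<Sum>i<CARD('d). (cmod (hinner x (u i)))\<^sup>2)"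
proof -
  have "complex_of_real ((norm x)\<^sup>2) = (\<Sum>i<CARD('d). hinner x (u i) * hinner (u i) x)"
    unfolding hinner_self[symmetric] by (rule orthonormal_Parseval[OF assms])
  also have "\<dots> = (\<Sum>i<CARD('d). of_real ((cmod (hinner x (u i)))\<^sup>2))"
    by (intro sum.cong refl) (simp only: complex_norm_square hinner_commute[symmetric])
  finally show ?thesis unfolding of_real_sum[symmetric] of_real_eq_iff .
qed

lemma Bessel:
  assumes "orthonormal v k"
  shows "(\<Sum>b<k. (cmod (hinner x (v b)))\<^sup>2) \<le> (norm x)\<^sup>2"
proof -
  define p where "p = (\<Sum>b<k. hinner x (v b) *s v b)"
  define s where "s = (\<Sum>b<k. (cmod (hinner x (v b)))\<^sup>2)"
  have xp: "hinner x p = of_real s"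
    unfolding p_def s_def hinner_sum_right hinner_scale_right of_real_sum complex_norm_square
    by (simp add: mult.commute)
  have pv: "hinner p (v b) = hinner x (v b)" if "b < k" for b
  proof -
    have "hinner p (v b) = (\<Sum>c<k. hinner x (v c) * (if c = b then 1 else 0))"
      unfolding p_def hinner_sum_left hinner_scale_left
      using that assms by (intro sum.cong) (auto simp: orthonormalD)
    then show ?thesis using that by (simp add: if_distrib cong: if_cong)
  qed
  have "hinner p p = (\<Sum>b<k. cnj (hinner x (v b)) * hinner p (v b))"
    by (subst (2) p_def) (simp only: hinner_sum_right hinner_scale_right)
  also have "\<dots> = hinner x p"
    unfolding p_def hinner_sum_right hinner_scale_right
    by (intro sum.cong) (simp_all add: pv[unfolded p_def])
  finally have pp: "hinner p p = of_real s" by (simp add: xp)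
  have px: "hinner p x = of_real s" using hinner_commute[of p x] by (simp add: xp)
  have "complex_of_real ((norm (x - p))\<^sup>2) = of_real ((norm x)\<^sup>2 - s)"
    unfolding hinner_self[symmetric] hinner_diff_left hinner_diff_right xp px pp
    by (simp add: hinner_self)
  then have "(norm (x - p))\<^sup>2 = (norm x)\<^sup>2 - s" unfolding of_real_eq_iff .
  then show ?thesis unfolding s_def[symmetric] by (metis diff_ge_0_iff_ge zero_le_power2)
qed

section \<open>Ky Fan sums: the action variables as functions of one Hermitian matrix\<close>

definition top_sum :: "complex^'d^'d \<Rightarrow> nat \<Rightarrow> real" where
  "top_sum A j = (\<Sum>i<j. eigenvalue A i)"

lemma hermitian_form_eigenbasis:
  assumes A: "hermitian (A :: complex^'d^'d)" and u: "eigenbasis A u"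
  shows "Re (hinner (A *v x) x) = (\<Sum>i<CARD('d). eigenvalue A i * (cmod (hinner x (u i)))\<^sup>2)"
proof -
  have "hinner (A *v x) x = (\<Sum>i<CARD('d). hinner (A *v x) (u i) * hinner (u i) x)"
    by (rule orthonormal_Parseval[OF eigenbasisD(1)[OF u]])
  also have "\<dots> = (\<Sum>i<CARD('d). of_real (eigenvalue A i * (cmod (hinner x (u i)))\<^sup>2))"
  proof (intro sum.cong refl)
    fix i assume "i \<in> {..<CARD('d)}"
    then have "hinner (A *v x) (u i) = of_real (eigenvalue A i) * hinner x (u i)"
      using eigenbasisD(2)[OF u] by (simp add: hinner_hermitian[OF A] hinner_scale_right)
    then show "hinner (A *v x) (u i) * hinner (u i) x
        = of_real (eigenvalue A i * (cmod (hinner x (u i)))\<^sup>2)"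
      unfolding of_real_mult complex_norm_square hinner_commute[of "u i" x] by simp
  qed
  finally show ?thesis unfolding of_real_sum[symmetric] by simp
qed

text \<open>Ky Fan's inequality. The left side is a weighted sum of all eigenvalues with weights in
  \<open>[0, 1]\<close> (Bessel) of total \<open>j\<close> (Parseval), which is largest when the
  weight sits on the first \<open>j\<close> eigenvalues.\<close>

lemma hermitian_form_sum_le_top_sum:
  assumes A: "hermitian (A :: complex^'d^'d)" and v: "orthonormal v j" and j: "j \<le> CARD('d)"
  shows "(\<Sum>b<j. Re (hinner (A *v v b) (v b))) \<le> top_sum A j"
proof (cases "j = 0")
  case True
  then show ?thesis by (simp add: top_sum_def)
next
  case False
  obtain u where u: "eigenbasis A u" using ex_eigenbasis[OF A] ..
  let ?d = "CARD('d)"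
  \<comment> \<open>The \<open>j\<close>-th largest eigenvalue, counted from 1. After subtracting
    it, the terms with \<open>i < j\<close> are nonnegative and the others nonpositive, so the
    weights can be replaced by 1 and 0 term by term.\<close>
  define \<beta> where "\<beta> = eigenvalue A (j - 1)"
  define c where "c i = (\<Sum>b<j. (cmod (hinner (v b) (u i)))\<^sup>2)" for i
  have "(\<Sum>b<j. Re (hinner (A *v v b) (v b))) = (\<Sum>i<?d. eigenvalue A i * c i)"
    unfolding hermitian_form_eigenbasis[OF A u] c_def sum_distrib_left by (rule sum.swap)
  moreover have "(\<Sum>i<?d. c i) = real j"
  proof -
    have "(\<Sum>i<?d. c i) = (\<Sum>b<j. (norm (v b))\<^sup>2)"
      unfolding c_def orthonormal_norm_Parseval[OF eigenbasisD(1)[OF u]] by (rule sum.swap)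
    also have "\<dots> = real j" using orthonormal_norm[OF v] by simp
    finally show ?thesis .
  qed
  moreover have "(\<Sum>i<?d. (eigenvalue A i - \<beta>) * c i) \<le> (\<Sum>i<j. eigenvalue A i - \<beta>)"
  proof -
    have c01: "0 \<le> c i" "i < ?d \<Longrightarrow> c i \<le> 1" for i
    proof -
      show "0 \<le> c i" by (simp add: c_def sum_nonneg)
      assume "i < ?d"
      have "c i = (\<Sum>b<j. (cmod (hinner (u i) (v b)))\<^sup>2)"
        unfolding c_def by (intro sum.cong refl) (metis hinner_commute complex_mod_cnj)
      also have "\<dots> \<le> 1" using Bessel[OF v, of "u i"] orthonormal_norm[OF eigenbasisD(1)[OF u]] \<open>i < ?d\<close> by simp
      finally show "c i \<le> 1" .
    qed
    have "(eigenvalue A i - \<beta>) * c i \<le> (if i < j then eigenvalue A i - \<beta> else 0)" if "i < ?d" for i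
    proof (cases "i < j")
      case True
      then have "\<beta> \<le> eigenvalue A i" unfolding \<beta>_def using j by (intro eigenvalue_antimono[OF A]) auto
      then show ?thesis using True c01[of i] that mult_left_mono[of "c i" 1 "eigenvalue A i - \<beta>"] by simp
    next
      case F: False
      then have "eigenvalue A i \<le> \<beta>" unfolding \<beta>_def using that False by (intro eigenvalue_antimono[OF A]) auto
      then show ?thesis using F c01(1)[of i] by (simp add: mult_nonpos_nonneg)
    qed
    then have "(\<Sum>i<?d. (eigenvalue A i - \<beta>) * c i) \<le> (\<Sum>i<?d. if i < j then eigenvalue A i - \<beta> else 0)"
      by (intro sum_mono) simp
    also have "\<dots> = (\<Sum>i<j. eigenvalue A i - \<beta>)"
    proof -
      have "{..<?d} \<inter> {i. i < j} = {..<j}" using j by auto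
      then show ?thesis by (simp add: sum.If_cases)
    qed
    finally show ?thesis .
  qed
  ultimately show ?thesis
    by (simp add: top_sum_def left_diff_distrib sum_subtractf sum_distrib_left[symmetric])
qed

lemma inner_sum_outer: "A \<bullet> (\<Sum>i\<in>I. outer (u i)) = (\<Sum>i\<in>I. Re (hinner (A *v u i) (u i)))"
  by (simp add: inner_sum_right inner_outer)

lemma top_sum_eq_inner:
  assumes u: "eigenbasis (A :: complex^'d^'d) u" and j: "j \<le> CARD('d)"
  shows "top_sum A j = A \<bullet> (\<Sum>i<j. outer (u i))"
  unfolding inner_sum_outer top_sum_def
proof (rule sum.cong)
  fix i assume "i \<in> {..<j}"
  then show "eigenvalue A i = Re (hinner (A *v u i) (u i))"
    using j eigenbasisD(2)[OF u, of i] orthonormalD[OF eigenbasisD(1)[OF u], of i i]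
    by (simp add: hinner_scale_left)
qed simp

text \<open>The subgradient inequality for a maximum of linear functions: \<open>top_sum\<close>
  dominates the linear function given by the projection at \<open>A\<close>, with equality at
  \<open>A\<close>.\<close>

lemma top_sum_diff_ge:
  assumes "hermitian B" and u: "eigenbasis (A :: complex^'d^'d) u" and j: "j \<le> CARD('d)"
  shows "(B - A) \<bullet> (\<Sum>i<j. outer (u i)) \<le> top_sum B j - top_sum A j"
proof -
  have "B \<bullet> (\<Sum>i<j. outer (u i)) \<le> top_sum B j"
    unfolding inner_sum_outer
    using assms orthonormal_mono[OF eigenbasisD(1)[OF u] j] by (intro hermitian_form_sum_le_top_sum)
  then show ?thesis by (simp add: inner_diff_left top_sum_eq_inner[OF u j])
qed

lemma norm_sum_outer_le:
  assumes "orthonormal u j"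
  shows "norm (\<Sum>i<j. outer (u i)) \<le> real j"
proof -
  have "norm (\<Sum>i<j. outer (u i)) \<le> (\<Sum>i<j. norm (outer (u i)))" by (rule norm_sum)
  also have "\<dots> = real j" using orthonormal_norm[OF assms] by (simp add: norm_outer)
  finally show ?thesis .
qed

lemma top_sum_Lipschitz:
  assumes A: "hermitian A" and B: "hermitian (B :: complex^'d^'d)" and j: "j \<le> CARD('d)"
  shows "\<bar>top_sum B j - top_sum A j\<bar> \<le> real j * norm (B - A)"
proof -
  obtain u v where u: "eigenbasis A u" and v: "eigenbasis B v"
    using ex_eigenbasis A B by blast
  have le: "\<bar>M \<bullet> (\<Sum>i<j. outer (w i))\<bar> \<le> real j * norm M" if "eigenbasis C w"
    for M C :: "complex^'d^'d" and w
    using norm_sum_outer_le[OF orthonormal_mono[OF eigenbasisD(1)[OF that] j]]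
      Cauchy_Schwarz_ineq2[of M "\<Sum>i<j. outer (w i)"]
      mult_left_mono[of "norm (\<Sum>i<j. outer (w i))" "real j" "norm M"]
    by (simp add: mult.commute)
  have "- (real j * norm (B - A)) \<le> (B - A) \<bullet> (\<Sum>i<j. outer (u i))"
    "- (real j * norm (B - A)) \<le> (A - B) \<bullet> (\<Sum>i<j. outer (v i))"
    using le[OF u, of "B - A"] le[OF v, of "A - B"] norm_minus_commute[of A B] by (simp_all add: abs_le_iff)
  then show ?thesis
    using top_sum_diff_ge[OF B u j] top_sum_diff_ge[OF A v j] by (intro abs_leI) linarith+
qed

text \<open>Each eigenvalue is a difference of two consecutive Ky Fan sums, whose Lipschitz
  constants \<open>i + 1\<close> and \<open>i\<close> add up to at most
  \<open>2 * CARD('d)\<close>.\<close>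

lemma eigenvalue_Lipschitz:
  assumes A: "hermitian A" and B: "hermitian (B :: complex^'d^'d)" and i: "i < CARD('d)"
  shows "\<bar>eigenvalue B i - eigenvalue A i\<bar> \<le> 2 * real CARD('d) * norm (B - A)"
proof -
  have e: "eigenvalue C i = top_sum C (Suc i) - top_sum C i" for C :: "complex^'d^'d"
    by (simp add: top_sum_def)
  have "\<bar>eigenvalue B i - eigenvalue A i\<bar> \<le> (real (Suc i) + real i) * norm (B - A)"
    using top_sum_Lipschitz[OF A B, of "Suc i"] top_sum_Lipschitz[OF A B, of i] i
    unfolding e by (simp add: distrib_right)
  also have "\<dots> \<le> 2 * real CARD('d) * norm (B - A)"
    using i by (intro mult_right_mono) auto
  finally show ?thesis .
qed

lemma continuous_on_eigenvalue:
  assumes "i < CARD('d)"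
  shows "continuous_on {A :: complex^'d^'d. hermitian A} (\<lambda>A. eigenvalue A i)"
proof (rule lipschitz_on_continuous_on)
  show "(2 * real CARD('d))-lipschitz_on {A :: complex^'d^'d. hermitian A} (\<lambda>A. eigenvalue A i)"
    using eigenvalue_Lipschitz[OF _ _ assms] by (intro lipschitz_onI) (auto simp: dist_norm)
qed

text \<open>Quantifying over all pairs, not just over the neighbours \<open>j - 1\<close> and
  \<open>j\<close>, makes the boundary cases \<open>j = 0\<close> and \<open>j = CARD('d)\<close>
  hold vacuously.\<close>

definition gap :: "complex^'d^'d \<Rightarrow> nat \<Rightarrow> bool" where
  "gap A j \<longleftrightarrow> (\<forall>a<j. \<forall>b. j \<le> b \<and> b < CARD('d) \<longrightarrow> eigenvalue A b < eigenvalue A a)"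

text \<open>The chosen eigenbasis matters in general; under \<open>gap A j\<close> the sum is the
  same for every eigenbasis (\<open>spectral_proj_eq\<close>).\<close>

definition spectral_proj :: "complex^'d^'d \<Rightarrow> nat \<Rightarrow> complex^'d^'d" where
  "spectral_proj A j = (\<Sum>i<j. outer ((SOME u. eigenbasis A u) i))"

lemma gapI:
  assumes A: "hermitian (A :: complex^'d^'d)"
    and "0 < j \<Longrightarrow> j < CARD('d) \<Longrightarrow> eigenvalue A j < eigenvalue A (j - 1)"
  shows "gap A j"
  unfolding gap_def
proof (intro allI impI)
  fix a b assume ab: "a < j" "j \<le> b \<and> b < CARD('d)"
  then have "eigenvalue A b \<le> eigenvalue A j" "eigenvalue A (j - 1) \<le> eigenvalue A a"
    by (auto intro!: eigenvalue_antimono[OF A])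
  then show "eigenvalue A b < eigenvalue A a" using assms(2) ab by force
qed

lemma gap_bound:
  assumes A: "hermitian (A :: complex^'d^'d)" and "gap A j"
  obtains \<delta> where "\<delta> > 0" "\<And>a b. a < j \<Longrightarrow> j \<le> b \<Longrightarrow> b < CARD('d) \<Longrightarrow> \<delta> \<le> eigenvalue A a - eigenvalue A b"
proof (cases "0 < j \<and> j < CARD('d)")
  case True
  have "eigenvalue A (j - 1) - eigenvalue A j \<le> eigenvalue A a - eigenvalue A b"
    if "a < j" "j \<le> b" "b < CARD('d)" for a b
  proof -
    have "eigenvalue A b \<le> eigenvalue A j" "eigenvalue A (j - 1) \<le> eigenvalue A a"
      using that by (auto intro!: eigenvalue_antimono[OF A])
    then show ?thesis by linarith
  qed
  moreover have "eigenvalue A (j - 1) - eigenvalue A j > 0"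
    using assms(2) True by (simp add: gap_def)
  ultimately show ?thesis using that by blast
next
  case False
  then show ?thesis using that[of 1] by auto
qed

lemma sum_outer_orthonormal_mult:
  assumes "orthonormal u k" "j \<le> k" "i < k"
  shows "(\<Sum>a<j. outer (u a)) *v u i = (if i < j then u i else 0)"
proof -
  have "(\<Sum>a<j. outer (u a)) *v u i = (\<Sum>a<j. (if i = a then u a else 0))"
    unfolding matrix_vector_mul_sum outer_mult_vec
    using assms by (intro sum.cong) (auto simp: orthonormalD)
  then show ?thesis by simp
qed

lemma hermitian_sum_outer: "hermitian (\<Sum>a\<in>I. outer (u a))"
  by (intro hermitian_sum hermitian_outer)

lemma sum_outer_eigenbasis:
  fixes u :: "nat \<Rightarrow> complex^'d"
  assumes u: "eigenbasis A u" and j: "j \<le> CARD('d)"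
  defines "P \<equiv> \<Sum>a<j. outer (u a)"
  shows "P ** P = P" "A ** P = P ** A"
proof -
  note on = eigenbasisD(1)[OF u]
  note Pu = sum_outer_orthonormal_mult[OF on j]
  have P0: "P *v 0 = 0" by simp
  show "P ** P = P"
    by (rule matrix_eqI_orthonormal[OF on])
      (simp add: matrix_vector_mul_assoc[symmetric] P_def Pu)
  show "A ** P = P ** A"
    by (rule matrix_eqI_orthonormal[OF on])
      (simp add: matrix_vector_mul_assoc[symmetric] P_def Pu eigenbasisD(2)[OF u] vector_scalar_commute)
qed

text \<open>A Davis-Kahan bound. As both projections have rank \<open>j\<close>, the squared
  distance is twice the sum of \<open>\<bar>(u a, v b)\<bar>\<close> squared over
  \<open>a < j \<le> b\<close>; and \<open>(u a, v b)\<close> times the difference of the two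
  eigenvalues is a matrix element of \<open>B - A\<close>. The gap is measured between upper
  eigenvalues of \<open>A\<close> and lower ones of \<open>B\<close>.\<close>

lemma sum_outer_perturbation:
  assumes A: "hermitian (A :: complex^'d^'d)" and B: "hermitian B"
    and u: "eigenbasis A u" and v: "eigenbasis B v" and j: "j \<le> CARD('d)" and \<delta>: "\<delta> > 0"
    and gap: "\<And>a b. a < j \<Longrightarrow> j \<le> b \<Longrightarrow> b < CARD('d) \<Longrightarrow> \<delta> \<le> eigenvalue A a - eigenvalue B b"
  shows "norm ((\<Sum>i<j. outer (v i)) - (\<Sum>i<j. outer (u i))) \<le> 2 * real CARD('d) * norm (B - A) / \<delta>"
proof -
  let ?d = "CARD('d)"
  note on_u = eigenbasisD(1)[OF u] and on_v = eigenbasisD(1)[OF v]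
  define P where "P = (\<Sum>i<j. outer (u i))"
  define Q where "Q = (\<Sum>i<j. outer (v i))"
  define h where "h a b = (cmod (hinner (u a) (v b)))\<^sup>2" for a b
  have oo: "outer x \<bullet> outer y = (cmod (hinner y x))\<^sup>2" for x y :: "complex^'d"
    unfolding inner_outer outer_mult_vec hinner_scale_left hinner_commute[of x y]
    by (simp add: complex_norm_square[symmetric] del: of_real_power)
  have "P \<bullet> P = (\<Sum>i<j. 1)" "Q \<bullet> Q = (\<Sum>i<j. 1)"
    unfolding P_def Q_def inner_sum_outer
    using j orthonormalD[OF on_u] orthonormalD[OF on_v]
    by (auto intro!: sum.cong simp: sum_outer_orthonormal_mult[OF on_u] sum_outer_orthonormal_mult[OF on_v])
  moreover have "Q \<bullet> P = (\<Sum>a<j. \<Sum>b<j. h a b)"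
    unfolding P_def Q_def inner_sum_right inner_sum_left oo h_def ..
  ultimately have "(norm (Q - P))\<^sup>2 = 2 * (\<Sum>a<j. 1 - (\<Sum>b<j. h a b))"
    by (simp add: power2_norm_eq_inner inner_diff_left inner_diff_right inner_commute[of P Q] sum_subtractf
        del: dot_square_norm)
  also have "\<dots> = 2 * (\<Sum>a<j. \<Sum>b\<in>{j..<?d}. h a b)"
  proof -
    have "1 - (\<Sum>b<j. h a b) = (\<Sum>b\<in>{j..<?d}. h a b)" if "a < j" for a
    proof -
      have "1 = (\<Sum>b<?d. h a b)"
        using orthonormal_norm_Parseval[OF on_v, of "u a"] orthonormal_norm[OF on_u, of a] that j
        by (simp add: h_def)
      also have "\<dots> = (\<Sum>b<j. h a b) + (\<Sum>b\<in>{j..<?d}. h a b)"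
        using j sum.atLeastLessThan_concat[of 0 j ?d "h a"] by (simp add: atLeast0LessThan)
      finally show ?thesis by linarith
    qed
    then show ?thesis by simp
  qed
  also have "\<dots> \<le> 2 * (\<Sum>a<j. \<Sum>b\<in>{j..<?d}. (norm (B - A) / \<delta>)\<^sup>2)"
  proof -
    have "h a b \<le> (norm (B - A) / \<delta>)\<^sup>2" if ab: "a < j" "j \<le> b" "b < ?d" for a b
    proof -
      have "hinner ((B - A) *v u a) (v b) = of_real (eigenvalue B b - eigenvalue A a) * hinner (u a) (v b)"
        using ab j eigenbasisD(2)[OF u, of a] eigenbasisD(2)[OF v, of b]
        by (simp add: matrix_vector_mult_diff_rdistrib hinner_diff_left hinner_hermitian[OF B]
            hinner_scale_right hinner_scale_left left_diff_distrib)
      then have "\<bar>eigenvalue B b - eigenvalue A a\<bar> * cmod (hinner (u a) (v b)) = cmod (hinner ((B - A) *v u a) (v b))"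
        by (simp only: norm_mult norm_of_real)
      also have "\<dots> \<le> norm ((B - A) *v u a) * norm (v b)" by (rule hinner_Cauchy_Schwarz)
      also have "\<dots> \<le> norm (B - A)"
        using norm_matrix_vector[of "B - A" "u a"] ab j orthonormal_norm[OF on_u] orthonormal_norm[OF on_v]
        by simp
      finally have 1: "\<bar>eigenvalue B b - eigenvalue A a\<bar> * cmod (hinner (u a) (v b)) \<le> norm (B - A)" .
      have "\<delta> * cmod (hinner (u a) (v b)) \<le> \<bar>eigenvalue B b - eigenvalue A a\<bar> * cmod (hinner (u a) (v b))"
        using gap[OF ab] by (intro mult_right_mono) auto
      then have "cmod (hinner (u a) (v b)) \<le> norm (B - A) / \<delta>"
        using 1 \<delta> by (simp add: pos_le_divide_eq mult.commute)
      then show ?thesis unfolding h_def by (intro power_mono) auto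
    qed
    then show ?thesis by (intro mult_left_mono sum_mono) auto
  qed
  also have "\<dots> = 2 * real j * real (?d - j) * (norm (B - A) / \<delta>)\<^sup>2" by simp
  also have "\<dots> \<le> (2 * real ?d)\<^sup>2 * (norm (B - A) / \<delta>)\<^sup>2"
  proof (intro mult_right_mono)
    have "real j * real (?d - j) \<le> real ?d * real ?d" using j by (intro mult_mono) auto
    moreover have "0 \<le> real ?d * real ?d" by simp
    ultimately show "2 * real j * real (?d - j) \<le> (2 * real ?d)\<^sup>2" unfolding power2_eq_square by linarith
  qed simp
  finally have "(norm (Q - P))\<^sup>2 \<le> (2 * real ?d * norm (B - A) / \<delta>)\<^sup>2"
    by (simp only: power_mult_distrib power_divide times_divide_eq_right)
  then have "norm (Q - P) \<le> 2 * real ?d * norm (B - A) / \<delta>"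
    by (rule power2_le_imp_le) (use \<delta> in simp)
  then show ?thesis unfolding P_def Q_def .
qed

text \<open>The perturbation bound for \<open>B = A\<close> has right-hand side 0, so any two
  eigenbases give the same projection.\<close>

lemma spectral_proj_eq:
  assumes A: "hermitian (A :: complex^'d^'d)" and g: "gap A j" and j: "j \<le> CARD('d)" and u: "eigenbasis A u"
  shows "spectral_proj A j = (\<Sum>i<j. outer (u i))"
proof -
  obtain \<delta> where \<delta>: "\<delta> > 0" "\<And>a b. a < j \<Longrightarrow> j \<le> b \<Longrightarrow> b < CARD('d) \<Longrightarrow> \<delta> \<le> eigenvalue A a - eigenvalue A b"
    using gap_bound[OF A g] by metis
  have "eigenbasis A (SOME u. eigenbasis A u)" using ex_eigenbasis[OF A] by (rule someI_ex)
  from sum_outer_perturbation[OF A A u this j \<delta>] show ?thesis by (simp add: spectral_proj_def)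
qed

lemma spectral_proj_unitary_conj:
  assumes A: "hermitian (A :: complex^'d^'d)" and gp: "gap A j" and j: "j \<le> CARD('d)" and g: "unitary g"
  shows "gap (g ** A ** cadjoint g) j"
    and "spectral_proj (g ** A ** cadjoint g) j = g ** spectral_proj A j ** cadjoint g"
proof -
  obtain u where u: "eigenbasis A u" using ex_eigenbasis[OF A] ..
  note c = eigenvalue_unitary_conj[OF A g u]
  show gap': "gap (g ** A ** cadjoint g) j" using gp by (simp add: gap_def c(1))
  show "spectral_proj (g ** A ** cadjoint g) j = g ** spectral_proj A j ** cadjoint g"
    by (simp add: spectral_proj_eq[OF hermitian_conj[OF A] gap' j c(2)] spectral_proj_eq[OF A gp j u]
        matrix_mul_sum_left matrix_mul_sum_right outer_unitary)
qed

section \<open>Differentiability of eigenvalue sums and spectral projections\<close>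

lemma has_derivative_withinI_quadratic:
  assumes "bounded_linear f'" "\<epsilon> > 0"
    and "\<And>y. y \<in> S \<Longrightarrow> norm (y - x) < \<epsilon> \<Longrightarrow> norm (f y - f x - f' (y - x)) \<le> C * (norm (y - x))\<^sup>2"
  shows "(f has_derivative f') (at x within S)"
  unfolding has_derivative_within_alt
proof (intro conjI assms(1) allI impI)
  fix e :: real assume e: "e > 0"
  define d where "d = min \<epsilon> (e / (\<bar>C\<bar> + 1))"
  have "norm (f y - f x - f' (y - x)) \<le> e * norm (y - x)" if y: "y \<in> S" "norm (y - x) < d" for y
  proof -
    have "C * norm (y - x) \<le> (\<bar>C\<bar> + 1) * norm (y - x)" by (intro mult_right_mono) auto
    also have "\<dots> \<le> e" using y(2) by (simp add: d_def pos_less_divide_eq mult.commute)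
    finally have "C * norm (y - x) * norm (y - x) \<le> e * norm (y - x)" by (intro mult_right_mono) auto
    then show ?thesis using assms(3)[OF y(1)] y(2) by (simp add: d_def power2_eq_square mult.assoc)
  qed
  moreover have "d > 0" using e assms(2) by (simp add: d_def add_nonneg_pos)
  ultimately show "\<exists>d>0. \<forall>y\<in>S. norm (y - x) < d \<longrightarrow> norm (f y - f x - f' (y - x)) \<le> e * norm (y - x)"
    by blast
qed

lemma spectral_proj_Lipschitz_at:
  assumes A: "hermitian (A :: complex^'d^'d)" and gA: "gap A j" and j: "j \<le> CARD('d)" and u: "eigenbasis A u"
  obtains \<epsilon> K where "\<epsilon> > 0" "K \<ge> 0"
    "\<And>B v. hermitian B \<Longrightarrow> norm (B - A) < \<epsilon> \<Longrightarrow> eigenbasis B v \<Longrightarrow>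
      gap B j \<and> norm ((\<Sum>i<j. outer (v i)) - (\<Sum>i<j. outer (u i))) \<le> K * norm (B - A)"
proof -
  let ?d = "CARD('d)"
  obtain \<delta> where \<delta>: "\<delta> > 0" "\<And>a b. a < j \<Longrightarrow> j \<le> b \<Longrightarrow> b < ?d \<Longrightarrow> \<delta> \<le> eigenvalue A a - eigenvalue A b"
    using gap_bound[OF A gA] by metis
  \<comment> \<open>Eigenvalues move by at most
    \<open>2 * real ?d * \<epsilon> = \<delta> / 4\<close>, which leaves at least
    \<open>\<delta> / 2\<close> between the two groups, both within \<open>B\<close> and from
    \<open>A\<close> to \<open>B\<close>.\<close>
  define \<epsilon> where "\<epsilon> = \<delta> / (8 * real ?d)"
  have dpos: "real ?d > 0" by simp
  have "gap B j \<and> norm ((\<Sum>i<j. outer (v i)) - (\<Sum>i<j. outer (u i))) \<le> 4 * real ?d / \<delta> * norm (B - A)"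
    if B: "hermitian B" "norm (B - A) < \<epsilon>" "eigenbasis B v" for B v
  proof -
    have close: "\<bar>eigenvalue B i - eigenvalue A i\<bar> \<le> \<delta> / 4" if "i < ?d" for i
    proof -
      have "2 * real ?d * norm (B - A) \<le> 2 * real ?d * \<epsilon>" using B(2) by (intro mult_left_mono) auto
      also have "\<dots> = \<delta> / 4" using dpos by (simp add: \<epsilon>_def)
      finally show ?thesis using eigenvalue_Lipschitz[OF A B(1) that] by linarith
    qed
    have 1: "\<delta> / 2 \<le> eigenvalue A a - eigenvalue B b" if "a < j" "j \<le> b" "b < ?d" for a b
      using close[of b] \<delta>(2)[of a b] \<delta>(1) that by linarith
    have "gap B j" unfolding gap_def
    proof (intro allI impI)
      fix a b assume ab: "a < j" "j \<le> b \<and> b < ?d"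
      then show "eigenvalue B b < eigenvalue B a"
        using close[of b] close[of a] \<delta>(2)[of a b] \<delta>(1) j by linarith
    qed
    moreover have "norm ((\<Sum>i<j. outer (v i)) - (\<Sum>i<j. outer (u i))) \<le> 2 * real ?d * norm (B - A) / (\<delta> / 2)"
      using \<delta>(1) by (intro sum_outer_perturbation[OF A B(1) u B(3) j _ 1]) auto
    ultimately show ?thesis by (simp add: mult_ac)
  qed
  moreover have "\<epsilon> > 0" using \<delta>(1) dpos by (simp add: \<epsilon>_def)
  moreover have "4 * real ?d / \<delta> \<ge> 0" using \<delta>(1) by simp
  ultimately show ?thesis using that by blast
qed

text \<open>The subgradient inequalities at \<open>A\<close> and at \<open>B\<close> squeeze the
  linearisation error between 0 and the product of \<open>B - A\<close> with the difference of the
  two projections, which is itself of order \<open>norm (B - A)\<close>.\<close>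

lemma has_derivative_top_sum:
  assumes A: "hermitian (A :: complex^'d^'d)" and gA: "gap A j" and j: "j \<le> CARD('d)"
  shows "((\<lambda>X. top_sum X j) has_derivative (\<lambda>E. E \<bullet> spectral_proj A j)) (at A within {X. hermitian X})"
proof -
  obtain u where u: "eigenbasis A u" using ex_eigenbasis[OF A] ..
  obtain \<epsilon> K where K: "\<epsilon> > 0" "K \<ge> 0"
    "\<And>B v. hermitian B \<Longrightarrow> norm (B - A) < \<epsilon> \<Longrightarrow> eigenbasis B v \<Longrightarrow>
      gap B j \<and> norm ((\<Sum>i<j. outer (v i)) - (\<Sum>i<j. outer (u i))) \<le> K * norm (B - A)"
    using spectral_proj_Lipschitz_at[OF A gA j u] by metis
  define P where "P = (\<Sum>i<j. outer (u i))"
  show ?thesis unfolding spectral_proj_eq[OF A gA j u] P_def[symmetric]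
  proof (rule has_derivative_withinI_quadratic[OF _ K(1)])
    show "bounded_linear (\<lambda>E. E \<bullet> P)" by (rule bounded_linear_inner_left)
    fix B assume B: "B \<in> {X. hermitian X}" "norm (B - A) < \<epsilon>"
    then obtain v where v: "eigenbasis B v" using ex_eigenbasis by blast
    define Q where "Q = (\<Sum>i<j. outer (v i))"
    have lo: "(B - A) \<bullet> P \<le> top_sum B j - top_sum A j"
      unfolding P_def using B by (intro top_sum_diff_ge u j) simp
    have "(A - B) \<bullet> Q \<le> top_sum A j - top_sum B j"
      unfolding Q_def by (intro top_sum_diff_ge v j A)
    then have "top_sum B j - top_sum A j \<le> (B - A) \<bullet> Q" by (simp add: inner_diff_left)
    then have "\<bar>top_sum B j - top_sum A j - (B - A) \<bullet> P\<bar> \<le> (B - A) \<bullet> (Q - P)"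
      using lo by (simp add: inner_diff_right)
    also have "\<dots> \<le> norm (B - A) * norm (Q - P)" by (rule norm_cauchy_schwarz)
    also have "\<dots> \<le> norm (B - A) * (K * norm (B - A))"
      using K(3)[of B v] B v by (intro mult_left_mono) (auto simp: P_def Q_def)
    finally show "norm (top_sum B j - top_sum A j - (B - A) \<bullet> P) \<le> K * (norm (B - A))\<^sup>2"
      by (simp add: power2_eq_square mult_ac)
  qed
qed

text \<open>In an eigenbasis of \<open>A\<close>, the entries of the increment within one side of
  the gap are quadratic because both matrices are projections; those across the gap are determined
  to first order because \<open>B\<close> commutes with its own projection.\<close>

lemma spectral_proj_differentiable:
  assumes A: "hermitian (A :: complex^'d^'d)" and gA: "gap A j" and j: "j \<le> CARD('d)"
  shows "(\<lambda>X. spectral_proj X j) differentiable (at A within {X. hermitian X})"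
proof -
  let ?d = "CARD('d)"
  obtain u where u: "eigenbasis A u" using ex_eigenbasis[OF A] ..
  note on = eigenbasisD(1)[OF u]
  obtain \<epsilon> K where K: "\<epsilon> > 0" "K \<ge> 0"
    "\<And>B v. hermitian B \<Longrightarrow> norm (B - A) < \<epsilon> \<Longrightarrow> eigenbasis B v \<Longrightarrow>
      gap B j \<and> norm ((\<Sum>i<j. outer (v i)) - (\<Sum>i<j. outer (u i))) \<le> K * norm (B - A)"
    using spectral_proj_Lipschitz_at[OF A gA j u] by metis
  obtain \<delta> where \<delta>: "\<delta> > 0" "\<And>a b. a < j \<Longrightarrow> j \<le> b \<Longrightarrow> b < ?d \<Longrightarrow> \<delta> \<le> eigenvalue A a - eigenvalue A b"
    using gap_bound[OF A gA] by metis
  define P where "P = (\<Sum>i<j. outer (u i))"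
  have Pu: "P *v u a = (if a < j then u a else 0)" if "a < ?d" for a
    unfolding P_def by (rule sum_outer_orthonormal_mult[OF on j that])
  have hP: "hermitian P" unfolding P_def by (rule hermitian_sum_outer)
  \<comment> \<open>The coefficients of first-order perturbation theory. The absolute value is right
    for both orders of \<open>a\<close> and \<open>b\<close>: the denominator is always the upper
    eigenvalue minus the lower one.\<close>
  define t where "t a b = (if (a < j) = (b < j) then 0 else 1 / \<bar>eigenvalue A a - eigenvalue A b\<bar>)" for a b
  define \<tau> where "\<tau> a x = (\<Sum>b<?d. (of_real (t a b) * hinner x (u b)) *s u b)" for a x
  define T where "T E = (\<Sum>a<?d. rank1 (\<tau> a (E *v u a)) (u a))" for E
  have \<tau>: "\<tau> a (x + y) = \<tau> a x + \<tau> a y" "\<tau> a (c *\<^sub>R x) = c *\<^sub>R \<tau> a x" for a c x y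
    unfolding \<tau>_def
    by (simp_all only: hinner_add_left hinner_scale_left distrib_left vector_sadd_rdistrib sum.distrib
        scaleR_eq_scale vec.scale_sum_right vector_smult_assoc mult_ac)
  have "linear T"
  proof (rule linearI)
    show "T (x + y) = T x + T y" for x y
      unfolding T_def by (simp only: matrix_vector_mult_add_rdistrib \<tau> rank1_add_left sum.distrib)
    show "T (c *\<^sub>R x) = c *\<^sub>R T x" for c x
      unfolding T_def by (simp only: scaleR_matrix_mult_vec \<tau> rank1_scaleR_left scaleR_sum_right)
  qed
  then have blT: "bounded_linear T" by (simp add: linear_conv_bounded_linear)
  have Tu: "hinner (T E *v u a) (u b) = of_real (t a b) * hinner (E *v u a) (u b)"
    if ab: "a < ?d" "b < ?d" for E a b
  proof -
    have "T E *v u a = (\<Sum>c<?d. (if c = a then \<tau> a (E *v u a) else 0))"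
      unfolding T_def matrix_vector_mul_sum rank1_mult_vec
      using ab by (intro sum.cong) (auto simp: orthonormalD[OF on])
    also have "\<dots> = \<tau> a (E *v u a)" using ab by simp
    finally have "hinner (T E *v u a) (u b) = hinner (\<tau> a (E *v u a)) (u b)" by simp
    also have "\<dots> = (\<Sum>c<?d. of_real (t a c) * hinner (E *v u a) (u c) * (if c = b then 1 else 0))"
      unfolding \<tau>_def hinner_sum_left hinner_scale_left
      using ab by (intro sum.cong) (simp_all add: orthonormalD[OF on])
    also have "\<dots> = (\<Sum>c<?d. if c = b then of_real (t a c) * hinner (E *v u a) (u c) else 0)"
      by (intro sum.cong) auto
    finally show ?thesis using ab by simp
  qed
  define C where "C = 2 * K / \<delta> + K\<^sup>2"
  have "((\<lambda>X. spectral_proj X j) has_derivative T) (at A within {X. hermitian X})"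
  proof (rule has_derivative_withinI_quadratic[OF blT K(1)])
    fix B assume "B \<in> {X. hermitian X}" and nB: "norm (B - A) < \<epsilon>"
    then have B: "hermitian B" by simp
    obtain v where v: "eigenbasis B v" using ex_eigenbasis[OF B] by blast
    define Q where "Q = (\<Sum>i<j. outer (v i))"
    define E where "E = B - A"
    define R where "R = Q - P"
    have gB: "gap B j" and R: "norm R \<le> K * norm E"
      using K(3)[OF B nB v] by (simp_all add: P_def Q_def R_def E_def)
    have QQ: "Q ** Q = Q" and QB: "B ** Q = Q ** B"
      using sum_outer_eigenbasis[OF v j] by (simp_all add: Q_def)
    have hh: "cmod (hinner (X *v (Y *v u a)) (u b)) \<le> norm X * norm Y" if "a < ?d" "b < ?d"
      for X Y :: "complex^'d^'d" and a b
    proof -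
      have "cmod (hinner (X *v (Y *v u a)) (u b)) \<le> norm (X *v (Y *v u a)) * norm (u b)"
        by (rule hinner_Cauchy_Schwarz)
      also have "\<dots> = norm (X *v (Y *v u a))" using that orthonormal_norm[OF on] by simp
      also have "\<dots> \<le> norm X * norm (Y *v u a)" by (rule norm_matrix_vector)
      also have "\<dots> \<le> norm X * (norm Y * norm (u a))" by (intro mult_left_mono norm_matrix_vector) simp
      finally show ?thesis using that orthonormal_norm[OF on] by simp
    qed
    have entry: "cmod (hinner ((R - T E) *v u a) (u b)) \<le> C * (norm E)\<^sup>2" if ab: "a < ?d" "b < ?d" for a b
    proof -
      define x where "x = hinner (R *v u a) (u b)"
      define e where "e = hinner (E *v u a) (u b)"
      have lhs: "hinner ((R - T E) *v u a) (u b) = x - of_real (t a b) * e"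
        by (simp only: matrix_vector_mult_diff_rdistrib hinner_diff_left Tu[OF ab] x_def e_def)
      show ?thesis
      proof (cases "(a < j) = (b < j)")
        case True
        define y where "y = hinner (R *v (R *v u a)) (u b)"
        \<comment> \<open>This is \<open>Q ** Q = Q\<close> with \<open>Q = P + R\<close> and
          \<open>P ** P = P\<close>. On the top block it reads \<open>x = x + x + y\<close>, on the
          bottom block \<open>x = y\<close>, where \<open>y\<close> is an entry of
          \<open>R ** R\<close>.\<close>
        have "R = P ** R + R ** P + R ** R"
        proof -
          have "P ** P = P" using sum_outer_eigenbasis[OF u j] by (simp add: P_def)
          then show ?thesis using QQ
            by (simp add: R_def matrix_diff_ldistrib matrix_diff_rdistrib)
        qed
        then have "x = hinner ((P ** R + R ** P + R ** R) *v u a) (u b)" unfolding x_def by simp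
        also have "\<dots> = hinner (R *v u a) (P *v u b) + hinner (R *v (P *v u a)) (u b) + hinner (R *v (R *v u a)) (u b)"
          by (simp add: matrix_vector_mult_add_rdistrib hinner_add_left matrix_vector_mul_assoc[symmetric]
              hinner_hermitian[OF hP])
        finally have x: "x = hinner (R *v u a) (P *v u b) + hinner (R *v (P *v u a)) (u b) + y"
          unfolding y_def .
        have "- x = y \<or> x = y"
        proof (cases "a < j")
          case T: True
          then have "x = x + (x + y)" using x True Pu[OF ab(1)] Pu[OF ab(2)] by (simp add: x_def add.assoc)
          then have "x + y = 0" by (metis add_cancel_right_right)
          then show ?thesis using minus_unique by blast
        next
          case False
          then show ?thesis using x True Pu[OF ab(1)] Pu[OF ab(2)] by simp
        qed
        then have "cmod x = cmod y" using norm_minus_cancel[of x] by fastforce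
        also have "\<dots> = cmod (hinner (R *v (R *v u a)) (u b))" unfolding y_def ..
        also have "\<dots> \<le> norm R * norm R" by (rule hh[OF ab])
        also have "\<dots> \<le> (K * norm E) * (K * norm E)" using R K(2) by (intro mult_mono) auto
        also have "\<dots> = K\<^sup>2 * (norm E)\<^sup>2" by (simp add: power2_eq_square)
        also have "\<dots> \<le> C * (norm E)\<^sup>2" using K(2) \<delta>(1) by (intro mult_right_mono) (auto simp: C_def)
        finally show ?thesis using True by (simp add: lhs t_def)
      next
        case False
        define D where "D = eigenvalue A b - eigenvalue A a"
        have D: "\<bar>D\<bar> \<ge> \<delta>" "D < 0 \<longleftrightarrow> a < j"
          using False \<delta>(1) \<delta>(2)[of a b] \<delta>(2)[of b a] ab unfolding D_def by (auto simp: not_less)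
        have "of_real D * hinner (Q *v u a) (u b) = hinner (A *v (Q *v u a)) (u b) - hinner (Q *v (A *v u a)) (u b)"
          using eigenbasisD(2)[OF u ab(1)] eigenbasisD(2)[OF u ab(2)]
          by (simp add: hinner_hermitian[OF A] hinner_scale_right vector_scalar_commute hinner_scale_left D_def left_diff_distrib)
        \<comment> \<open>\<open>Q\<close> commutes with \<open>B = A + E\<close>, so the commutator
          of \<open>A\<close> with \<open>Q\<close> equals that of \<open>Q\<close> with
          \<open>E\<close>. This already contains a factor \<open>E\<close>, so replacing
          \<open>Q\<close> by \<open>P\<close> costs only products of \<open>R\<close> and
          \<open>E\<close>.\<close>
        also have "\<dots> = hinner (Q *v (E *v u a)) (u b) - hinner (E *v (Q *v u a)) (u b)"
        proof -
          have "A ** Q - Q ** A = Q ** E - E ** Q"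
            using QB by (simp add: E_def matrix_diff_ldistrib matrix_diff_rdistrib)
          then have "hinner ((A ** Q - Q ** A) *v u a) (u b) = hinner ((Q ** E - E ** Q) *v u a) (u b)" by simp
          then show ?thesis
            by (simp only: matrix_vector_mult_diff_rdistrib hinner_diff_left matrix_vector_mul_assoc[symmetric])
        qed
        also have "\<dots> = hinner (E *v u a) (P *v u b) - hinner (E *v (P *v u a)) (u b)
            + (hinner (R *v (E *v u a)) (u b) - hinner (E *v (R *v u a)) (u b))"
        proof -
          have q: "Q = P + R" by (simp add: R_def)
          show ?thesis unfolding q
            by (simp add: matrix_vector_mult_add_rdistrib matrix_vector_right_distrib hinner_add_left
                hinner_hermitian[OF hP])
        qed
        finally have 1: "of_real D * hinner (Q *v u a) (u b) = hinner (E *v u a) (P *v u b) - hinner (E *v (P *v u a)) (u b)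
            + (hinner (R *v (E *v u a)) (u b) - hinner (E *v (R *v u a)) (u b))" .
        have "hinner (Q *v u a) (u b) = x"
          using False orthonormalD[OF on ab] by (auto simp: x_def R_def matrix_vector_mult_diff_rdistrib
            hinner_diff_left Pu[OF ab(1)])
        moreover have "hinner (E *v u a) (P *v u b) - hinner (E *v (P *v u a)) (u b) = of_real (sgn D) * e"
          using False D \<delta>(1) by (cases "a < j") (auto simp: Pu[OF ab(1)] Pu[OF ab(2)] e_def sgn_real_def)
        ultimately have 2: "of_real D * x - of_real (sgn D) * e
            = hinner (R *v (E *v u a)) (u b) - hinner (E *v (R *v u a)) (u b)"
          using 1 by simp
        have "cmod (of_real D * x - of_real (sgn D) * e) \<le> norm R * norm E + norm E * norm R"
          unfolding 2 using norm_triangle_ineq4 hh[OF ab, of R E] hh[OF ab, of E R]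
          by (meson add_mono order_trans)
        also have "\<dots> \<le> 2 * K * (norm E)\<^sup>2"
          using mult_right_mono[OF R, of "norm E"] by (simp add: power2_eq_square mult_ac)
        finally have 3: "cmod (of_real D * x - of_real (sgn D) * e) \<le> 2 * K * (norm E)\<^sup>2" .
        have "t a b = 1 / \<bar>D\<bar>" using False by (auto simp: t_def D_def abs_minus_commute)
        then have "D * t a b = sgn D" using D \<delta>(1) by (auto simp: sgn_real_def)
        then have "of_real D * x - of_real (sgn D) * e = of_real D * (x - of_real (t a b) * e)"
          by (simp add: right_diff_distrib mult.assoc[symmetric] of_real_mult[symmetric] del: of_real_mult)
        then have "\<bar>D\<bar> * cmod (x - of_real (t a b) * e) \<le> 2 * K * (norm E)\<^sup>2"
          using 3 by (simp add: norm_mult)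
        moreover have "\<delta> * cmod (x - of_real (t a b) * e) \<le> \<bar>D\<bar> * cmod (x - of_real (t a b) * e)"
          using D by (intro mult_right_mono) auto
        ultimately have "cmod (x - of_real (t a b) * e) \<le> 2 * K * (norm E)\<^sup>2 / \<delta>"
          using \<delta>(1) by (simp add: pos_le_divide_eq mult.commute)
        also have "\<dots> \<le> C * (norm E)\<^sup>2" by (simp add: C_def distrib_right)
        finally show ?thesis by (simp add: lhs)
      qed
    qed
    have "norm (R - T E) \<le> (\<Sum>a<?d. \<Sum>b<?d. cmod (hinner ((R - T E) *v u a) (u b)))"
      by (rule norm_matrix_le_sum_entries[OF on])
    also have "\<dots> \<le> (\<Sum>a<?d. \<Sum>b<?d. C * (norm E)\<^sup>2)" by (intro sum_mono entry) auto
    finally have "norm (R - T E) \<le> (real ?d)\<^sup>2 * C * (norm E)\<^sup>2" by (simp add: power2_eq_square)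
    then show "norm (spectral_proj B j - spectral_proj A j - T (B - A)) \<le> (real ?d)\<^sup>2 * C * (norm (B - A))\<^sup>2"
      by (simp add: spectral_proj_eq[OF A gA j u] spectral_proj_eq[OF B gB j v] R_def E_def P_def Q_def)
  qed
  then show ?thesis by (auto simp: differentiable_def)
qed

section \<open>Unitary one-parameter groups\<close>

text \<open>For a projection \<open>P\<close> this is the exponential of
  \<open>\<i> t P\<close>.\<close>

definition rot :: "complex^'d^'d \<Rightarrow> real \<Rightarrow> complex^'d^'d" where
  "rot P t = mat 1 + mat (cis t - 1) ** P"

lemma rot_0 [simp]: "rot P 0 = mat 1"
  by (simp add: rot_def)

lemma rot_mult_vec: "rot P t *v v = v + (cis t - 1) *s (P *v v)"
  by (simp add: rot_def matrix_vector_mult_add_rdistrib mat_mult_vec matrix_vector_mul_assoc[symmetric])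

lemma cadjoint_rot: "hermitian P \<Longrightarrow> cadjoint (rot P t) = rot P (- t)"
  by (simp add: rot_def cadjoint_add cadjoint_mult hermitian_def cis_cnj mat_mult_commute)

lemma rot_add:
  assumes "P ** P = P"
  shows "rot P s ** rot P t = rot P (s + t)"
proof -
  have m: "(mat c ** P) ** (mat d ** P) = mat (c * d) ** P" for c d
    by (metis assms mat_mult_commute mat_mult_mat matrix_mul_assoc)
  have "rot P s ** rot P t = mat 1 + (mat (cis s - 1) ** P + mat (cis t - 1) ** P
      + mat ((cis s - 1) * (cis t - 1)) ** P)"
    by (simp add: rot_def matrix_add_ldistrib matrix_add_rdistrib m)
  also have "\<dots> = mat 1 + mat ((cis s - 1) + (cis t - 1) + (cis s - 1) * (cis t - 1)) ** P"
    by (simp only: mat_add matrix_add_rdistrib)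
  also have "(cis s - 1) + (cis t - 1) + (cis s - 1) * (cis t - 1) = cis (s + t) - 1"
    by (simp add: algebra_simps cis_mult)
  finally show ?thesis by (simp add: rot_def)
qed

lemma unitary_rot:
  assumes "P ** P = P" "hermitian P"
  shows "unitary (rot P t)"
  by (simp add: unitary_def cadjoint_rot[OF assms(2)] rot_add[OF assms(1)])

lemma rot_commute: "A ** P = P ** A \<Longrightarrow> A ** rot P t = rot P t ** A"
  by (simp add: rot_def matrix_add_ldistrib matrix_add_rdistrib matrix_mul_assoc[symmetric])
    (metis mat_mult_commute matrix_mul_assoc)

lemma rot_conj_commute:
  assumes "P ** P = P" "hermitian P" "A ** P = P ** A"
  shows "rot P t ** A ** cadjoint (rot P t) = A"
proof -
  have "rot P t ** A ** cadjoint (rot P t) = A ** (rot P t ** cadjoint (rot P t))"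
    by (simp only: rot_commute[OF assms(3), symmetric] matrix_mul_assoc)
  then show ?thesis using unitary_rot[OF assms(1,2), of t] by (simp add: unitary_def)
qed

lemma linear_mat_mult: "linear (\<lambda>c. mat c ** (Y :: complex^'d^'d))"
  by (rule linearI) (simp_all add: mat_add matrix_add_rdistrib vec_eq_iff mat_mult_component)

lemma has_vector_derivative_cis_scaled: "((\<lambda>t. cis (c * t)) has_vector_derivative of_real c * \<i>) (at 0)"
proof -
  have "((\<lambda>z. exp (\<i> * of_real c * z)) has_field_derivative \<i> * of_real c) (at 0)"
    by (auto intro!: derivative_eq_intros)
  then have "((\<lambda>t. exp (\<i> * of_real c * of_real t)) has_vector_derivative \<i> * of_real c) (at 0)"
    using has_vector_derivative_real_field[of _ _ 0] by simp
  then show ?thesis by (simp add: cis_conv_exp mult_ac)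
qed

lemma has_derivative_vecI:
  fixes f :: "'a::real_normed_vector \<Rightarrow> ('b::euclidean_space)^'n"
  assumes "\<And>k. ((\<lambda>t. f t $ k) has_derivative (\<lambda>y. f' y $ k)) (at x within S)"
  shows "(f has_derivative f') (at x within S)"
  unfolding has_derivative_componentwise_within[of f] Basis_vec_def
  by (auto simp: inner_axis intro!: has_derivative_inner_left assms)

lemma has_vector_derivative_vecI:
  fixes f :: "real \<Rightarrow> ('a::euclidean_space)^'n"
  assumes "\<And>k. ((\<lambda>t. f t $ k) has_vector_derivative f' $ k) (at x within S)"
  shows "(f has_vector_derivative f') (at x within S)"
  using assms unfolding has_vector_derivative_def by (intro has_derivative_vecI) simp

text \<open>Expanding the product, the term in \<open>P ** X ** P\<close> carries
  \<open>(cis t - 1) * (cis (- t) - 1)\<close>, which vanishes to second order.\<close>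

lemma has_vector_derivative_rot_conj:
  assumes "hermitian P"
  shows "((\<lambda>t. rot P t ** X ** cadjoint (rot P t)) has_vector_derivative commutator (mat \<i> ** P) X) (at 0)"
proof -
  have d1: "((\<lambda>t. cis t - 1) has_vector_derivative \<i>) (at 0)"
    using has_vector_derivative_diff[OF has_vector_derivative_cis_scaled[of 1] has_vector_derivative_const] by simp
  have d2: "((\<lambda>t. cis (- t) - 1) has_vector_derivative - \<i>) (at 0)"
    using has_vector_derivative_diff[OF has_vector_derivative_cis_scaled[of "-1"] has_vector_derivative_const] by simp
  have d3: "((\<lambda>t. (cis t - 1) * (cis (- t) - 1)) has_vector_derivative 0) (at 0)"
    using has_vector_derivative_mult[OF d1 d2] by simp
  have bl: "bounded_linear (\<lambda>c. mat c ** Y)" for Y :: "complex^'a^'a"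
    using linear_mat_mult linear_conv_bounded_linear by blast
  have "((\<lambda>t. X + mat (cis t - 1) ** (P ** X) + mat (cis (- t) - 1) ** (X ** P)
      + mat ((cis t - 1) * (cis (- t) - 1)) ** (P ** X ** P))
    has_vector_derivative 0 + mat \<i> ** (P ** X) + mat (- \<i>) ** (X ** P) + mat 0 ** (P ** X ** P)) (at 0)"
    by (intro has_vector_derivative_add has_vector_derivative_const
        bounded_linear.has_vector_derivative[OF bl] d1 d2 d3)
  moreover have "rot P t ** X ** cadjoint (rot P t) = X + mat (cis t - 1) ** (P ** X)
      + mat (cis (- t) - 1) ** (X ** P) + mat ((cis t - 1) * (cis (- t) - 1)) ** (P ** X ** P)" for t
  proof -
    have 1: "Y ** (mat c ** Z) = mat c ** (Y ** Z)" for c and Y Z :: "complex^'a^'a"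
      by (metis mat_mult_commute matrix_mul_assoc)
    have 2: "mat c ** (mat d ** Z) = mat (c * d) ** Z" for c d and Z :: "complex^'a^'a"
      by (simp add: matrix_mul_assoc mat_mult_mat)
    show ?thesis
      unfolding cadjoint_rot[OF assms]
      by (simp add: rot_def matrix_add_ldistrib matrix_add_rdistrib matrix_mul_assoc[symmetric] 1[of X] 1[of P] 2)
  qed
  moreover have "0 + mat \<i> ** (P ** X) + mat (- \<i>) ** (X ** P) + mat 0 ** (P ** X ** P) = commutator (mat \<i> ** P) X"
  proof -
    have "mat (- \<i>) ** (X ** P) = - (mat \<i> ** (X ** P))" by (simp add: vec_eq_iff mat_mult_component)
    moreover have "X ** (mat \<i> ** P) = mat \<i> ** (X ** P)" by (metis mat_mult_commute matrix_mul_assoc)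
    ultimately show ?thesis by (simp add: commutator_def matrix_mul_assoc[symmetric])
  qed
  ultimately show ?thesis by simp
qed

section \<open>Tuples of Hermitian matrices\<close>

lemma unitary_mult: "unitary g \<Longrightarrow> unitary h \<Longrightarrow> unitary (g ** h)"
  unfolding unitary_def cadjoint_mult by (metis matrix_mul_assoc matrix_mul_rid)

lemma unitary_one: "unitary (mat 1)"
  by (simp add: unitary_def)

lemma unitary_inverse: "unitary g \<Longrightarrow> cadjoint g ** g = mat 1"
  unfolding unitary_def using matrix_left_right_inverse by blast

lemma unitary_cadjoint: "unitary g \<Longrightarrow> unitary (cadjoint g)"
  using unitary_inverse by (simp add: unitary_def)

lemma conj_act_mult: "conj_act g (conj_act h x) = conj_act (g ** h) x"
  by (simp add: conj_act_def vec_eq_iff[where 'b = 'b] cadjoint_mult matrix_mul_assoc)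

lemma conj_act_one [simp]: "conj_act (mat 1) x = x"
  by (simp add: conj_act_def)

lemma conj_act_inverse: "unitary g \<Longrightarrow> conj_act (cadjoint g) (conj_act g x) = x"
  by (simp add: conj_act_mult unitary_inverse)

lemma linear_conj_act: "linear (conj_act g)"
  by (rule linearI)
    (simp_all add: conj_act_def vec_eq_iff[where 'b = 'b] matrix_add_ldistrib matrix_add_rdistrib
      matrix_scaleR_left matrix_scaleR_right)

lemma orbit_conj_act: "unitary g \<Longrightarrow> orbit (conj_act g e) = orbit e"
proof -
  have sub: "orbit (conj_act g e) \<subseteq> orbit e" if "unitary g" for g and e :: "('a, 'b) tuple"
    using that unitary_mult by (auto simp: orbit_def conj_act_mult)
  assume g: "unitary g"
  show ?thesis using sub[OF g] sub[OF unitary_cadjoint[OF g], of "conj_act g e"]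
    by (simp add: conj_act_inverse[OF g] subset_antisym)
qed

lemma orbit_refl: "e \<in> orbit e"
  unfolding orbit_def using unitary_one conj_act_one by (metis (mono_tags, lifting) mem_Collect_eq)

lemma conj_act_hermitian: "x \<in> hermitian_tuples \<Longrightarrow> conj_act g x \<in> hermitian_tuples"
  by (simp add: hermitian_tuples_def conj_act_def hermitian_conj)

lemma partial_sum_conj_act: "partial_sum (conj_act g e) i = g ** partial_sum e i ** cadjoint g"
  unfolding partial_sum_def conj_act_def by (simp only: vec_lambda_beta matrix_mul_sum_left matrix_mul_sum_right)

lemma hermitian_partial_sum: "e \<in> hermitian_tuples \<Longrightarrow> hermitian (partial_sum e i)"
  unfolding partial_sum_def hermitian_tuples_def by (intro hermitian_sum) simp

lemma lam_eq: "lam e i j = (if j \<le> CARD('d) then eigenvalue (partial_sum e i) (j - 1) else 0)"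
  for e :: "('d::finite, 'n::{finite,linorder}) tuple"
  by (simp add: lam_def eigenvalue_def)

lemma lam_conj_act:
  assumes "e \<in> hermitian_tuples" "unitary g"
  shows "lam (conj_act g e) i j = lam e i j"
proof -
  note h = hermitian_partial_sum[OF assms(1), of i]
  obtain u where "eigenbasis (partial_sum e i) u" using ex_eigenbasis[OF h] ..
  then show ?thesis
    by (simp only: lam_eq partial_sum_conj_act eigenvalue_unitary_conj(1)[OF h assms(2)])
qed

lemma sum_lam_eq_top_sum:
  assumes "j \<le> CARD('d)"
  shows "(\<Sum>k = 1..j. lam (e :: ('d::finite, 'n::{finite,linorder}) tuple) i k) = top_sum (partial_sum e i) j"
  unfolding top_sum_def
  using assms by (simp add: sum.atLeast1_atMost_eq lam_eq)

lemma hinner_unitary: "unitary g \<Longrightarrow> hinner (g *v v) (g *v w) = hinner v w"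
  by (simp add: hinner_adjoint matrix_vector_mul_assoc unitary_inverse)

lemma norm_unitary: "unitary g \<Longrightarrow> norm (g *v v) = norm v"
  using hinner_unitary[of g v v] unfolding hinner_self of_real_eq_iff by (simp add: power2_eq_iff_nonneg)

lemma coadjoint_orbit_conj:
  assumes "X \<in> coadjoint_orbit t" "unitary g"
  shows "g ** X ** cadjoint g \<in> coadjoint_orbit t"
proof -
  obtain w where w: "X = scale_mat t (outer w)" "norm w = 1"
    using assms(1) by (auto simp: coadjoint_orbit_def)
  have "g ** X ** cadjoint g = scale_mat t (outer (g *v w))"
    by (simp add: w scale_mat_eq matrix_scaleR_left matrix_scaleR_right outer_unitary)
  then show ?thesis using norm_unitary[OF assms(2), of w] w(2) by (auto simp: coadjoint_orbit_def)
qed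

lemma conj_act_N_tilde: "e \<in> N_tilde r \<Longrightarrow> unitary g \<Longrightarrow> conj_act g e \<in> N_tilde r"
  by (simp add: N_tilde_def conj_act_def coadjoint_orbit_conj)

lemma N_tilde_hermitian: "N_tilde r \<subseteq> hermitian_tuples"
  by (auto simp: N_tilde_def hermitian_tuples_def coadjoint_orbit_def scale_mat_eq)
    (metis hermitian_outer hermitian_scaleR)

lemma conj_act_M_tilde:
  fixes e :: "('d::finite, 'n::finite) tuple"
  assumes "e \<in> M_tilde r" "unitary g"
  shows "conj_act g e \<in> M_tilde r"
proof -
  have "g ** mat c ** cadjoint g = mat c" for c
    using assms(2) by (metis mat_mult_commute matrix_mul_assoc matrix_mul_rid unitary_def)
  then have "(\<Sum>k\<in>UNIV. conj_act g e $ k) = mat (complex_of_real ((\<Sum>k\<in>UNIV. r $ k) / real CARD('d)))"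
    using assms(1) by (simp add: conj_act_def M_tilde_def matrix_mul_sum_left[symmetric] matrix_mul_sum_right[symmetric])
  then show ?thesis using assms conj_act_N_tilde by (auto simp: M_tilde_def)
qed

lemma M_tilde0_hermitian: "M_tilde0 r \<subseteq> hermitian_tuples"
  using N_tilde_hermitian by (auto simp: M_tilde0_def M_tilde_def)

lemma conj_act_M_tilde0:
  assumes "e \<in> M_tilde0 r" "unitary g"
  shows "conj_act g e \<in> M_tilde0 r"
proof -
  have "e \<in> hermitian_tuples" using assms(1) M_tilde0_hermitian by blast
  moreover have "conj_act g e \<in> M_tilde r"
    using assms by (intro conj_act_M_tilde) (simp_all add: M_tilde0_def)
  ultimately show ?thesis using assms
    unfolding M_tilde0_def by (simp add: lam_conj_act del: One_nat_def)
qed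

lemma action_orbit:
  assumes "e \<in> hermitian_tuples"
  shows "action i j (orbit e) = (\<Sum>k = 1..j. lam e i k)"
proof -
  have "(\<lambda>e. \<Sum>k = 1..j. lam e i k) ` orbit e = {\<Sum>k = 1..j. lam e i k}"
    using orbit_refl[of e] lam_conj_act[OF assms] by (auto simp: orbit_def)
  then show ?thesis by (simp add: action_def)
qed

text \<open>The orthogonal projection onto \<open>hermitian_tuples\<close>. Neighbourhoods of
  extensions must be open among all tuples, while eigenvalue conditions are meant for Hermitian
  ones; they are imposed on \<open>herm_part x\<close>.\<close>

definition herm_part :: "('d::finite, 'n::finite) tuple \<Rightarrow> ('d, 'n) tuple" where
  "herm_part x = (\<chi> k. (1/2) *\<^sub>R (x $ k + cadjoint (x $ k)))"

lemma linear_herm_part: "linear herm_part"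
  by (rule linearI)
    (simp_all add: herm_part_def vec_eq_iff[where 'b = 'b] cadjoint_add cadjoint_scaleR scaleR_add_right mult.commute)

lemma herm_part_hermitian: "herm_part x \<in> hermitian_tuples"
  by (simp add: herm_part_def hermitian_tuples_def hermitian_def cadjoint_scaleR cadjoint_add add.commute)

lemma herm_part_id: "x \<in> hermitian_tuples \<Longrightarrow> herm_part x = x"
  by (simp add: herm_part_def hermitian_tuples_def hermitian_def vec_eq_iff[where 'b = 'b] scaleR_2[symmetric])

lemma herm_part_conj_act: "herm_part (conj_act g x) = conj_act g (herm_part x)"
  by (simp add: herm_part_def conj_act_def vec_eq_iff[where 'b = 'b] cadjoint_mult matrix_mul_assoc
      matrix_add_ldistrib matrix_add_rdistrib matrix_scaleR_left matrix_scaleR_right)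

lemma hermitian_tuples_diff:
  "x \<in> hermitian_tuples \<Longrightarrow> y \<in> hermitian_tuples \<Longrightarrow> x - y \<in> hermitian_tuples"
  by (simp add: hermitian_tuples_def hermitian_diff)

lemma inner_cadjoint: "cadjoint A \<bullet> cadjoint B = A \<bullet> B"
proof -
  have "cadjoint A \<bullet> cadjoint B = (\<Sum>i\<in>UNIV. \<Sum>j\<in>UNIV. A $ j $ i \<bullet> B $ j $ i)"
    by (simp add: inner_vec_def cadjoint_def inner_complex_def)
  then show ?thesis by (simp add: inner_vec_def) (rule sum.swap)
qed

lemma inner_herm_part: "y \<in> hermitian_tuples \<Longrightarrow> herm_part x \<bullet> y = x \<bullet> y"
proof -
  assume "y \<in> hermitian_tuples"
  then have y: "cadjoint (y $ k) = y $ k" for k by (simp add: hermitian_tuples_def hermitian_def)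
  have "cadjoint (x $ k) \<bullet> y $ k = x $ k \<bullet> y $ k" for k
    using inner_cadjoint[of "x $ k" "y $ k"] by (simp add: y)
  then show ?thesis by (simp add: inner_vec_def[where 'b = 'b] herm_part_def inner_add_left)
qed

section \<open>Gradients with respect to \<open>Im Tr\<close>\<close>

lemma trace_mat_mult: "trace (mat c ** A) = c * trace (A :: complex^'d^'d)"
  by (simp add: trace_def mat_mult_component sum_distrib_left)

lemma Im_trace_i: "hermitian B \<Longrightarrow> Im (trace ((mat \<i> ** A) ** B)) = A \<bullet> B"
  by (simp add: matrix_mul_assoc[symmetric] trace_mat_mult inner_eq_trace hermitian_def)

text \<open>A derivative within \<open>hermitian_tuples\<close> is tested only on Hermitian
  increments, so a linear map that agrees with \<open>F'\<close> there may replace it.\<close>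

lemma has_gradientI:
  fixes F :: "('d::finite, 'n::finite) tuple \<Rightarrow> real"
  assumes F': "(F has_derivative F') (at e within hermitian_tuples)" and e: "e \<in> hermitian_tuples"
    and skew: "\<And>k. skew_hermitian (D $ k)"
    and D: "\<And>y. y \<in> hermitian_tuples \<Longrightarrow> (\<Sum>k\<in>UNIV. Im (trace (D $ k ** y $ k))) = F' y"
  shows "has_gradient F D e"
proof -
  have "linear (\<lambda>y. \<Sum>k\<in>UNIV. Im (trace (D $ k ** y $ k)))"
    by (rule linearI)
      (simp_all add: matrix_add_ldistrib trace_add matrix_scaleR_right sum.distrib sum_distrib_left
        trace_def scaleR_sum_right[symmetric] Im_sum)
  then have "bounded_linear (\<lambda>y. \<Sum>k\<in>UNIV. Im (trace (D $ k ** y $ k)))"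
    by (simp add: linear_conv_bounded_linear)
  then have "(F has_derivative (\<lambda>y. \<Sum>k\<in>UNIV. Im (trace (D $ k ** y $ k)))) (at e within hermitian_tuples)"
    using F' unfolding has_derivative_within_alt by (simp only: D[OF hermitian_tuples_diff[OF _ e]] cong: ball_cong) blast
  then show ?thesis using skew by (simp add: has_gradient_def)
qed

lemma skew_hermitian_i: "hermitian A \<Longrightarrow> skew_hermitian (mat \<i> ** A)"
proof -
  assume "hermitian A"
  then have "cadjoint (mat \<i> ** A) = mat (- \<i>) ** A"
    by (simp add: hermitian_def cadjoint_mult mat_mult_commute)
  then show ?thesis by (simp add: skew_hermitian_def vec_eq_iff mat_mult_component)
qed

text \<open>Represent the derivative by the Euclidean product with some \<open>Z\<close>; the
  Hermitian part of \<open>Z\<close> represents it equally well on Hermitian increments, and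
  multiplication by \<open>\<i>\<close> makes it skew-Hermitian.\<close>

lemma differentiable_imp_has_gradient:
  fixes F :: "('d::finite, 'n::finite) tuple \<Rightarrow> real"
  assumes F: "F differentiable (at e within hermitian_tuples)" and e: "e \<in> hermitian_tuples"
  shows "\<exists>D. has_gradient F D e"
proof -
  obtain F' where F': "(F has_derivative F') (at e within hermitian_tuples)"
    using F by (auto simp: differentiable_def)
  have lF': "linear F'" using F' has_derivative_linear by blast
  interpret linear F' by (rule lF')
  define Z where "Z = (\<Sum>b\<in>Basis. F' b *\<^sub>R b)"
  have Z: "F' y = Z \<bullet> y" for y
  proof -
    have "F' y = F' (\<Sum>b\<in>Basis. (y \<bullet> b) *\<^sub>R b)" by (simp only: euclidean_representation)
    also have "\<dots> = (\<Sum>b\<in>Basis. (y \<bullet> b) * F' b)" by (simp only: sum scale real_scaleR_def)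
    finally show ?thesis unfolding Z_def by (simp add: inner_sum_left inner_commute[of y] mult.commute)
  qed
  define D where "D = (\<chi> k. mat \<i> ** herm_part Z $ k)"
  have skew: "skew_hermitian (D $ k)" for k
    using herm_part_hermitian[of Z] by (simp add: D_def skew_hermitian_i hermitian_tuples_def)
  have D: "(\<Sum>k\<in>UNIV. Im (trace (D $ k ** y $ k))) = F' y" if "y \<in> hermitian_tuples" for y
  proof -
    have "(\<Sum>k\<in>UNIV. Im (trace (D $ k ** y $ k))) = (\<Sum>k\<in>UNIV. herm_part Z $ k \<bullet> y $ k)"
      using that by (simp add: D_def Im_trace_i hermitian_tuples_def)
    also have "\<dots> = herm_part Z \<bullet> y" by (simp add: inner_vec_def[where 'b = 'n])
    finally show ?thesis by (simp add: inner_herm_part[OF that] Z)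
  qed
  show ?thesis using has_gradientI[OF F' e skew D] by blast
qed

text \<open>When \<open>c'\<close> is the Hamiltonian field of a gradient, the derivative is a
  \<open>lie_poisson\<close> value by definition; brackets thus become derivatives along
  flows.\<close>

lemma has_gradient_curve:
  assumes G: "has_gradient G D e"
    and c: "(c has_vector_derivative c') (at 0)" "c 0 = e" "\<And>t. c t \<in> hermitian_tuples"
  shows "((\<lambda>t. G (c t)) has_real_derivative (\<Sum>k\<in>UNIV. Im (trace (D $ k ** c' $ k)))) (at (0::real))"
proof -
  define L where "L y = (\<Sum>k\<in>UNIV. Im (trace (D $ k ** y $ k)))" for y
  have G': "(G has_derivative L) (at (c 0) within hermitian_tuples)"
    using G c(2) by (simp add: has_gradient_def L_def[abs_def])
  have "((\<lambda>t. G (c t)) has_derivative (\<lambda>t. L (t *\<^sub>R c'))) (at 0)"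
    using c(1,3) has_derivative_in_compose2[OF _ _ UNIV_I, of hermitian_tuples G] G'
    unfolding has_vector_derivative_def
    by (intro has_derivative_in_compose[of c _ 0 UNIV G] ) (auto intro: has_derivative_subset)
  moreover have "L (t *\<^sub>R c') = L c' * t" for t
    using has_derivative_linear[OF G'] by (simp add: linear_scale mult.commute)
  ultimately show ?thesis unfolding L_def[symmetric] has_field_derivative_def by simp
qed

lemma hermitian_eq_0I:
  fixes A :: "complex^'d^'d"
  assumes A: "hermitian A" and 0: "\<And>v. norm v = 1 \<Longrightarrow> Re (hinner (A *v v) v) = 0"
  shows "A = 0"
proof -
  obtain u where u: "eigenbasis A u" using ex_eigenbasis[OF A] ..
  show ?thesis
  proof (rule matrix_eqI_orthonormal[OF eigenbasisD(1)[OF u]])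
    fix i assume i: "i < CARD('d)"
    have "eigenvalue A i = 0"
      using 0[of "u i"] i orthonormal_norm[OF eigenbasisD(1)[OF u] i] orthonormalD[OF eigenbasisD(1)[OF u] i i]
      by (simp add: eigenbasisD(2)[OF u] hinner_scale_left)
    then show "A *v u i = 0 *v u i" using i by (simp add: eigenbasisD(2)[OF u])
  qed
qed

lemma trace_mult_commutator: "trace (A ** commutator B X) = trace (B ** commutator X (A :: complex^'d^'d))"
proof -
  have "trace (A ** (B ** X)) = trace (B ** (X ** A))" "trace (A ** (X ** B)) = trace (B ** (A ** X))"
    by (metis matrix_mul_assoc trace_mul_sym)+
  then show ?thesis by (simp add: commutator_def matrix_diff_ldistrib trace_sub)
qed

lemma hermitian_commutator: "skew_hermitian D \<Longrightarrow> hermitian X \<Longrightarrow> hermitian (commutator D X)"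
  by (simp add: hermitian_def skew_hermitian_def commutator_def cadjoint_diff cadjoint_mult
      matrix_minus_left matrix_minus_right)

lemma commutator_swap: "commutator A B = - commutator B A"
  by (simp add: commutator_def)

text \<open>The sum is the derivative of the momentum map along the Hamiltonian field. Rotations
  \<open>rot P\<close> with \<open>P = outer v\<close> are enough to test invariance: the derivative
  of \<open>G\<close> along them is minus the quadratic form of the sum at \<open>v\<close>, and a
  Hermitian matrix with zero quadratic form vanishes.\<close>

lemma invariant_imp_sum_commutator_0:
  fixes e :: "('d::finite, 'n::finite) tuple"
  assumes G: "has_gradient G D e" and e: "e \<in> hermitian_tuples"
    and inv: "\<And>g. unitary g \<Longrightarrow> G (conj_act g e) = G e"
  shows "(\<Sum>k\<in>UNIV. commutator (D $ k) (e $ k)) = 0"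
proof (rule hermitian_eq_0I)
  have he: "hermitian (e $ k)" "skew_hermitian (D $ k)" for k
    using e G by (auto simp: hermitian_tuples_def has_gradient_def)
  show h: "hermitian (\<Sum>k\<in>UNIV. commutator (D $ k) (e $ k))"
    using he by (intro hermitian_sum hermitian_commutator)
  fix v :: "complex^'d" assume v: "norm v = 1"
  define P where "P = outer v"
  have P: "hermitian P" "P ** P = P"
    using v by (simp_all add: P_def hermitian_outer mult_outer outer_mult_vec hinner_self)
      (simp add: rank1_def outer_def)
  define c where "c t = conj_act (rot P t) e" for t
  have "(c has_vector_derivative (\<chi> k. commutator (mat \<i> ** P) (e $ k))) (at 0)"
    using has_vector_derivative_rot_conj[OF P(1)]
    unfolding c_def[abs_def] conj_act_def by (intro has_vector_derivative_vecI[where 'n = 'n]) simp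
  then have "((\<lambda>t. G (c t)) has_real_derivative
      (\<Sum>k\<in>UNIV. Im (trace (D $ k ** (\<chi> k. commutator (mat \<i> ** P) (e $ k)) $ k)))) (at 0)"
    by (rule has_gradient_curve[OF G]) (simp_all add: c_def conj_act_hermitian e)
  moreover have "(\<lambda>t. G (c t)) = (\<lambda>t. G e)" using inv unitary_rot[OF P(2,1)] by (simp add: c_def)
  ultimately have "(\<Sum>k\<in>UNIV. Im (trace (D $ k ** commutator (mat \<i> ** P) (e $ k)))) = 0"
    using DERIV_unique[OF _ DERIV_const] by force
  moreover have "Im (trace (D $ k ** commutator (mat \<i> ** P) (e $ k))) = - Re (hinner (commutator (D $ k) (e $ k) *v v) v)" for k
  proof -
    have "trace (D $ k ** commutator (mat \<i> ** P) (e $ k)) = trace ((mat \<i> ** P) ** commutator (e $ k) (D $ k))"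
      by (rule trace_mult_commutator)
    also have "\<dots> = - trace ((mat \<i> ** P) ** commutator (D $ k) (e $ k))"
      by (subst commutator_swap) (simp add: matrix_minus_right trace_def sum_negf)
    finally show ?thesis
      using Im_trace_i[OF hermitian_commutator[OF he(2) he(1)], of P k k] inner_commute[of P]
      by (simp add: P_def inner_outer)
  qed
  ultimately show "Re (hinner ((\<Sum>k\<in>UNIV. commutator (D $ k) (e $ k)) *v v) v) = 0"
    by (simp add: matrix_vector_mul_sum hinner_sum_left sum_negf)
qed

section \<open>Eigenvalues of the partial sums\<close>

lemma ix_bij: "bij_betw (ix :: nat \<Rightarrow> 'n::{finite,linorder}) {1..CARD('n)} UNIV"
proof -
  have "bij_betw ((!) (sorted_list_of_set (UNIV :: 'n set))) {..<CARD('n)} UNIV"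
    by (rule bij_betw_nth) simp_all
  moreover have "bij_betw (\<lambda>k. k - 1) {1..CARD('n)} {..<CARD('n)}"
    by (rule bij_betw_byWitness[where f' = Suc]) auto
  ultimately have "bij_betw ((!) (sorted_list_of_set (UNIV :: 'n set)) \<circ> (\<lambda>k. k - 1)) {1..CARD('n)} UNIV"
    by (rule bij_betw_trans[rotated])
  moreover have "(ix :: nat \<Rightarrow> 'n) = (!) (sorted_list_of_set UNIV) \<circ> (\<lambda>k. k - 1)"
    by (simp add: fun_eq_iff ix_def)
  ultimately show ?thesis by simp
qed

lemma sum_ix: "(\<Sum>q\<in>UNIV. f q) = (\<Sum>k = 1..CARD('n). f (ix k :: 'n::{finite,linorder}))"
  by (rule sum.reindex_bij_betw[OF ix_bij, symmetric])

lemma ix_inj: "a \<in> {1..CARD('n)} \<Longrightarrow> b \<in> {1..CARD('n)} \<Longrightarrow> ix a = (ix b :: 'n::{finite,linorder}) \<longleftrightarrow> a = b"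
  by (rule inj_on_eq_iff[OF bij_betw_imp_inj_on[OF ix_bij]])

lemma partial_sum_Suc: "partial_sum e (Suc i) = partial_sum e i + e $ ix (i + 2)"
  by (simp add: partial_sum_def)

lemma eigenvalue_nonneg:
  assumes A: "hermitian (A :: complex^'d^'d)" and pos: "\<And>x. Re (hinner (A *v x) x) \<ge> 0" and i: "i < CARD('d)"
  shows "eigenvalue A i \<ge> 0"
proof -
  obtain u where u: "eigenbasis A u" using ex_eigenbasis[OF A] ..
  have "Re (hinner (A *v u i) (u i)) = eigenvalue A i"
    using i orthonormalD[OF eigenbasisD(1)[OF u] i i] by (simp add: eigenbasisD(2)[OF u] hinner_scale_left)
  then show ?thesis using pos[of "u i"] by simp
qed

text \<open>If it were positive, the top \<open>k + 1\<close> eigenvectors would all lie in the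
  range of \<open>A\<close>, which is spanned by at most \<open>k\<close> vectors.\<close>

lemma eigenvalue_rank:
  fixes A :: "complex^'d^'d"
  assumes A: "hermitian A" and rng: "\<And>x. A *v x \<in> vec.span S" and S: "finite S" "card S \<le> k" and k: "k < CARD('d)"
  shows "eigenvalue A k \<le> 0"
proof (rule ccontr)
  assume pos: "\<not> eigenvalue A k \<le> 0"
  obtain u where u: "eigenbasis A u" using ex_eigenbasis[OF A] ..
  have "u i \<in> vec.span S" if i: "i \<le> k" for i
  proof -
    have nz: "eigenvalue A i > 0" using pos eigenvalue_antimono[OF A i k] by linarith
    have "A *v u i = of_real (eigenvalue A i) *s u i"
      using i k by (intro eigenbasisD(2)[OF u]) simp
    then have "of_real (1 / eigenvalue A i) *s (A *v u i) = u i"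
      using nz by (simp add: vector_smult_assoc flip: of_real_mult)
    then show ?thesis using vec.span_scale[OF rng[of "u i"], of "of_real (1 / eigenvalue A i)"] by simp
  qed
  then have sub: "u ` {..k} \<subseteq> vec.span S" by auto
  have "vec.independent (u ` {..k})"
    using k by (intro orthonormal_independent[OF eigenbasisD(1)[OF u]]) auto
  then have "card (u ` {..k}) \<le> card S"
    using vec.independent_span_bound[OF S(1) _ sub] by simp
  moreover have "card (u ` {..k}) = Suc k"
    using k by (subst card_image) (auto intro: inj_on_subset[OF orthonormal_inj[OF eigenbasisD(1)[OF u]]])
  ultimately show False using S(2) by simp
qed

section \<open>Consequences of strict interlacing\<close>

lemma no_eigenvector_between:
  assumes A: "hermitian (A :: complex^'d^'d)" and hi: "\<And>i. i < j \<Longrightarrow> i < CARD('d) \<Longrightarrow> x < eigenvalue A i"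
    and lo: "\<And>i. j \<le> i \<Longrightarrow> i < CARD('d) \<Longrightarrow> eigenvalue A i < x"
    and v: "A *v v = of_real x *s v"
  shows "v = 0"
proof (rule ccontr)
  assume "v \<noteq> 0"
  then obtain i where i: "i < CARD('d)" "eigenvalue A i = x" using eigenvalue_of_eigenvector[OF A v] by blast
  show False using hi[of i] lo[of i] i by (cases "i < j") auto
qed

lemma scaleR_outer_mult_vec: "(c *\<^sub>R outer v) *v x = (of_real c * hinner x v) *s v"
  by (simp add: scaleR_matrix_mult_vec outer_mult_vec scaleR_eq_scale vector_smult_assoc)

text \<open>The assumptions on \<open>w\<close> range over all \<open>k\<close>; outside
  \<open>{1..CARD('n)}\<close> the term \<open>ix k\<close> still denotes some index, and range
  conditions are avoided.\<close>

locale strict_tuple =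
  fixes r :: "real^'n::{finite,linorder}" and e :: "('d::finite, 'n) tuple" and w :: "nat \<Rightarrow> complex^'d"
  assumes e: "e \<in> M_tilde0 r" and r: "\<And>a. r $ a > 0"
    and w: "\<And>k. norm (w k) = 1" "\<And>k. e $ ix k = r $ ix k *\<^sub>R outer (w k)"
begin

lemma herm: "e \<in> hermitian_tuples"
  using e M_tilde0_hermitian by blast

lemma hermA: "hermitian (partial_sum e i)"
  using herm by (rule hermitian_partial_sum)

text \<open>The last two hypotheses say that the entry \<open>(i - 1, j)\<close> is unforced. It
  occurs in both inequalities, so neither exception for forced pairs can apply.\<close>

lemma strict:
  assumes "1 \<le> i" "i \<le> CARD('n) - 1" "1 \<le> j" "j \<le> i" "CARD('d) + i < j + CARD('n)" "j \<le> CARD('d)"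
  shows "lam e i (j + 1) < lam e (i - 1) j" "lam e (i - 1) j < lam e i j"
proof -
  have "CARD('d) > 0" by simp
  then have "\<not> both_forced (CARD('d) - 1) CARD('n) i j (i - 1) j"
    "\<not> both_forced (CARD('d) - 1) CARD('n) (i - 1) j i (j + 1)"
    using assms by (auto simp: both_forced_def forced_Lambda_def forced_zero_def)
  moreover have "(lam e i j > lam e (i - 1) j \<or> both_forced (CARD('d) - 1) CARD('n) i j (i - 1) j) \<and>
     (lam e (i - 1) j > lam e i (j + 1) \<or> both_forced (CARD('d) - 1) CARD('n) (i - 1) j i (j + 1))"
    using e assms(1-4) unfolding M_tilde0_def by blast
  ultimately show "lam e i (j + 1) < lam e (i - 1) j" "lam e (i - 1) j < lam e i j" by blast+
qed

lemma next_partial_sum: "partial_sum e (Suc i) *v x = partial_sum e i *v x + (r $ ix (i + 2) * hinner x (w (i + 2))) *s w (i + 2)"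
  by (simp add: partial_sum_Suc w matrix_vector_mult_add_rdistrib scaleR_outer_mult_vec)

lemma partial_sum_mult_vec: "partial_sum e i *v x = (\<Sum>k = 1..i + 1. (r $ ix k * hinner x (w k)) *s w k)"
proof (induction i)
  case 0
  show ?case by (simp add: partial_sum_def w scaleR_outer_mult_vec)
next
  case (Suc i)
  then show ?case by (simp add: next_partial_sum)
qed

lemma lam_nonneg: "lam e i j \<ge> 0"
proof -
  have "Re (hinner (partial_sum e i *v x) x) \<ge> 0" for x
  proof -
    have "hinner (partial_sum e i *v x) x = (\<Sum>k = 1..i + 1. of_real (r $ ix k * (cmod (hinner x (w k)))\<^sup>2))"
      unfolding partial_sum_mult_vec hinner_sum_left hinner_scale_left of_real_mult complex_norm_square
      by (intro sum.cong refl) (simp only: hinner_commute[of "w _" x] mult.assoc)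
    then have "Re (hinner (partial_sum e i *v x) x) = (\<Sum>k = 1..i + 1. r $ ix k * (cmod (hinner x (w k)))\<^sup>2)"
      unfolding of_real_sum[symmetric] by simp
    also have "\<dots> \<ge> 0" using r by (intro sum_nonneg mult_nonneg_nonneg) (auto intro: less_imp_le)
    finally show ?thesis .
  qed
  note nn = eigenvalue_nonneg[OF hermA this]
  show ?thesis
  proof (cases "j \<le> CARD('d)")
    case True
    then have "j - 1 < CARD('d)" using zero_less_card_finite[where 'a = 'd] by linarith
    then show ?thesis using nn True by (simp only: lam_eq if_True)
  qed (simp add: lam_eq)
qed

lemma partial_sum_rank:
  assumes "i + 1 < CARD('d)"
  shows "eigenvalue (partial_sum e i) (i + 1) \<le> 0"
proof (rule eigenvalue_rank[OF hermA])
  show "partial_sum e i *v x \<in> vec.span (w ` {1..i + 1})" for x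
    unfolding partial_sum_mult_vec by (intro vec.span_sum vec.span_scale vec.span_base) auto
  show "card (w ` {1..i + 1}) \<le> i + 1" using card_image_le[of "{1..i + 1}" w] by simp
qed (use assms in auto)

text \<open>The unforced value \<open>lam e i j\<close> lies strictly between the consecutive
  entries \<open>j + 1\<close> and \<open>j\<close> of the next row, so it is no eigenvalue of the
  next partial sum.\<close>

lemma no_eigenvector_next:
  assumes "i + 2 \<le> CARD('n)" "1 \<le> j" "j \<le> i + 1" "CARD('d) + i + 1 < j + CARD('n)" "j \<le> CARD('d)"
    and v: "partial_sum e (Suc i) *v v = of_real (lam e i j) *s v"
  shows "v = 0"
proof (rule no_eigenvector_between[OF hermA _ _ v, of j])
  have s: "lam e (Suc i) (j + 1) < lam e i j" "lam e i j < lam e (Suc i) j"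
    using strict[of "Suc i" j] assms by simp_all
  fix a assume a: "a < CARD('d)"
  {
    assume "a < j"
    then have "eigenvalue (partial_sum e (Suc i)) (j - 1) \<le> eigenvalue (partial_sum e (Suc i)) a"
      using assms(5) by (intro eigenvalue_antimono[OF hermA]) auto
    then show "lam e i j < eigenvalue (partial_sum e (Suc i)) a" using s(2) assms(5) by (simp add: lam_eq)
  }
  {
    assume "j \<le> a"
    then have "eigenvalue (partial_sum e (Suc i)) a \<le> eigenvalue (partial_sum e (Suc i)) j"
      using a by (intro eigenvalue_antimono[OF hermA]) auto
    then show "eigenvalue (partial_sum e (Suc i)) a < lam e i j" using s(1) a \<open>j \<le> a\<close> by (simp add: lam_eq)
  }
qed

text \<open>The same argument with the entries \<open>j\<close> and \<open>j - 1\<close> of the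
  previous row as lower and upper neighbours.\<close>

lemma no_eigenvector_prev:
  assumes i: "1 \<le> i" "i + 2 \<le> CARD('n)" and j: "1 \<le> j" "j \<le> i + 1" "CARD('d) + i + 1 < j + CARD('n)" "j \<le> CARD('d)"
    and v: "partial_sum e (i - 1) *v v = of_real (lam e i j) *s v"
  shows "v = 0"
proof (rule no_eigenvector_between[OF hermA _ _ v, of "j - 1"])
  let ?A = "partial_sum e (i - 1)"
  fix a assume a: "a < CARD('d)"
  {
    assume aj: "a < j - 1"
    have "eigenvalue ?A (j - 1 - 1) \<le> eigenvalue ?A a"
      using aj j by (intro eigenvalue_antimono[OF hermA]) auto
    moreover have "lam e i (j - 1 + 1) < lam e (i - 1) (j - 1)"
      using aj i j by (intro strict) auto
    moreover have "lam e (i - 1) (j - 1) = eigenvalue ?A (j - 1 - 1)" using j by (auto simp: lam_eq)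
    moreover have "j - 1 + 1 = j" using j by simp
    ultimately show "lam e i j < eigenvalue ?A a" by simp
  }
  {
    assume aj: "j - 1 \<le> a"
    then have le: "eigenvalue ?A a \<le> eigenvalue ?A (j - 1)"
      using a by (intro eigenvalue_antimono[OF hermA]) auto
    show "eigenvalue ?A a < lam e i j"
    proof (cases "j \<le> i")
      case True
      then have "lam e (i - 1) j < lam e i j" using i j by (intro strict) auto
      moreover have "lam e (i - 1) j = eigenvalue ?A (j - 1)" using j(4) by (simp add: lam_eq)
      ultimately show ?thesis using le by linarith
    next
      \<comment> \<open>At the edge \<open>j = i + 1\<close> the lower neighbour is outside the
        triangular pattern. The previous partial sum has rank at most \<open>i\<close>, so its
        eigenvalue there is at most 0, while \<open>lam e i j\<close> exceeds a nonnegative entry of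
        the next row.\<close>
      case False
      then have ji: "j = i + 1" using j by simp
      then have ii: "i - 1 + 1 = j - 1" "j - 1 < CARD('d)" using i(1) j(1,4) by linarith+
      have "eigenvalue ?A (j - 1) \<le> 0" using partial_sum_rank[of "i - 1"] unfolding ii(1) using ii(2) by blast
      moreover have "lam e (Suc i) (j + 1) < lam e (Suc i - 1) j"
        using i j by (intro strict) auto
      moreover have "lam e (Suc i - 1) j = lam e i j" by simp
      ultimately show ?thesis using le lam_nonneg[of "Suc i" "j + 1"] by linarith
    qed
  }
qed

text \<open>Consecutive partial sums differ by a multiple of \<open>outer (w (i + 2))\<close>, so an
  eigenvector orthogonal to \<open>w (i + 2)\<close> would keep its eigenvalue in the next
  row.\<close>

lemma eigenvector_not_orthogonal_next:
  assumes j: "i + 2 \<le> CARD('n)" "1 \<le> j" "j \<le> i + 1" "CARD('d) + i + 1 < j + CARD('n)" "j \<le> CARD('d)"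
    and u: "u \<in> eigenspace (partial_sum e i) (lam e i j)" "u \<noteq> 0"
  shows "hinner u (w (i + 2)) \<noteq> 0"
proof
  assume "hinner u (w (i + 2)) = 0"
  then have "partial_sum e (Suc i) *v u = of_real (lam e i j) *s u"
    using u(1) by (simp add: next_partial_sum eigenspace_def)
  then show False using no_eigenvector_next[OF j] u(2) by blast
qed

lemma eigenvector_not_orthogonal_prev:
  assumes i: "1 \<le> i" "i + 2 \<le> CARD('n)" and j: "1 \<le> j" "j \<le> i + 1" "CARD('d) + i + 1 < j + CARD('n)" "j \<le> CARD('d)"
    and u: "u \<in> eigenspace (partial_sum e i) (lam e i j)" "u \<noteq> 0"
  shows "hinner u (w (i + 1)) \<noteq> 0"
proof
  assume "hinner u (w (i + 1)) = 0"
  then have "partial_sum e (i - 1) *v u = of_real (lam e i j) *s u"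
    using u(1) i(1) next_partial_sum[of "i - 1" u] by (simp add: eigenspace_def)
  then show False using no_eigenvector_prev[OF i j] u(2) by blast
qed

text \<open>A two-dimensional eigenspace would contain a nonzero vector orthogonal to
  \<open>w (i + 2)\<close>; \<open>v\<close> below is such a combination.\<close>

lemma simple_eigenvalue:
  assumes j: "i + 2 \<le> CARD('n)" "1 \<le> j" "j \<le> i + 1" "CARD('d) + i + 1 < j + CARD('n)" "j \<le> CARD('d)"
    and b: "b < CARD('d)" "b \<noteq> j - 1"
  shows "eigenvalue (partial_sum e i) b \<noteq> lam e i j"
proof
  assume eq: "eigenvalue (partial_sum e i) b = lam e i j"
  obtain u where u: "eigenbasis (partial_sum e i) u" using ex_eigenbasis[OF hermA] by blast
  have j1: "j - 1 < CARD('d)" "lam e i j = eigenvalue (partial_sum e i) (j - 1)"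
    using j by (auto simp: lam_eq)
  define v where "v = hinner (u b) (w (i + 2)) *s u (j - 1) - hinner (u (j - 1)) (w (i + 2)) *s u b"
  have vE: "v \<in> eigenspace (partial_sum e i) (lam e i j)"
    using eigenbasisD(2)[OF u b(1)] eigenbasisD(2)[OF u j1(1)] eq j1(2)
    by (simp add: v_def eigenspace_def matrix_vector_mult_diff_distrib vector_scalar_commute
        vector_smult_assoc vector_ssub_ldistrib mult.commute)
  have "hinner v (w (i + 2)) = 0"
    by (simp add: v_def hinner_diff_left hinner_scale_left)
  then have "v = 0" using eigenvector_not_orthogonal_next[OF j vE] by blast
  then have "hinner v (u b) = 0" by simp
  then have "hinner (u (j - 1)) (w (i + 2)) = 0"
    using b j1(1) orthonormalD[OF eigenbasisD(1)[OF u]]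
    by (simp add: v_def hinner_diff_left hinner_scale_left)
  moreover have "u (j - 1) \<in> eigenspace (partial_sum e i) (lam e i j)"
    using eigenbasisD(2)[OF u j1(1)] by (simp add: eigenspace_def j1(2))
  moreover have "u (j - 1) \<noteq> 0" using orthonormal_norm[OF eigenbasisD(1)[OF u] j1(1)] by force
  ultimately show False using eigenvector_not_orthogonal_next[OF j] by blast
qed

lemma gap_at:
  assumes j: "i + 2 \<le> CARD('n)" "1 \<le> j" "j \<le> i + 1" "CARD('d) + i + 1 < j + CARD('n)" "j \<le> CARD('d)"
  shows "gap (partial_sum e i) j" "gap (partial_sum e i) (j - 1)"
proof -
  have l: "lam e i j = eigenvalue (partial_sum e i) (j - 1)" using j(5) by (simp add: lam_eq)
  have d: "j - 1 < CARD('d)" using j by linarith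
  show "gap (partial_sum e i) j"
  proof (rule gapI[OF hermA])
    assume "j < CARD('d)"
    moreover from this have "eigenvalue (partial_sum e i) j \<le> eigenvalue (partial_sum e i) (j - 1)"
      by (intro eigenvalue_antimono[OF hermA]) auto
    moreover have "j \<noteq> j - 1" using j(2) by linarith
    ultimately show "eigenvalue (partial_sum e i) j < eigenvalue (partial_sum e i) (j - 1)"
      using simple_eigenvalue[OF j, of j] l by linarith
  qed
  show "gap (partial_sum e i) (j - 1)"
  proof (rule gapI[OF hermA])
    assume pos: "0 < j - 1"
    have "eigenvalue (partial_sum e i) (j - 1) \<le> eigenvalue (partial_sum e i) (j - 1 - 1)"
      using d by (intro eigenvalue_antimono[OF hermA]) auto
    moreover have "j - 1 - 1 \<noteq> j - 1" "j - 1 - 1 < CARD('d)" using pos d by linarith+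
    ultimately show "eigenvalue (partial_sum e i) (j - 1) < eigenvalue (partial_sum e i) (j - 1 - 1)"
      using simple_eigenvalue[OF j, of "j - 1 - 1"] l by linarith
  qed
qed

text \<open>By induction all \<open>y k\<close> agree. If \<open>k\<close> were the first exception,
  \<open>w k\<close> would be orthogonal to all earlier vectors, hence to every eigenvector of the
  preceding partial sum with nonzero eigenvalue, which
  \<open>eigenvector_not_orthogonal_next\<close> excludes.\<close>

lemma commuting_matrix_scalar:
  assumes n: "CARD('d) < CARD('n)" and Y: "hermitian Y"
    and y: "\<And>k. k \<in> {1..CARD('n)} \<Longrightarrow> Y *v w k = of_real (y k) *s w k"
  shows "Y = mat (of_real (y 1))"
proof -
  have eq: "y k = y 1" if "1 \<le> k" "k \<le> CARD('n)" for k
    using that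
  proof (induction k rule: less_induct)
    case (less k)
    show ?case
    proof (cases "k = 1")
      case False
      then have "k = (k - 2) + 2" using less.prems by simp
      then obtain i where k: "k = i + 2" by blast
      show ?thesis
      proof (rule ccontr)
        assume ne: "y k \<noteq> y 1"
        \<comment> \<open>The least column whose entry in row \<open>i\<close> is not forced to be
          \<Lambda>. It is at most \<open>i + 1\<close> because \<open>CARD('d) < CARD('n)\<close>,
          and at most \<open>CARD('d)\<close> because \<open>i + 2 \<le> CARD('n)\<close>.\<close>
        define j where "j = max 1 (CARD('d) + i + 2 - CARD('n))"
        have dp: "1 \<le> CARD('d)" by (simp add: Suc_le_eq)
        have j: "i + 2 \<le> CARD('n)" "1 \<le> j" "j \<le> i + 1" "CARD('d) + i + 1 < j + CARD('n)" "j \<le> CARD('d)"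
          using n less.prems k dp by (auto simp: j_def)
        have orth: "hinner (w q) (w k) = 0" if q: "q \<in> {1..i + 1}" for q
        proof -
          have "y q = y 1" using less.IH[of q] less.prems q k by simp
          moreover have "hinner (Y *v w q) (w k) = hinner (w q) (Y *v w k)" by (rule hinner_hermitian[OF Y])
          ultimately have "of_real (y 1) * hinner (w q) (w k) = of_real (y k) * hinner (w q) (w k)"
            using y[of q] y[of k] q less.prems k by (simp add: hinner_scale_left hinner_scale_right)
          then show ?thesis using ne by simp
        qed
        have pos: "lam e i j > 0"
        proof -
          have "lam e (Suc i) (j + 1) < lam e (Suc i - 1) j" using j by (intro strict) auto
          then show ?thesis using lam_nonneg[of "Suc i" "j + 1"] by simp
        qed
        obtain u where u: "eigenbasis (partial_sum e i) u" using ex_eigenbasis[OF hermA] by blast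
        have j1: "j - 1 < CARD('d)" "lam e i j = eigenvalue (partial_sum e i) (j - 1)"
          using j by (auto simp: lam_eq)
        have uE: "partial_sum e i *v u (j - 1) = of_real (lam e i j) *s u (j - 1)"
          using eigenbasisD(2)[OF u j1(1)] by (simp add: j1(2))
        have "hinner (partial_sum e i *v u (j - 1)) (w k) = 0"
          unfolding partial_sum_mult_vec hinner_sum_left hinner_scale_left using orth by simp
        then have "of_real (lam e i j) * hinner (u (j - 1)) (w (i + 2)) = 0"
          by (simp only: uE hinner_scale_left k)
        then have "hinner (u (j - 1)) (w (i + 2)) = 0" using pos by simp
        moreover have "u (j - 1) \<noteq> 0" using orthonormal_norm[OF eigenbasisD(1)[OF u] j1(1)] by force
        moreover have "u (j - 1) \<in> eigenspace (partial_sum e i) (lam e i j)"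
          using uE unfolding eigenspace_def by blast
        ultimately show False using eigenvector_not_orthogonal_next[OF j] by blast
      qed
    qed simp
  qed
  define L where "L = (\<Sum>k\<in>UNIV. r $ k) / real CARD('d)"
  have L: "L > 0" unfolding L_def using r by (intro divide_pos_pos sum_pos) auto
  have S: "(\<Sum>k = 1..CARD('n). e $ ix k) = mat (of_real L)"
  proof -
    have "(\<Sum>q\<in>UNIV. e $ q) = mat (of_real L)"
      using e unfolding M_tilde0_def M_tilde_def L_def by blast
    then show ?thesis by (simp only: sum_ix)
  qed
  \<comment> \<open>\<open>Y\<close> acts on each summand of \<Lambda> times the identity as the
    scalar \<open>y 1\<close>, and \<Lambda> is positive.\<close>
  have "Y ** mat (of_real L) = (\<Sum>k = 1..CARD('n). Y ** e $ ix k)"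
    by (simp only: S[symmetric] matrix_mul_sum_right)
  also have "\<dots> = (\<Sum>k = 1..CARD('n). mat (of_real (y 1)) ** e $ ix k)"
  proof (intro sum.cong refl)
    fix k assume k: "k \<in> {1..CARD('n)}"
    have "Y ** outer (w k) = mat (of_real (y 1)) ** outer (w k)"
      using y[OF k] eq[of k] k by (simp add: mult_outer mat_mult_vec)
    then show "Y ** e $ ix k = mat (of_real (y 1)) ** e $ ix k" by (simp add: w matrix_scaleR_right)
  qed
  also have "\<dots> = mat (of_real (y 1)) ** mat (of_real L)"
    by (simp only: S[symmetric] matrix_mul_sum_right)
  finally have "Y ** mat (of_real L) ** mat (1 / of_real L)
      = mat (of_real (y 1)) ** mat (of_real L) ** mat (1 / of_real L)" by (rule arg_cong)
  then show ?thesis using L by (simp add: matrix_mul_assoc[symmetric] mat_mult_mat)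
qed

end

lemma strict_tuple_exists:
  assumes "e \<in> M_tilde0 r" "\<And>a. r $ a > 0"
  shows "\<exists>w. strict_tuple r e w"
proof -
  have "\<exists>w. norm w = 1 \<and> e $ q = r $ q *\<^sub>R outer w" for q
  proof -
    have "e $ q \<in> coadjoint_orbit (r $ q)"
      using assms(1) unfolding M_tilde0_def M_tilde_def N_tilde_def by blast
    then show ?thesis by (auto simp: coadjoint_orbit_def scale_mat_eq)
  qed
  then have "\<exists>f. \<forall>q. norm (f q) = 1 \<and> e $ q = r $ q *\<^sub>R outer (f q)" by (intro choice) blast
  then obtain f where f: "\<And>q. norm (f q) = 1" "\<And>q. e $ q = r $ q *\<^sub>R outer (f q)" by blast
  have "strict_tuple r e (\<lambda>k. f (ix k))" using assms f by unfold_locales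
  then show ?thesis by blast
qed

lemma continuous_on_lam: "continuous_on hermitian_tuples (\<lambda>x :: ('d::finite, 'n::{finite,linorder}) tuple. lam x i j)"
proof (cases "j \<le> CARD('d)")
  case True
  then have j: "j - 1 < CARD('d)" using zero_less_card_finite[where 'a = 'd] by linarith
  have "continuous_on hermitian_tuples (\<lambda>x :: ('d, 'n) tuple. partial_sum x i)"
    unfolding partial_sum_def by (intro continuous_intros)
  then have "continuous_on hermitian_tuples (\<lambda>x :: ('d, 'n) tuple. eigenvalue (partial_sum x i) (j - 1))"
    by (rule continuous_on_compose2[OF continuous_on_eigenvalue[OF j]]) (auto intro: hermitian_partial_sum)
  then show ?thesis using True by (simp add: lam_eq)
qed (simp add: lam_eq)

text \<open>The conditions are finitely many strict inequalities between continuous functions; the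
  exceptions \<open>both_forced\<close> do not depend on the tuple.\<close>

lemma M_tilde0_nbhd:
  assumes e: "e \<in> M_tilde0 (r :: real^'n::{finite,linorder})"
  shows "\<exists>W. open W \<and> e \<in> W \<and> W \<inter> M_tilde r \<subseteq> (M_tilde0 r :: ('d::finite, 'n) tuple set)"
proof -
  define I where "I = {(i, j). 1 \<le> i \<and> i \<le> CARD('n) - 1 \<and> 1 \<le> j \<and> j \<le> i}"
  define C where "C x = (\<lambda>(i, j). (lam x i j > lam x (i - 1) j \<or>
        both_forced (CARD('d) - 1) CARD('n) i j (i - 1) j) \<and>
     (lam x (i - 1) j > lam x i (j + 1) \<or>
        both_forced (CARD('d) - 1) CARD('n) (i - 1) j i (j + 1)))" for x :: "('d, 'n) tuple"
  have M0: "x \<in> M_tilde0 r \<longleftrightarrow> x \<in> M_tilde r \<and> (\<forall>p\<in>I. C x p)" for x :: "('d, 'n) tuple"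
    unfolding M_tilde0_def I_def C_def by blast
  have "I \<subseteq> {..CARD('n)} \<times> {..CARD('n)}" by (auto simp: I_def)
  then have fin: "finite I" by (rule finite_subset) simp
  have eh: "e \<in> hermitian_tuples" using e M_tilde0_hermitian by blast
  have lt: "((\<lambda>x. lam x i j) \<longlongrightarrow> lam e i j) (at e within hermitian_tuples)" for i j
    using continuous_on_lam eh by (auto simp: continuous_on_def)
  have less: "\<forall>\<^sub>F x in at e within hermitian_tuples. lam x i j < lam x i' j'" if "lam e i j < lam e i' j'" for i j i' j'
    using order_tendstoD(1)[OF tendsto_diff[OF lt[of i' j'] lt[of i j]], of 0] that by simp
  have "\<forall>\<^sub>F x in at e within hermitian_tuples. \<forall>p\<in>I. C x p"
  proof (intro eventually_ball_finite[OF fin] ballI)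
    fix p assume "p \<in> I"
    then have "C e p" using e M0 by blast
    then show "\<forall>\<^sub>F x in at e within hermitian_tuples. C x p"
    proof (cases p)
      case (Pair i j)
      have or: "\<forall>\<^sub>F x in at e within hermitian_tuples. lam x a b < lam x a' b' \<or> Q"
        if "lam e a b < lam e a' b' \<or> Q" for a b a' b' Q
        using that by (cases Q) (auto intro: less)
      show ?thesis
        using \<open>C e p\<close> unfolding C_def Pair case_prod_conv by (intro eventually_conj or) blast+
    qed
  qed
  then obtain W where W: "open W" "e \<in> W" "\<And>x. x \<in> W \<Longrightarrow> x \<noteq> e \<Longrightarrow> x \<in> hermitian_tuples \<Longrightarrow> \<forall>p\<in>I. C x p"
    unfolding eventually_at_topological by blast
  have "W \<inter> M_tilde r \<subseteq> M_tilde0 r"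
  proof
    fix x assume x: "x \<in> W \<inter> M_tilde r"
    then have "x \<in> hermitian_tuples" using N_tilde_hermitian by (auto simp: M_tilde_def)
    then show "x \<in> M_tilde0 r" using W(3)[of x] x e M0 by (cases "x = e") auto
  qed
  then show ?thesis using W(1,2) by blast
qed

section \<open>The tangent space of the momentum level\<close>

lemma cadjoint_rank1: "cadjoint (rank1 x y) = rank1 y x"
  by (simp add: cadjoint_def rank1_def vec_eq_iff mult.commute)

lemma inner_rank1: "A \<bullet> rank1 x y = Re (hinner (A *v y) x)"
proof -
  have "trace (A ** rank1 y x) = hinner (A *v y) x"
    by (simp add: trace_def matrix_matrix_mult_def rank1_def hinner_def matrix_vector_mult_def
        sum_distrib_right mult.assoc)
  then show ?thesis by (simp add: inner_eq_trace cadjoint_rank1)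
qed

lemma trace_rank1: "trace (rank1 x y) = hinner x y"
  by (simp add: trace_def rank1_def hinner_def)

lemma rank1_self: "rank1 x x = outer x"
  by (simp add: rank1_def outer_def)

lemma rank1_mult: "rank1 x y ** A = rank1 x (cadjoint A *v y)"
  by (simp add: rank1_def matrix_matrix_mult_def cadjoint_def matrix_vector_mult_def vec_eq_iff
      sum_distrib_left mult_ac)

lemma bounded_bilinear_rank1: "bounded_bilinear (rank1 :: complex^'d \<Rightarrow> _)"
proof -
  have "bilinear (rank1 :: complex^'d \<Rightarrow> _)"
    unfolding bilinear_def
    by (auto intro!: linearI simp: rank1_def vec_eq_iff distrib_left distrib_right)
  then show ?thesis by (simp add: bilinear_conv_bounded_bilinear)
qed

lemma rank1_zero [simp]: "rank1 0 y = 0" "rank1 x 0 = 0"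
  by (simp_all add: rank1_def vec_eq_iff)

text \<open>Dividing by the squared norm keeps the value in the orbit without constraining
  \<open>\<eta>\<close>; it contributes the term with \<open>w \<bullet> L \<eta>\<close>. The map
  \<open>L\<close> will be a coordinate projection of a tuple of vectors.\<close>

lemma has_derivative_normalized_outer:
  fixes w :: "complex^'d"
  assumes "norm w = 1" and "bounded_linear (L :: 'b::real_normed_vector \<Rightarrow> _)"
  shows "((\<lambda>\<eta>. (c / (norm (w + L \<eta>))\<^sup>2) *\<^sub>R outer (w + L \<eta>)) has_derivative
    (\<lambda>\<eta>. c *\<^sub>R (rank1 (L \<eta>) w + rank1 w (L \<eta>) - (2 * (w \<bullet> L \<eta>)) *\<^sub>R outer w))) (at 0)"
proof -
  have w1: "w \<bullet> w = 1" using assms(1) by (simp add: norm_eq_1)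
  have L0: "L 0 = 0" using assms(2) by (simp add: linear_0 bounded_linear.linear)
  have dL: "((\<lambda>\<eta>. w + L \<eta>) has_derivative L) (at 0)"
    using has_derivative_add[OF has_derivative_const bounded_linear_imp_has_derivative[OF assms(2)]] by simp
  have div: "((\<lambda>\<eta>. c / N \<eta>) has_derivative (\<lambda>\<eta>. - c * N' \<eta>)) (at 0)"
    if "(N has_derivative N') (at 0)" "N 0 = 1" for N N' :: "'b \<Rightarrow> real"
    using that by (auto intro!: derivative_eq_intros)
  have "((\<lambda>\<eta>. (w + L \<eta>) \<bullet> (w + L \<eta>)) has_derivative (\<lambda>\<eta>. 2 * (w \<bullet> L \<eta>))) (at 0)"
    using has_derivative_inner[OF dL dL] by (simp add: L0 inner_commute)
  then have "((\<lambda>\<eta>. c / ((w + L \<eta>) \<bullet> (w + L \<eta>))) has_derivative (\<lambda>\<eta>. - c * (2 * (w \<bullet> L \<eta>)))) (at 0)"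
    using w1 L0 by (intro div) auto
  moreover have "((\<lambda>\<eta>. rank1 (w + L \<eta>) (w + L \<eta>)) has_derivative (\<lambda>\<eta>. rank1 w (L \<eta>) + rank1 (L \<eta>) w)) (at 0)"
    using bounded_bilinear.FDERIV[OF bounded_bilinear_rank1 dL dL] by (simp add: L0)
  ultimately have "((\<lambda>\<eta>. (c / ((w + L \<eta>) \<bullet> (w + L \<eta>))) *\<^sub>R rank1 (w + L \<eta>) (w + L \<eta>)) has_derivative
      (\<lambda>\<eta>. (c / (w \<bullet> w)) *\<^sub>R (rank1 w (L \<eta>) + rank1 (L \<eta>) w) + (- c * (2 * (w \<bullet> L \<eta>))) *\<^sub>R rank1 w w)) (at 0)"
    using has_derivative_scaleR[of "\<lambda>\<eta>. c / ((w + L \<eta>) \<bullet> (w + L \<eta>))" _ 0 UNIV] by (fastforce simp: L0)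
  moreover have "(c / (w \<bullet> w)) *\<^sub>R (rank1 w (L \<eta>) + rank1 (L \<eta>) w) + (- c * (2 * (w \<bullet> L \<eta>))) *\<^sub>R rank1 w w
      = c *\<^sub>R (rank1 (L \<eta>) w + rank1 w (L \<eta>) - (2 * (w \<bullet> L \<eta>)) *\<^sub>R outer w)" for \<eta>
    by (simp add: w1 rank1_self algebra_simps)
  ultimately show ?thesis by (simp only: power2_norm_eq_inner rank1_self)
qed

text \<open>With \<open>skew_hermitian_inner\<close>, which removes the normalisation term, this
  exhibits the Hamiltonian field as the image of \<open>D *v w\<close> under the derivative of the
  parametrisation of the orbit.\<close>

lemma commutator_outer:
  assumes "skew_hermitian D"
  shows "commutator D (c *\<^sub>R outer w) = c *\<^sub>R (rank1 (D *v w) w + rank1 w (D *v w))"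
proof -
  have "outer w ** D = - rank1 w (D *v w)"
    using assms unfolding rank1_self[symmetric] rank1_mult
    by (simp add: skew_hermitian_def rank1_def vec_eq_iff matrix_vector_mult_def sum_negf)
  then show ?thesis
    by (simp add: commutator_def matrix_scaleR_left matrix_scaleR_right mult_outer scaleR_add_right)
qed

lemma skew_hermitian_inner: "skew_hermitian D \<Longrightarrow> w \<bullet> (D *v w) = 0"
proof -
  assume "skew_hermitian D"
  then have "hinner (D *v w) w = - hinner w (D *v w)"
    by (simp add: hinner_adjoint skew_hermitian_def) (simp add: hinner_def matrix_vector_mult_def sum_negf)
  then have "Re (hinner (D *v w) w) = - Re (hinner (D *v w) w)"
    using hinner_commute[of w "D *v w"] by (metis complex_cnj_minus complex_cnj_cnj cnj.simps(1) uminus_complex.sel(1))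
  then have "(D *v w) \<bullet> w = 0" by (simp add: inner_eq_Re_hinner)
  then show ?thesis by (simp add: inner_commute)
qed

context strict_tuple
begin

text \<open>The multiplier rule is applied to \<open>H\<close> and the momentum map after both are
  pulled back along \<open>\<Psi>\<close> to a vector space. The direction \<open>\<xi>\<close>
  consists of the vectors \<open>D $ q *v v q\<close>.\<close>

lemma derivative_zero_on_M_tilde0:
  assumes n: "CARD('d) < CARD('n)"
    and H': "(H has_derivative H') (at e within hermitian_tuples)"
    and V: "open V" "e \<in> V" "\<And>x. x \<in> V \<inter> M_tilde0 r \<Longrightarrow> H x = (H e :: real)"
    and D: "\<And>k. skew_hermitian (D $ k)" "(\<Sum>k\<in>UNIV. commutator (D $ k) (e $ k)) = 0"
  shows "H' (hamiltonian_field D e) = 0"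
proof -
  define v where "v q = w (inv_into {1..CARD('n)} ix q)" for q :: 'n
  have v: "norm (v q) = 1" "e $ q = r $ q *\<^sub>R outer (v q)" for q
  proof -
    have "ix (inv_into {1..CARD('n)} ix q) = q"
      using bij_betw_inv_into_right[OF ix_bij] by blast
    then show "norm (v q) = 1" "e $ q = r $ q *\<^sub>R outer (v q)"
      using w[of "inv_into {1..CARD('n)} ix q"] by (simp_all add: v_def)
  qed
  have wv: "w k = v (ix k)" if "k \<in> {1..CARD('n)}" for k
    using that bij_betw_inv_into_left[OF ix_bij that] by (simp add: v_def)
  define \<Psi> :: "((complex, 'd) vec, 'n) vec \<Rightarrow> ('d, 'n) tuple"
    where "\<Psi> \<eta> = (\<chi> q. (r $ q / (norm (v q + \<eta> $ q))\<^sup>2) *\<^sub>R outer (v q + \<eta> $ q))" for \<eta>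
  define \<Psi>' :: "((complex, 'd) vec, 'n) vec \<Rightarrow> ('d, 'n) tuple"
    where "\<Psi>' \<eta> = (\<chi> q. r $ q *\<^sub>R (rank1 (\<eta> $ q) (v q) + rank1 (v q) (\<eta> $ q)
      - (2 * (v q \<bullet> \<eta> $ q)) *\<^sub>R outer (v q)))" for \<eta>
  have d\<Psi>: "(\<Psi> has_derivative \<Psi>') (at 0)"
    unfolding \<Psi>_def \<Psi>'_def
    by (rule has_derivative_vecI)
      (simp only: vec_lambda_beta has_derivative_normalized_outer[OF v(1) bounded_linear_vec_nth])
  have \<Psi>0: "\<Psi> 0 = e" using v by (simp add: \<Psi>_def vec_eq_iff[where 'b = 'n])
  have \<Psi>herm: "\<Psi> \<eta> \<in> hermitian_tuples" for \<eta>
    by (simp add: \<Psi>_def hermitian_tuples_def hermitian_scaleR hermitian_outer)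
  define U0 where "U0 = {\<eta> :: ((complex, 'd) vec, 'n) vec. \<forall>q. v q + \<eta> $ q \<noteq> 0}"
  have U0: "open U0" "0 \<in> U0"
  proof -
    have "open {\<eta> :: ((complex, 'd) vec, 'n) vec. v q + \<eta> $ q \<noteq> 0}" for q
      by (intro open_Collect_neq continuous_intros)
    then have "open (\<Inter>q\<in>UNIV. {\<eta> :: ((complex, 'd) vec, 'n) vec. v q + \<eta> $ q \<noteq> 0})" by (intro open_INT) auto
    moreover have "U0 = (\<Inter>q\<in>UNIV. {\<eta>. v q + \<eta> $ q \<noteq> 0})" by (auto simp: U0_def)
    ultimately show "open U0" by simp
    have "v q \<noteq> 0" for q using v(1)[of q] by force
    then show "0 \<in> U0" by (simp add: U0_def)
  qed
  have cont: "continuous_on U0 \<Psi>"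
  proof -
    have "continuous_on U0 (\<lambda>\<eta>. (r $ q / (norm (v q + \<eta> $ q))\<^sup>2) *\<^sub>R rank1 (v q + \<eta> $ q) (v q + \<eta> $ q))" for q
      by (intro continuous_intros bounded_bilinear.continuous_on[OF bounded_bilinear_rank1]) (auto simp: U0_def)
    then show ?thesis unfolding \<Psi>_def rank1_self by (intro continuous_on_vec_lambda)
  qed
  have \<Psi>N: "\<Psi> \<eta> \<in> N_tilde r" if "\<eta> \<in> U0" for \<eta>
  proof -
    have "\<Psi> \<eta> $ q \<in> coadjoint_orbit (r $ q)" for q
    proof -
      define x where "x = (1 / norm (v q + \<eta> $ q)) *\<^sub>R (v q + \<eta> $ q)"
      have "v q + \<eta> $ q \<noteq> 0" using that by (simp add: U0_def)
      then have "norm x = 1" by (simp add: x_def)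
      moreover have "outer (c *\<^sub>R y) = c\<^sup>2 *\<^sub>R outer y" for c and y :: "complex^'d"
        by (simp add: outer_def vec_eq_iff power2_eq_square)
      then have "\<Psi> \<eta> $ q = scale_mat (r $ q) (outer x)"
        by (simp add: \<Psi>_def x_def scale_mat_eq power_divide)
      ultimately show ?thesis by (auto simp: coadjoint_orbit_def)
    qed
    then show ?thesis by (simp add: N_tilde_def)
  qed
  obtain W where W: "open W" "e \<in> W" "W \<inter> M_tilde r \<subseteq> M_tilde0 r" using M_tilde0_nbhd[OF e] by blast
  \<comment> \<open>Inside \<open>W\<close> every point of \<open>M_tilde r\<close> is strictly
    interlaced, so points of the level set in the image of \<open>U\<close> fall under the
    hypothesis on \<open>H\<close>.\<close>
  define U where "U = U0 \<inter> \<Psi> -` (V \<inter> W)"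
  have U: "open U" "0 \<in> U"
    using continuous_open_preimage[OF cont U0(1), of "V \<inter> W"] U0(2) V W \<Psi>0 by (auto simp: U_def)
  define f where "f \<eta> = (\<Sum>q\<in>UNIV. \<Psi> \<eta> $ q)" for \<eta>
  define f' where "f' \<eta> = (\<Sum>q\<in>UNIV. \<Psi>' \<eta> $ q)" for \<eta>
  have df: "(f has_derivative f') (at 0)"
    unfolding f_def[abs_def] f'_def[abs_def]
    by (intro has_derivative_sum bounded_linear.has_derivative[OF bounded_linear_vec_nth] d\<Psi>)
  have dh: "((\<lambda>\<eta>. H (\<Psi> \<eta>)) has_derivative (\<lambda>\<eta>. H' (\<Psi>' \<eta>))) (at 0)"
    using H' \<Psi>herm \<Psi>0
    by (intro has_derivative_in_compose[OF d\<Psi>, of H]) (auto intro: has_derivative_subset)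
  have e0: "f 0 = mat (of_real ((\<Sum>k\<in>UNIV. r $ k) / real CARD('d)))"
    using e unfolding f_def \<Psi>0 M_tilde0_def M_tilde_def by blast
  have lf': "linear f'" using df has_derivative_linear by blast
  have tr1: "trace (outer y) = of_real ((norm y)\<^sup>2)" for y :: "complex^'d"
    by (simp add: rank1_self[symmetric] trace_rank1 hinner_self)
  have trsum: "trace (\<Sum>q\<in>I. A q) = (\<Sum>q\<in>I. trace (A q))" for I and A :: "'n \<Rightarrow> complex^'d^'d"
    by (induction I rule: infinite_finite_induct) (simp_all add: trace_add, simp_all add: trace_def)
  have f'herm: "hermitian (f' \<eta>)" for \<eta>
    unfolding f'_def \<Psi>'_def
    by (intro hermitian_sum)
      (simp add: hermitian_def cadjoint_scaleR cadjoint_diff cadjoint_add cadjoint_rank1 add.commute)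
  have f'tr: "trace (f' \<eta>) = 0" for \<eta>
  proof -
    have "trace (\<Psi>' \<eta> $ q) = 0" for q
    proof -
      have "hinner (\<eta> $ q) (v q) + hinner (v q) (\<eta> $ q) = of_real (2 * (v q \<bullet> \<eta> $ q))"
        unfolding hinner_commute[of "\<eta> $ q"] inner_eq_Re_hinner by (simp add: complex_eq_iff)
      then show ?thesis
        by (simp add: \<Psi>'_def trace_scaleR trace_sub trace_add trace_rank1 tr1 v(1))
    qed
    then show ?thesis by (simp add: f'_def trsum)
  qed
  \<comment> \<open>The component \<open>z\<close> of \<open>X\<close> orthogonal to the range turns
    out to have every \<open>v q\<close> as an eigenvector, hence to be scalar, hence to vanish
    because its trace does.\<close>
  have surj: "X \<in> range f'" if X: "hermitian X" "trace X = 0" for X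
  proof -
    have span: "span (range f') = range f'"
      using linear_subspace_image[OF lf' subspace_UNIV] by (rule span_eq_iff[THEN iffD2])
    obtain y z where yz: "y \<in> range f'" "\<And>a. a \<in> range f' \<Longrightarrow> orthogonal z a" "X = y + z"
      using orthogonal_subspace_decomp_exists[of "range f'" X] unfolding span by metis
    have z: "z = X - y" using yz(3) by simp
    have hz: "hermitian z" and tz: "trace z = 0"
      using yz(1) X f'herm f'tr unfolding z by (auto intro: hermitian_diff simp: trace_sub)
    have eig: "z *v v q = of_real (Re (hinner (z *v v q) (v q))) *s v q" for q
    proof -
      define c where "c = Re (hinner (z *v v q) (v q))"
      \<comment> \<open>The defect of \<open>v q\<close> as an eigenvector of \<open>z\<close>.
        Varying only \<open>v q\<close> in this direction turns the orthogonality relation into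
        \<open>\<zeta> \<bullet> \<zeta> = 0\<close>.\<close>
      define \<zeta> where "\<zeta> = z *v v q - c *\<^sub>R v q"
      have ax: "axis q \<zeta> $ p = (if p = q then \<zeta> else 0)" for p by (simp add: axis_def)
      have "\<Psi>' (axis q \<zeta>) $ p = (if p = q then \<Psi>' (axis q \<zeta>) $ q else 0)" for p
        by (simp add: \<Psi>'_def ax)
      then have "f' (axis q \<zeta>) = (\<Sum>p\<in>UNIV. if p = q then \<Psi>' (axis q \<zeta>) $ q else 0)"
        unfolding f'_def by (intro sum.cong refl)
      then have "f' (axis q \<zeta>) = \<Psi>' (axis q \<zeta>) $ q" by simp
      then have "z \<bullet> \<Psi>' (axis q \<zeta>) $ q = 0"
        using yz(2)[OF rangeI, of "axis q \<zeta>"] by (simp add: orthogonal_def)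
      then have "r $ q * (z \<bullet> rank1 \<zeta> (v q) + z \<bullet> rank1 (v q) \<zeta> - 2 * (v q \<bullet> \<zeta>) * (z \<bullet> outer (v q))) = 0"
        by (simp add: \<Psi>'_def ax inner_diff_right inner_add_right)
      then have "z \<bullet> rank1 \<zeta> (v q) + z \<bullet> rank1 (v q) \<zeta> - 2 * (v q \<bullet> \<zeta>) * (z \<bullet> outer (v q)) = 0"
        using r[of q] by simp
      moreover have "z \<bullet> rank1 \<zeta> (v q) = (z *v v q) \<bullet> \<zeta>"
        by (simp add: inner_rank1 inner_eq_Re_hinner)
      moreover have "z \<bullet> rank1 (v q) \<zeta> = (z *v v q) \<bullet> \<zeta>"
        using hinner_hermitian[OF hz, of \<zeta> "v q"] hinner_commute[of \<zeta> "z *v v q"]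
        by (simp add: inner_rank1 inner_eq_Re_hinner)
      moreover have "z \<bullet> outer (v q) = c" by (simp add: inner_outer c_def)
      ultimately have "(z *v v q) \<bullet> \<zeta> - c * (v q \<bullet> \<zeta>) = 0" by simp
      then have "\<zeta> \<bullet> \<zeta> = 0" unfolding \<zeta>_def by (simp add: inner_diff_left)
      then show ?thesis by (simp add: \<zeta>_def c_def scaleR_eq_scale)
    qed
    have "z = mat (of_real (Re (hinner (z *v v (ix 1)) (v (ix 1)))))"
      by (rule commuting_matrix_scalar[OF n hz, of "\<lambda>k. Re (hinner (z *v v (ix k)) (v (ix k)))"])
        (simp add: wv eig[symmetric])
    then obtain c where c: "z = mat c" by blast
    have "trace z = of_nat CARD('d) * c" unfolding c by (simp add: trace_def mat_def)
    then have "c = 0" using tz by simp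
    then show ?thesis using yz(1,3) c by simp
  qed
  define \<xi> where "\<xi> = (\<chi> q. D $ q *v v q)"
  have \<xi>: "\<Psi>' \<xi> = hamiltonian_field D e"
    using v(2) D(1)
    by (simp add: \<Psi>'_def \<xi>_def hamiltonian_field_def vec_eq_iff[where 'b = 'n] commutator_outer skew_hermitian_inner)
  have "H' (\<Psi>' \<xi>) = 0"
  proof (rule derivative_zero_on_level_set[OF df dh U])
    show "continuous_on U f"
      unfolding f_def[abs_def] using continuous_on_subset[OF cont, of U]
      by (intro continuous_intros) (auto simp: U_def)
    fix \<eta> assume \<eta>: "\<eta> \<in> U"
    \<comment> \<open>Each factor keeps its trace \<open>r $ q\<close>, so values of
      \<open>f\<close> differ by trace-zero Hermitian matrices, which \<open>surj\<close> places in
      \<open>range f'\<close>.\<close>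
    have "trace (f x) = of_real (\<Sum>q\<in>UNIV. r $ q)" if "x \<in> U0" for x
    proof -
      have "trace (\<Psi> x $ q) = of_real (r $ q)" for q
        using that by (simp add: \<Psi>_def trace_scaleR tr1 U0_def del: of_real_power)
      then show ?thesis by (simp add: f_def trsum)
    qed
    then have "trace (f \<eta> - f 0) = 0" using \<eta> U(2) by (simp add: U_def trace_sub)
    moreover have "hermitian (f x)" for x
      using \<Psi>herm[of x] unfolding f_def hermitian_tuples_def by (intro hermitian_sum) simp
    ultimately show "f \<eta> - f 0 \<in> range f'" by (intro surj hermitian_diff)
    assume "f \<eta> = f 0"
    then have "\<Psi> \<eta> \<in> M_tilde r"
      using \<Psi>N[of \<eta>] \<eta> unfolding e0 by (simp add: M_tilde_def f_def U_def)
    then show "H (\<Psi> \<eta>) = H (\<Psi> 0)"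
      using V(3)[of "\<Psi> \<eta>"] W(3) \<eta> \<Psi>0 by (auto simp: U_def)
  next
    show "f' \<xi> = 0" using D(2) by (simp add: f'_def \<xi> hamiltonian_field_def)
  qed
  then show ?thesis by (simp add: \<xi>)
qed

text \<open>By antisymmetry the difference of the brackets is minus the derivative of
  \<open>F1 - F2\<close> along the Hamiltonian field of \<open>G\<close>, which the invariance of
  \<open>G\<close> makes tangent to the level set.\<close>

lemma lie_poisson_depends_on_restriction:
  assumes n: "CARD('d) < CARD('n)"
    and F: "has_gradient F1 D1 e" "has_gradient F2 D2 e"
    and V: "open V" "e \<in> V" "\<And>x. x \<in> V \<inter> M_tilde0 r \<Longrightarrow> F1 x = F2 x"
    and G: "has_gradient G D' e" "\<And>g. unitary g \<Longrightarrow> G (conj_act g e) = G e"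
  shows "lie_poisson D1 D' e = lie_poisson D2 D' e"
proof -
  define L where "L D Y = (\<Sum>k\<in>UNIV. Im (trace (D $ k ** Y $ k)))" for D Y :: "('d, 'n) tuple"
  have lp: "lie_poisson D D' e = - L D (hamiltonian_field D' e)" for D
  proof -
    have "trace (D' $ k ** commutator (D $ k) (e $ k)) = - trace (D $ k ** commutator (D' $ k) (e $ k))" for k
      unfolding trace_mult_commutator[of "D' $ k"] commutator_swap[of "e $ k"]
      by (simp add: matrix_minus_right trace_def sum_negf)
    then show ?thesis by (simp add: lie_poisson_def L_def hamiltonian_field_def sum_negf)
  qed
  have "((\<lambda>x. F1 x - F2 x) has_derivative (\<lambda>Y. L D1 Y - L D2 Y)) (at e within hermitian_tuples)"
    using F by (intro has_derivative_diff) (simp_all add: has_gradient_def L_def[abs_def])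
  moreover have "skew_hermitian (D' $ k)" for k using G(1) by (simp add: has_gradient_def)
  ultimately have "L D1 (hamiltonian_field D' e) - L D2 (hamiltonian_field D' e) = 0"
    using derivative_zero_on_M_tilde0[OF n, of "\<lambda>x. F1 x - F2 x" _ V D'] V e
      invariant_imp_sum_commutator_0[OF G(1) herm G(2)] by force
  then show ?thesis by (simp add: lp)
qed

end

section \<open>The action variables and their flows\<close>

lemma gap_iff:
  assumes "hermitian (A :: complex^'d^'d)"
  shows "gap A j \<longleftrightarrow> (0 < j \<and> j < CARD('d) \<longrightarrow> eigenvalue A j < eigenvalue A (j - 1))"
proof
  assume "gap A j"
  then show "0 < j \<and> j < CARD('d) \<longrightarrow> eigenvalue A j < eigenvalue A (j - 1)" by (simp add: gap_def)
next
  assume "0 < j \<and> j < CARD('d) \<longrightarrow> eigenvalue A j < eigenvalue A (j - 1)"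
  then show "gap A j" by (intro gapI[OF assms]) blast
qed

lemma linear_partial_sum: "linear (\<lambda>x :: ('d::finite, 'n::{finite,linorder}) tuple. partial_sum x i)"
  by (rule linearI) (simp_all only: partial_sum_def vector_add_component vector_scaleR_component
      sum.distrib scaleR_sum_right)

lemma open_gap: "open {x :: ('d::finite, 'n::{finite,linorder}) tuple. gap (partial_sum (herm_part x) i) j}"
proof (cases "0 < j \<and> j < CARD('d)")
  case True
  have "continuous_on UNIV (\<lambda>x :: ('d, 'n) tuple. partial_sum (herm_part x) i)"
    using linear_continuous_on[of "herm_part :: ('d, 'n) tuple \<Rightarrow> _"] linear_herm_part
    unfolding partial_sum_def by (intro continuous_intros) (simp add: linear_conv_bounded_linear)
  then have cont: "continuous_on UNIV (\<lambda>x :: ('d, 'n) tuple. eigenvalue (partial_sum (herm_part x) i) a)"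
    if "a < CARD('d)" for a
    by (rule continuous_on_compose2[OF continuous_on_eigenvalue[OF that]])
      (auto intro: hermitian_partial_sum herm_part_hermitian)
  have "gap (partial_sum (herm_part x) i) j \<longleftrightarrow>
      eigenvalue (partial_sum (herm_part x) i) j < eigenvalue (partial_sum (herm_part x) i) (j - 1)"
    for x :: "('d, 'n) tuple"
    using True by (simp add: gap_iff[OF hermitian_partial_sum[OF herm_part_hermitian]])
  moreover have "open {x :: ('d, 'n) tuple. eigenvalue (partial_sum (herm_part x) i) j
      < eigenvalue (partial_sum (herm_part x) i) (j - 1)}"
    using True by (intro open_Collect_less cont) auto
  ultimately show ?thesis by simp
next
  case False
  then have "{x :: ('d, 'n) tuple. gap (partial_sum (herm_part x) i) j} = UNIV"
    by (auto simp: gap_iff[OF hermitian_partial_sum[OF herm_part_hermitian]])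
  then show ?thesis by simp
qed

lemma gap_conj_act:
  fixes x :: "('d::finite, 'n::{finite,linorder}) tuple"
  assumes "x \<in> hermitian_tuples" "unitary g" "gap (partial_sum x i) j" "j \<le> CARD('d)"
  shows "gap (partial_sum (conj_act g x) i) j"
  unfolding partial_sum_conj_act
  using assms by (intro spectral_proj_unitary_conj hermitian_partial_sum)

lemma has_derivative_top_sum_partial_sum:
  fixes x :: "('d::finite, 'n::{finite,linorder}) tuple"
  assumes x: "x \<in> hermitian_tuples" and "gap (partial_sum x i) j" "j \<le> CARD('d)"
  shows "((\<lambda>y. top_sum (partial_sum y i) j) has_derivative
    (\<lambda>Y. partial_sum Y i \<bullet> spectral_proj (partial_sum x i) j)) (at x within hermitian_tuples)"
proof -
  have d: "((\<lambda>y :: ('d, 'n) tuple. partial_sum y i) has_derivative (\<lambda>Y. partial_sum Y i)) (at x within hermitian_tuples)"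
    using linear_partial_sum by (intro bounded_linear_imp_has_derivative) (simp add: linear_conv_bounded_linear)
  show ?thesis
    by (rule has_derivative_in_compose[OF d])
      (rule has_derivative_subset[OF has_derivative_top_sum[OF hermitian_partial_sum[OF x] assms(2,3)]],
        auto intro: hermitian_partial_sum)
qed

context strict_tuple
begin

text \<open>Only its velocity at 0 is matched with the Hamiltonian field of the action; the bracket
  at \<open>e\<close> needs no more.\<close>

definition flow :: "nat \<Rightarrow> nat \<Rightarrow> real \<Rightarrow> ('d, 'n) tuple" where
  "flow i j t = (\<chi> q. if q \<in> ix ` {1..i + 1}
     then rot (spectral_proj (partial_sum e i) j) t ** e $ q ** cadjoint (rot (spectral_proj (partial_sum e i) j) t)
     else e $ q)"

definition action_gradient :: "nat \<Rightarrow> nat \<Rightarrow> ('d, 'n) tuple" where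
  "action_gradient i j = (\<chi> q. if q \<in> ix ` {1..i + 1} then mat \<i> ** spectral_proj (partial_sum e i) j else 0)"

lemma ix_mem: "k \<in> {1..CARD('n)} \<Longrightarrow> i + 1 \<le> CARD('n) \<Longrightarrow> (ix k :: 'n) \<in> ix ` {1..i + 1} \<longleftrightarrow> k \<le> i + 1"
proof -
  assume k: "k \<in> {1..CARD('n)}" and i: "i + 1 \<le> CARD('n)"
  have "k = k'" if "(ix k :: 'n) = ix k'" "k' \<in> {1..i + 1}" for k'
    using that k i ix_inj[where 'n = 'n, of k k'] by simp
  then show ?thesis using k by auto
qed

lemma spectral_proj_projection:
  assumes "gap (partial_sum e i) j" "j \<le> CARD('d)"
  defines "P \<equiv> spectral_proj (partial_sum e i) j"
  shows "hermitian P" "P ** P = P" "partial_sum e i ** P = P ** partial_sum e i"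
proof -
  obtain u where u: "eigenbasis (partial_sum e i) u" using ex_eigenbasis[OF hermA] by blast
  have P: "P = (\<Sum>a<j. outer (u a))" unfolding P_def by (rule spectral_proj_eq[OF hermA assms(1,2) u])
  show "hermitian P" unfolding P by (rule hermitian_sum_outer)
  show "P ** P = P" "partial_sum e i ** P = P ** partial_sum e i"
    unfolding P by (rule sum_outer_eigenbasis[OF u assms(2)])+
qed

lemma flow_0: "flow i j 0 = e"
  by (simp add: flow_def vec_eq_iff[where 'b = 'n])

lemma flow_has_vector_derivative:
  assumes "gap (partial_sum e i) j" "j \<le> CARD('d)"
  shows "(flow i j has_vector_derivative hamiltonian_field (action_gradient i j) e) (at 0)"
proof -
  have "((\<lambda>t. flow i j t $ q) has_vector_derivative hamiltonian_field (action_gradient i j) e $ q) (at 0)" for q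
  proof (cases "q \<in> ix ` {1..i + 1}")
    case True
    then show ?thesis
      using has_vector_derivative_rot_conj[OF spectral_proj_projection(1)[OF assms], of "e $ q"]
      by (simp only: flow_def action_gradient_def hamiltonian_field_def vec_lambda_beta if_True)
  next
    case False
    have "commutator 0 X = 0" for X :: "complex^'d^'d" by (simp add: commutator_def)
    with False show ?thesis
      by (simp only: flow_def action_gradient_def hamiltonian_field_def vec_lambda_beta if_False
          has_vector_derivative_const)
  qed
  then show ?thesis by (rule has_vector_derivative_vecI)
qed

lemma continuous_on_flow: "continuous_on UNIV (flow i j)"
proof -
  have rotc: "continuous_on UNIV (\<lambda>t. rot P t)" for P :: "complex^'d^'d"
    unfolding rot_def using linear_continuous_on[of "\<lambda>c. mat c ** P" "range (\<lambda>t. cis t - 1)"] linear_mat_mult[of P]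
    by (intro continuous_intros continuous_on_compose2[of _ "\<lambda>c. mat c ** P" _ "\<lambda>t. cis t - 1"])
      (auto simp: linear_conv_bounded_linear)
  have adj: "continuous_on UNIV (\<lambda>t. cadjoint (rot P t))" for P :: "complex^'d^'d"
  proof -
    have "linear (cadjoint :: complex^'d^'d \<Rightarrow> _)" by (auto intro!: linearI simp: cadjoint_add cadjoint_scaleR)
    then show ?thesis using continuous_on_compose2[OF linear_continuous_on rotc]
      by (auto simp: linear_conv_bounded_linear)
  qed
  have "continuous_on UNIV (\<lambda>t. flow i j t $ q)" for q
    by (cases "q \<in> ix ` {1..i + 1}")
      (simp_all only: flow_def vec_lambda_beta if_True if_False continuous_on_const
        bilinear_continuous_on_compose[OF bilinear_continuous_on_compose[OF rotc continuous_on_const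
          bilinear_matrix_mult] adj bilinear_matrix_mult])
  then have "continuous_on UNIV (\<lambda>t. \<chi> q. flow i j t $ q)" by (intro continuous_on_vec_lambda)
  then show ?thesis by simp
qed

lemma flow_hermitian: "flow i j t \<in> hermitian_tuples"
  using herm by (simp add: flow_def hermitian_tuples_def hermitian_conj)

lemma partial_sum_flow_le:
  fixes j :: nat
  assumes "i' \<le> i" "i + 1 \<le> CARD('n)"
  defines "R \<equiv> rot (spectral_proj (partial_sum e i) j)"
  shows "partial_sum (flow i j t) i' = R t ** partial_sum e i' ** cadjoint (R t)"
proof -
  have "flow i j t $ ix k = R t ** e $ ix k ** cadjoint (R t)" if "k \<in> {1..i' + 1}" for k
    using that assms by (auto simp: flow_def)
  then have "(\<Sum>k = 1..i' + 1. flow i j t $ ix k) = (\<Sum>k = 1..i' + 1. R t ** e $ ix k ** cadjoint (R t))"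
    by (rule sum.cong[OF refl])
  then show ?thesis unfolding partial_sum_def by (simp only: matrix_mul_sum_left matrix_mul_sum_right)
qed

lemma flow_ix_gt: "i + 1 < k \<Longrightarrow> k \<le> CARD('n) \<Longrightarrow> flow i j t $ ix k = e $ ix k"
  using ix_mem[of k i] by (simp add: flow_def)

text \<open>\<open>partial_sum e i\<close> commutes with its own spectral projection, so the
  rotation fixes it; later sums add factors that do not move.\<close>

lemma partial_sum_flow_ge:
  assumes g: "gap (partial_sum e i) j" "j \<le> CARD('d)" and "i \<le> i'" "i' + 1 \<le> CARD('n)"
  shows "partial_sum (flow i j t) i' = partial_sum e i'"
  using assms(3,4)
proof (induction i' rule: dec_induct)
  case base
  then show ?case
    using partial_sum_flow_le[of i i j t] rot_conj_commute[OF spectral_proj_projection(2,1,3)[OF g]] by simp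
next
  case (step i')
  then show ?case using flow_ix_gt[of i "i' + 2" j t] by (simp add: partial_sum_Suc)
qed

lemma flow_M_tilde0:
  assumes g: "gap (partial_sum e i) j" "j \<le> CARD('d)" and i: "i + 1 \<le> CARD('n)"
  shows "flow i j t \<in> M_tilde0 r"
proof -
  note P = spectral_proj_projection[OF g]
  note un = unitary_rot[OF P(2,1), of t]
  have n: "CARD('n) - 1 + 1 = CARD('n)" "i \<le> CARD('n) - 1" using i by auto
  have sum: "(\<Sum>q\<in>UNIV. x $ q) = partial_sum x (CARD('n) - 1)" for x :: "('d, 'n) tuple"
    unfolding partial_sum_def n(1) by (rule sum_ix)
  have eN: "e \<in> N_tilde r" "(\<Sum>k\<in>UNIV. e $ k) = mat (of_real ((\<Sum>k\<in>UNIV. r $ k) / real CARD('d)))"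
    using e unfolding M_tilde0_def M_tilde_def by blast+
  have "flow i j t \<in> N_tilde r"
    using eN(1) coadjoint_orbit_conj[OF _ un] by (simp add: N_tilde_def flow_def)
  moreover have "(\<Sum>q\<in>UNIV. flow i j t $ q) = (\<Sum>q\<in>UNIV. e $ q)"
    unfolding sum by (rule partial_sum_flow_ge[OF g]) (use n in auto)
  ultimately have M: "flow i j t \<in> M_tilde r" using eN(2) by (simp add: M_tilde_def)
  have lam: "lam (flow i j t) a b = lam e a b" if "a \<le> CARD('n) - 1" for a b
  proof (cases "a \<le> i")
    case True
    have h: "hermitian (partial_sum e a)" by (rule hermA)
    obtain u where "eigenbasis (partial_sum e a) u" using ex_eigenbasis[OF h] by blast
    then have "eigenvalue (partial_sum (flow i j t) a) = eigenvalue (partial_sum e a)"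
      unfolding partial_sum_flow_le[OF True i] by (rule eigenvalue_unitary_conj(1)[OF h un])
    then show ?thesis by (simp add: lam_eq)
  next
    case False
    then have "partial_sum (flow i j t) a = partial_sum e a"
      using that n by (intro partial_sum_flow_ge[OF g]) auto
    then show ?thesis by (simp add: lam_eq)
  qed
  have lam': "lam (flow i j t) (a - 1) b = lam e (a - 1) b" if "a \<le> CARD('n) - 1" for a b
    using that by (intro lam) auto
  show ?thesis using e M unfolding M_tilde0_def by (simp add: lam lam' del: One_nat_def)
qed

lemma has_gradient_action:
  assumes g: "gap (partial_sum e i) j" "j \<le> CARD('d)" and i: "i + 1 \<le> CARD('n)"
  shows "has_gradient (\<lambda>x. \<Sum>k = 1..j. lam x i k) (action_gradient i j) e"
  unfolding sum_lam_eq_top_sum[OF g(2)]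
proof (rule has_gradientI[OF has_derivative_top_sum_partial_sum[OF herm g] herm])
  let ?P = "spectral_proj (partial_sum e i) j"
  note P = spectral_proj_projection[OF g]
  show "skew_hermitian (action_gradient i j $ k)" for k
    using skew_hermitian_i[OF P(1)] by (simp add: action_gradient_def skew_hermitian_def)
  fix Y :: "('d, 'n) tuple" assume Y: "Y \<in> hermitian_tuples"
  have inj: "inj_on (ix :: nat \<Rightarrow> 'n) {1..i + 1}"
    by (rule inj_on_subset[OF bij_betw_imp_inj_on[OF ix_bij]]) (use i in auto)
  have "(\<Sum>k\<in>UNIV. Im (trace (action_gradient i j $ k ** Y $ k)))
      = (\<Sum>q\<in>UNIV. if q \<in> ix ` {1..i + 1} then ?P \<bullet> Y $ q else 0)"
  proof (intro sum.cong refl)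
    fix q
    have "hermitian (Y $ q)" using Y by (simp add: hermitian_tuples_def)
    moreover have "trace (0 :: complex^'d^'d) = 0" by (simp add: trace_def)
    ultimately show "Im (trace (action_gradient i j $ q ** Y $ q)) = (if q \<in> ix ` {1..i + 1} then ?P \<bullet> Y $ q else 0)"
      by (simp add: action_gradient_def Im_trace_i)
  qed
  also have "\<dots> = (\<Sum>q\<in>ix ` {1..i + 1}. ?P \<bullet> Y $ q)"
    by (simp add: sum.If_cases)
  also have "\<dots> = (\<Sum>k = 1..i + 1. ?P \<bullet> Y $ ix k)"
    using sum.reindex[OF inj] by (simp only: o_def)
  also have "\<dots> = partial_sum Y i \<bullet> ?P"
    unfolding partial_sum_def inner_sum_left by (simp only: inner_commute)
  finally show "(\<Sum>k\<in>UNIV. Im (trace (action_gradient i j $ k ** Y $ k))) = partial_sum Y i \<bullet> ?P" .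
qed

lemma action_extension:
  assumes g: "gap (partial_sum e i) j" "j \<le> CARD('d)"
  shows "invariant_extension r (action i j) e (\<lambda>x. \<Sum>k = 1..j. lam x i k)"
  unfolding invariant_extension_def
proof (rule exI, intro conjI allI impI ballI)
  define V where "V = {x :: ('d, 'n) tuple. gap (partial_sum (herm_part x) i) j}"
  show "open V" unfolding V_def by (rule open_gap)
  show "e \<in> V" using g(1) by (simp add: V_def herm_part_id[OF herm])
  show "conj_act h x \<in> V" if "unitary h \<and> x \<in> V" for h x
    using that g(2) by (simp add: V_def herm_part_conj_act gap_conj_act herm_part_hermitian)
  show "(\<Sum>k = 1..j. lam (conj_act h x) i k) = (\<Sum>k = 1..j. lam x i k)"
    if "unitary h \<and> x \<in> V \<inter> N_tilde r" for h x
    using that N_tilde_hermitian[of r] by (intro sum.cong refl lam_conj_act) auto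
  show "(\<Sum>k = 1..j. lam x i k) = action i j (orbit x)" if "x \<in> V \<inter> M_tilde0 r" for x
    using that M_tilde0_hermitian[of r] by (subst action_orbit) auto
  show "\<exists>D. has_gradient (\<lambda>x. \<Sum>k = 1..j. lam x i k) D x" if "x \<in> V \<inter> hermitian_tuples" for x
    unfolding sum_lam_eq_top_sum[OF g(2)]
  proof (rule differentiable_imp_has_gradient)
    show "x \<in> hermitian_tuples" using that by blast
    then show "(\<lambda>x. top_sum (partial_sum x i) j) differentiable at x within hermitian_tuples"
      using that has_derivative_top_sum_partial_sum[of x i j] g(2)
      by (auto simp: V_def herm_part_id differentiable_def)
  qed
qed

end

section \<open>The angle variables\<close>

text \<open>
  Up to the positive factor \<open>r\<^sub>k\<^sub>+\<^sub>1 r\<^sub>k\<^sub>+\<^sub>2\<close>, this is the number whose argument is the angle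
  \<open>\<theta>\<^sub>k\<^sub>l\<close>. It is written with spectral projections so as to make sense, and be differentiable, on
  an open set of tuples.
\<close>
definition four_point :: "nat \<Rightarrow> nat \<Rightarrow> ('d::finite, 'n::{finite,linorder}) tuple \<Rightarrow> complex" where
  "four_point k l x = trace
     ((spectral_proj (partial_sum x k) l - spectral_proj (partial_sum x k) (l - 1)) ** x $ ix (k + 1) **
      ((spectral_proj (partial_sum x k) (l + 1) - spectral_proj (partial_sum x k) l) ** x $ ix (k + 2)))"

text \<open>The three gaps isolate the eigenvalues number \<open>l\<close> and \<open>l + 1\<close>,
  counted from 1, so the differences of projections in \<open>four_point\<close> have rank
  one.\<close>

definition three_gaps :: "nat \<Rightarrow> nat \<Rightarrow> ('d::finite, 'n::{finite,linorder}) tuple \<Rightarrow> bool" where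
  "three_gaps k l x \<longleftrightarrow> gap (partial_sum x k) (l - 1) \<and> gap (partial_sum x k) l \<and> gap (partial_sum x k) (l + 1)"

lemma conj_mult:
  assumes "unitary g"
  shows "(g ** A ** cadjoint g) ** (g ** B ** cadjoint g) = g ** (A ** B) ** cadjoint g"
proof -
  have "(g ** A ** cadjoint g) ** (g ** B ** cadjoint g) = g ** A ** (cadjoint g ** g) ** B ** cadjoint g"
    by (simp only: matrix_mul_assoc)
  then show ?thesis by (simp only: unitary_inverse[OF assms] matrix_mul_rid matrix_mul_assoc)
qed

lemma trace_conj: "unitary g \<Longrightarrow> trace (g ** A ** cadjoint g) = trace A"
  by (metis matrix_mul_assoc matrix_mul_lid trace_mul_sym unitary_inverse)

lemma three_gaps_conj_act:
  fixes x :: "('d::finite, 'n::{finite,linorder}) tuple"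
  assumes "x \<in> hermitian_tuples" "unitary g" "three_gaps k l x" "l + 1 \<le> CARD('d)"
  shows "three_gaps k l (conj_act g x)"
  using assms unfolding three_gaps_def by (intro conjI gap_conj_act) auto

lemma four_point_conj_act:
  fixes x :: "('d::finite, 'n::{finite,linorder}) tuple"
  assumes x: "x \<in> hermitian_tuples" and g: "unitary g" and gaps: "three_gaps k l x" and l: "l + 1 \<le> CARD('d)"
  shows "four_point k l (conj_act g x) = four_point k l x"
proof -
  note h = hermitian_partial_sum[OF x, of k]
  have sp: "spectral_proj (partial_sum (conj_act g x) k) a = g ** spectral_proj (partial_sum x k) a ** cadjoint g"
    if "a \<in> {l - 1, l, l + 1}" for a
    unfolding partial_sum_conj_act using that gaps l
    by (intro spectral_proj_unitary_conj(2)[OF h _ _ g]) (auto simp: three_gaps_def)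
  have diff: "g ** A ** cadjoint g - g ** B ** cadjoint g = g ** (A - B) ** cadjoint g" for A B
    by (simp only: matrix_diff_ldistrib matrix_diff_rdistrib)
  have y: "conj_act g x $ q = g ** x $ q ** cadjoint g" for q by (simp add: conj_act_def)
  show ?thesis
    unfolding four_point_def using sp
    by (simp only: insert_iff simp_thms y diff conj_mult[OF g] trace_conj[OF g])
qed

lemma differentiable_matrix_mult:
  fixes f g :: "'a::real_normed_vector \<Rightarrow> complex^'d^'d"
  assumes "f differentiable (at x within S)" "g differentiable (at x within S)"
  shows "(\<lambda>x. f x ** g x) differentiable (at x within S)"
  using bounded_bilinear.FDERIV[OF bilinear_matrix_mult[unfolded bilinear_conv_bounded_bilinear]] assms
  unfolding differentiable_def by blast

lemma four_point_differentiable: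
  fixes x :: "('d::finite, 'n::{finite,linorder}) tuple"
  assumes x: "x \<in> hermitian_tuples" and gaps: "three_gaps k l x" and l: "l + 1 \<le> CARD('d)"
  shows "four_point k l differentiable (at x within hermitian_tuples)"
proof -
  have "bounded_linear (\<lambda>x :: ('d, 'n) tuple. partial_sum x k)"
    using linear_partial_sum by (simp add: linear_conv_bounded_linear)
  then have ps: "((\<lambda>x :: ('d, 'n) tuple. partial_sum x k) has_derivative (\<lambda>y. partial_sum y k)) (at x within hermitian_tuples)"
    by (rule bounded_linear_imp_has_derivative)
  have sp: "(\<lambda>x :: ('d, 'n) tuple. spectral_proj (partial_sum x k) a) differentiable (at x within hermitian_tuples)"
    if "a \<in> {l - 1, l, l + 1}" for a
  proof -
    have a: "gap (partial_sum x k) a" "a \<le> CARD('d)" using that gaps l by (auto simp: three_gaps_def)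
    obtain P' where "((\<lambda>X. spectral_proj X a) has_derivative P') (at (partial_sum x k) within {X. hermitian X})"
      using spectral_proj_differentiable[OF hermitian_partial_sum[OF x] a] by (auto simp: differentiable_def)
    then have "((\<lambda>X. spectral_proj X a) has_derivative P')
        (at (partial_sum x k) within (\<lambda>x. partial_sum x k) ` hermitian_tuples)"
      by (rule has_derivative_subset) (auto intro: hermitian_partial_sum)
    from has_derivative_in_compose[OF ps this] show ?thesis by (auto simp: differentiable_def)
  qed
  have comp: "(\<lambda>x :: ('d, 'n) tuple. x $ q) differentiable (at x within hermitian_tuples)" for q
    by (rule bounded_linear_imp_differentiable[OF bounded_linear_vec_nth])
  have tr: "bounded_linear (trace :: complex^'d^'d \<Rightarrow> complex)"
  proof -
    have "linear (trace :: complex^'d^'d \<Rightarrow> complex)"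
      by (rule linearI) (simp_all add: trace_add, simp add: trace_def scaleR_sum_right)
    then show ?thesis by (simp add: linear_conv_bounded_linear)
  qed
  have "(\<lambda>x. (spectral_proj (partial_sum x k) l - spectral_proj (partial_sum x k) (l - 1)) ** x $ ix (k + 1) **
      ((spectral_proj (partial_sum x k) (l + 1) - spectral_proj (partial_sum x k) l) ** x $ ix (k + 2)))
      differentiable (at x within hermitian_tuples)"
    by (intro differentiable_matrix_mult differentiable_diff sp comp) auto
  then show ?thesis
    unfolding four_point_def[abs_def] differentiable_def using bounded_linear.has_derivative[OF tr] by blast
qed

lemma is_Arg_scale: "is_Arg z t \<Longrightarrow> c > 0 \<Longrightarrow> is_Arg (of_real c * z) t"
  by (simp add: is_Arg_def norm_mult mult.assoc)

lemma is_Arg_mult_cis: "is_Arg z t \<Longrightarrow> is_Arg (cis s * z) (t + s)"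
  unfolding is_Arg_def by (simp add: norm_mult cis_conv_exp distrib_left exp_add mult_ac)

lemma is_Arg_divide: "is_Arg z t \<Longrightarrow> is_Arg z' t' \<Longrightarrow> is_Arg (z / z') (t - t')"
  unfolding is_Arg_def by (simp add: norm_divide right_diff_distrib exp_diff)

locale angle_tuple = strict_tuple r e w
  for r :: "real^'n::{finite,linorder}" and e :: "('d::finite, 'n) tuple" and w +
  fixes k l :: nat
  assumes k: "1 \<le> k" "k + 2 \<le> CARD('n)" and l: "1 \<le> l" "l \<le> k" "CARD('d) + k + 1 < l + CARD('n)" "l + 1 \<le> CARD('d)"
begin

lemma gaps: "three_gaps k l e"
  using gap_at[of k l] gap_at[of k "l + 1"] k l by (simp add: three_gaps_def)

lemma spectral_proj_diff:
  assumes u: "eigenbasis (partial_sum e k) u"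
  shows "spectral_proj (partial_sum e k) l - spectral_proj (partial_sum e k) (l - 1) = outer (u (l - 1))"
    and "spectral_proj (partial_sum e k) (l + 1) - spectral_proj (partial_sum e k) l = outer (u l)"
proof -
  have sp: "spectral_proj (partial_sum e k) a = (\<Sum>i<a. outer (u i))" if "a \<in> {l - 1, l, l + 1}" for a
    using that gaps l by (intro spectral_proj_eq[OF hermA _ _ u]) (auto simp: three_gaps_def)
  have "{..<l} = insert (l - 1) {..<l - 1}" using l(1) by auto
  then show "spectral_proj (partial_sum e k) l - spectral_proj (partial_sum e k) (l - 1) = outer (u (l - 1))"
    by (simp add: sp)
  show "spectral_proj (partial_sum e k) (l + 1) - spectral_proj (partial_sum e k) l = outer (u l)"
    by (simp add: sp)
qed

lemma four_point_eq:
  assumes u: "eigenbasis (partial_sum e k) u"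
  shows "four_point k l e = of_real (r $ ix (k + 1) * r $ ix (k + 2)) *
    (hinner (w (k + 1)) (u (l - 1)) * hinner (u (l - 1)) (w (k + 2)) *
     hinner (w (k + 2)) (u l) * hinner (u l) (w (k + 1)))"
  unfolding four_point_def spectral_proj_diff[OF u] w(2)
    by (simp add: matrix_scaleR_left matrix_scaleR_right trace_scaleR matrix_mul_assoc trace_mult_outer
        matrix_vector_mul_assoc[symmetric] outer_mult_vec vector_scalar_commute hinner_scale_left mult_ac
        del: of_real_mult)

lemma eigenvector_eigenspace:
  assumes u: "eigenbasis (partial_sum e k) u"
  shows "u (l - 1) \<in> eigenspace (partial_sum e k) (lam e k l)" "norm (u (l - 1)) = 1"
    and "u l \<in> eigenspace (partial_sum e k) (lam e k (l + 1))" "norm (u l) = 1"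
  using l eigenbasisD[OF u] orthonormal_norm[OF eigenbasisD(1)[OF u]]
  by (auto simp: eigenspace_def lam_eq)

lemma four_point_nonzero: "four_point k l e \<noteq> 0"
proof -
  obtain u where u: "eigenbasis (partial_sum e k) u" using ex_eigenbasis[OF hermA] by blast
  note ev = eigenvector_eigenspace[OF u]
  have nz: "u (l - 1) \<noteq> 0" "u l \<noteq> 0" using ev(2,4) by force+
  have "hinner (u (l - 1)) (w (k + 2)) \<noteq> 0"
    by (rule eigenvector_not_orthogonal_next[OF _ _ _ _ _ ev(1) nz(1)]) (use k l in auto)
  moreover have "hinner (u l) (w (k + 2)) \<noteq> 0"
    by (rule eigenvector_not_orthogonal_next[OF _ _ _ _ _ ev(3) nz(2)]) (use k l in auto)
  moreover have "hinner (u (l - 1)) (w (k + 1)) \<noteq> 0"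
    by (rule eigenvector_not_orthogonal_prev[OF _ _ _ _ _ _ ev(1) nz(1)]) (use k l in auto)
  moreover have "hinner (u l) (w (k + 1)) \<noteq> 0"
    by (rule eigenvector_not_orthogonal_prev[OF _ _ _ _ _ _ ev(3) nz(2)]) (use k l in auto)
  ultimately show ?thesis
    unfolding four_point_eq[OF u] using r[of "ix (k + 1)"] r[of "ix (k + 2)"]
      hinner_commute[of "w (k + 1)" "u (l - 1)"] hinner_commute[of "w (k + 2)" "u l"] by simp
qed

lemma is_Arg_four_point:
  assumes V: "angle_branch r k l V \<theta>" "orbit e \<in> V"
  shows "is_Arg (four_point k l e) (\<theta> (orbit e))"
proof -
  obtain u where u: "eigenbasis (partial_sum e k) u" using ex_eigenbasis[OF hermA] by blast
  have "is_Arg (hinner (w (k + 1)) (u (l - 1)) * hinner (u (l - 1)) (w (k + 2)) *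
      hinner (w (k + 2)) (u l) * hinner (u l) (w (k + 1))) (\<theta> (orbit e))"
    using V e w eigenvector_eigenspace[OF u] unfolding angle_branch_def scale_mat_eq by blast
  then show ?thesis
    unfolding four_point_eq[OF u] by (rule is_Arg_scale) (simp add: r)
qed

end

lemma (in angle_tuple) angle_tuple_at:
  fixes x :: "('d, 'n) tuple"
  assumes "x \<in> M_tilde0 r"
  shows "\<exists>w'. angle_tuple r x w' k l"
proof -
  obtain w' where "strict_tuple r x w'" using strict_tuple_exists[OF assms r] by blast
  then show ?thesis using k l by (auto simp: angle_tuple_def angle_tuple_axioms_def)
qed

lemma open_three_gaps: "open {x :: ('d::finite, 'n::{finite,linorder}) tuple. three_gaps k l (herm_part x)}"
  unfolding three_gaps_def by (intro open_Collect_conj open_gap)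

lemma open_invariant_hull:
  assumes "open W"
  shows "open (\<Union>g\<in>{g. unitary g}. conj_act g ` W)"
proof (intro open_UN ballI)
  fix g :: "complex^'a^'a" assume "g \<in> {g. unitary g}"
  then have g: "unitary g" by simp
  have "conj_act g ` W = conj_act (cadjoint g) -` W"
  proof (intro set_eqI iffI)
    fix x assume "x \<in> conj_act (cadjoint g) -` W"
    moreover have "conj_act g (conj_act (cadjoint g) x) = x"
      using conj_act_inverse[OF unitary_cadjoint[OF g]] by simp
    ultimately show "x \<in> conj_act g ` W" by (metis image_eqI vimageD)
  qed (auto simp: conj_act_inverse[OF g])
  moreover have "continuous_on UNIV (conj_act (cadjoint g) :: ('a, 'b) tuple \<Rightarrow> _)"
    using linear_conj_act by (intro linear_continuous_on) (simp add: linear_conv_bounded_linear)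
  ultimately show "open (conj_act g ` W)" using assms by (simp add: open_vimage)
qed

context angle_tuple
begin

text \<open>Dividing by the value at \<open>e\<close> moves \<open>four_point\<close> to 1, where
  the principal logarithm is differentiable; its imaginary part continues the branch off the level
  set.\<close>

lemma angle_extension:
  assumes V: "angle_branch r k l V \<theta>" "orbit e \<in> V"
  shows "\<exists>G. invariant_extension r \<theta> e G"
proof -
  define S where "S = {x \<in> M_tilde0 r. orbit x \<in> V}"
  have S: "openin (top_of_set (M_tilde0 r)) S" "continuous_on S (\<theta> \<circ> orbit)"
    using V(1) by (simp_all add: angle_branch_def S_def)
  have eS: "e \<in> S" using e V(2) by (simp add: S_def)
  define z where "z x = four_point k l x / four_point k l e" for x :: "('d, 'n) tuple"
  define G where "G x = \<theta> (orbit e) + Im (Ln (z x))" for x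
  \<comment> \<open>On \<open>S'\<close> the branch is within 1 of its value at \<open>e\<close>,
    and the logarithm contributes less than \<open>pi / 2\<close>; two arguments of the same number
    closer than \<open>2 * pi\<close> coincide.\<close>
  define S' where "S' = S \<inter> (\<theta> \<circ> orbit) -` ball (\<theta> (orbit e)) 1"
  have "openin (top_of_set S) S'"
    unfolding S'_def by (intro continuous_openin_preimage_gen S(2)) simp
  then have "openin (top_of_set (M_tilde0 r)) S'" using S(1) openin_trans by blast
  then obtain W where W: "open W" "S' = M_tilde0 r \<inter> W" by (auto simp: openin_open)
  \<comment> \<open>Extensions live on invariant neighbourhoods, so \<open>W\<close> is saturated by
    conjugation; the bound on the branch survives because it depends only on the orbit.\<close>
  define Wh where "Wh = (\<Union>g\<in>{g. unitary g}. conj_act g ` W)"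
  define Og where "Og = {x :: ('d, 'n) tuple. three_gaps k l (herm_part x)}"
  define U where "U = Wh \<inter> (Og \<inter> (\<lambda>x. z (herm_part x)) -` {c. Re c > 0})"
  have WhM: "orbit x \<in> V \<and> \<bar>\<theta> (orbit x) - \<theta> (orbit e)\<bar> < 1" if "x \<in> Wh" "x \<in> M_tilde0 r" for x
  proof -
    from that(1) obtain g where "unitary g" "x \<in> conj_act g ` W" unfolding Wh_def by blast
    then obtain y where g: "unitary g" "y \<in> W" "x = conj_act g y" by blast
    have "y \<in> M_tilde0 r"
      using conj_act_M_tilde0[OF that(2) unitary_cadjoint[OF g(1)]] by (simp add: g(3) conj_act_inverse[OF g(1)])
    then have "y \<in> S'" using g(2) W(2) by simp
    then show ?thesis by (auto simp: S'_def S_def g(3) orbit_conj_act[OF g(1)] dist_real_def)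
  qed
  have zc: "continuous_on Og (\<lambda>x. z (herm_part x))"
  proof (rule continuous_on_compose2[of "{y \<in> hermitian_tuples. three_gaps k l y}" z Og herm_part])
    show "continuous_on {y \<in> hermitian_tuples. three_gaps k l y} z"
      unfolding z_def[abs_def]
    proof (intro continuous_on_divide continuous_on_const ballI)
      show "continuous_on {y \<in> hermitian_tuples. three_gaps k l y} (four_point k l :: ('d, 'n) tuple \<Rightarrow> complex)"
        unfolding continuous_on_eq_continuous_within
      proof
        fix x :: "('d, 'n) tuple" assume "x \<in> {y \<in> hermitian_tuples. three_gaps k l y}"
        then have "four_point k l differentiable (at x within hermitian_tuples)"
          using four_point_differentiable[OF _ _ l(4)] by blast
        then have "four_point k l differentiable (at x within {y \<in> hermitian_tuples. three_gaps k l y})"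
          by (rule differentiable_within_subset) blast
        then show "continuous (at x within {y \<in> hermitian_tuples. three_gaps k l y}) (four_point k l)"
          by (rule differentiable_imp_continuous_within)
      qed
    qed (rule four_point_nonzero)
    show "continuous_on Og herm_part"
      using linear_herm_part by (intro linear_continuous_on) (simp add: linear_conv_bounded_linear)
    show "herm_part ` Og \<subseteq> {y \<in> hermitian_tuples. three_gaps k l y}"
      by (auto simp: Og_def herm_part_hermitian)
  qed
  have openU: "open U"
    unfolding U_def Wh_def
    by (intro open_Int open_invariant_hull W(1) continuous_open_preimage[OF zc])
      (auto simp: Og_def open_three_gaps open_halfspace_Re_gt)
  have z1: "z e = 1" using four_point_nonzero by (simp add: z_def)
  have eU: "e \<in> U"
  proof -
    have "e \<in> S'" using eS by (simp add: S'_def)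
    then have "conj_act (mat 1) e \<in> Wh" unfolding Wh_def using W(2) unitary_one by blast
    then show ?thesis using gaps z1 by (simp add: U_def Og_def herm_part_id[OF herm])
  qed
  have zinv: "z (conj_act g x) = z x" if "unitary g" "x \<in> hermitian_tuples" "three_gaps k l x" for g x
    using four_point_conj_act[OF that(2,1,3) l(4)] by (simp add: z_def)
  have Uz: "three_gaps k l x" "Re (z x) > 0" if "x \<in> U" "x \<in> hermitian_tuples" for x
    using that by (auto simp: U_def Og_def herm_part_id)
  have Arg: "is_Arg (z x) (\<theta> (orbit x) - \<theta> (orbit e))" if "x \<in> Wh" "x \<in> M_tilde0 r" for x
  proof -
    from angle_tuple_at[OF that(2)] obtain w' where w': "angle_tuple r x w' k l" by blast
    have "is_Arg (four_point k l x) (\<theta> (orbit x))"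
      using angle_tuple.is_Arg_four_point[OF w' V(1)] WhM[OF that] by blast
    then show ?thesis unfolding z_def using is_Arg_four_point[OF V] by (rule is_Arg_divide)
  qed
  have "invariant_extension r \<theta> e G"
    unfolding invariant_extension_def
  proof (rule exI[of _ U], intro conjI allI impI ballI openU eU)
    fix g :: "complex^'d^'d" and x :: "('d, 'n) tuple"
    {
      assume gx: "unitary g \<and> x \<in> U"
      then obtain h y where h: "unitary h" "y \<in> W" "x = conj_act h y" by (auto simp: U_def Wh_def)
      have "conj_act g x \<in> Wh"
        using h gx unitary_mult[of g h] unfolding Wh_def h(3) conj_act_mult by blast
      moreover have "three_gaps k l (herm_part x)" "Re (z (herm_part x)) > 0"
        using gx by (auto simp: U_def Og_def)
      ultimately show "conj_act g x \<in> U"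
        using gx l(4) by (simp add: U_def Og_def herm_part_conj_act zinv herm_part_hermitian three_gaps_conj_act)
    next
      assume gx: "unitary g \<and> x \<in> U \<inter> N_tilde r"
      then have "x \<in> hermitian_tuples" using N_tilde_hermitian by blast
      then show "G (conj_act g x) = G x" using gx Uz(1)[of x] by (simp add: G_def zinv)
    }
  next
    fix x assume x: "x \<in> U \<inter> M_tilde0 r"
    then have xh: "x \<in> hermitian_tuples" and xW: "x \<in> Wh" "x \<in> M_tilde0 r"
      using M_tilde0_hermitian by (auto simp: U_def)
    have pos: "Re (z x) > 0" using Uz(2) x xh by blast
    then have nz: "z x \<noteq> 0" by force
    have "\<bar>Im (Ln (z x))\<bar> < pi / 2" using Re_Ln_pos_lt_imp pos Re_Ln_pos_lt[OF nz] by blast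
    moreover have "is_Arg (z x) (Im (Ln (z x)))" using is_Arg_exp_Im[of "Ln (z x)"] nz by simp
    moreover have "\<bar>\<theta> (orbit x) - \<theta> (orbit e)\<bar> < 1" using WhM[OF xW] by blast
    ultimately have "Im (Ln (z x)) = \<theta> (orbit x) - \<theta> (orbit e)"
      using is_Arg_eqI[OF _ Arg[OF xW] _ nz, of "Im (Ln (z x))"] pi_gt3 by linarith
    then show "G x = \<theta> (orbit x)" by (simp add: G_def)
  next
    fix x assume x: "x \<in> U \<inter> hermitian_tuples"
    note Ux = Uz[of x]
    obtain B where B: "(four_point k l has_derivative B) (at x within hermitian_tuples)"
      using four_point_differentiable[of x k l] x Ux l(4) by (auto simp: differentiable_def)
    have zx: "z x \<notin> \<real>\<^sub>\<le>\<^sub>0" using Ux(2) x by (auto simp: complex_nonpos_Reals_iff)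
    have dz: "(z has_derivative (\<lambda>y. B y / four_point k l e)) (at x within hermitian_tuples)"
      unfolding z_def[abs_def] using bounded_linear.has_derivative[OF bounded_linear_divide B] by simp
    have dL: "(Ln has_derivative (\<lambda>y. inverse (z x) * y)) (at (z x) within z ` hermitian_tuples)"
      using has_field_derivative_Ln[OF zx] unfolding has_field_derivative_def by (rule has_derivative_at_withinI)
    have "(G has_derivative (\<lambda>y. 0 + Im (inverse (z x) * (B y / four_point k l e)))) (at x within hermitian_tuples)"
      unfolding G_def[abs_def]
      by (intro has_derivative_add has_derivative_const
          bounded_linear.has_derivative[OF bounded_linear_Im] has_derivative_in_compose[OF dz dL])
    then show "\<exists>D. has_gradient G D x"
      using x by (intro differentiable_imp_has_gradient) (auto simp: differentiable_def)
  qed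
  then show ?thesis by blast
qed

text \<open>If \<open>k < i\<close>, all matrices involved are conjugated by one unitary; if
  \<open>i < k\<close>, none of them changes. If \<open>i = k\<close>, only the factor
  \<open>k + 1\<close> is rotated, and the phases it picks up at the two eigenvectors cancel unless
  \<open>j\<close> separates their positions \<open>l\<close> and \<open>l + 1\<close>, that is,
  unless \<open>j = l\<close>.\<close>

lemma four_point_flow:
  assumes g: "gap (partial_sum e i) j" "j \<le> CARD('d)" and i: "i + 1 \<le> CARD('n)"
  shows "four_point k l (flow i j t) = cis ((if i = k \<and> j = l then 1 else 0) * t) * four_point k l e"
proof (cases i k rule: linorder_cases)
  case greater
  define R where "R = rot (spectral_proj (partial_sum e i) j) t"
  have R: "unitary R" unfolding R_def by (rule unitary_rot[OF spectral_proj_projection(2,1)[OF g]])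
  have "partial_sum (flow i j t) k = partial_sum (conj_act R e) k"
    unfolding partial_sum_conj_act R_def using greater i by (intro partial_sum_flow_le) auto
  moreover have "flow i j t $ ix a = conj_act R e $ ix a" if "a \<in> {1..i + 1}" for a
    using that by (auto simp: flow_def conj_act_def R_def)
  ultimately have "four_point k l (flow i j t) = four_point k l (conj_act R e)"
    using greater unfolding four_point_def by simp
  then show ?thesis using greater four_point_conj_act[OF herm R gaps l(4)] by simp
next
  case less
  then have "partial_sum (flow i j t) k = partial_sum e k"
    using k by (intro partial_sum_flow_ge[OF g]) auto
  moreover have "flow i j t $ ix (k + 1) = e $ ix (k + 1)" "flow i j t $ ix (k + 2) = e $ ix (k + 2)"
    using less k by (auto intro!: flow_ix_gt)
  ultimately show ?thesis using less unfolding four_point_def by simp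
next
  case equal
  obtain u where u: "eigenbasis (partial_sum e k) u" using ex_eigenbasis[OF hermA] by blast
  define P where "P = spectral_proj (partial_sum e i) j"
  have P: "P = (\<Sum>a<j. outer (u a))"
    unfolding P_def using g u equal by (intro spectral_proj_eq[OF hermA]) auto
  have hP: "hermitian P" unfolding P by (rule hermitian_sum_outer)
  have Pu: "P *v u a = (if a < j then u a else 0)" if "a < CARD('d)" for a
    unfolding P by (rule sum_outer_orthonormal_mult[OF eigenbasisD(1)[OF u] g(2) that])
  define \<alpha> where "\<alpha> a = (if a < j then cis (- t) else 1)" for a
  have Ru: "rot P (- t) *v u a = \<alpha> a *s u a" if "a < CARD('d)" for a
    by (simp add: rot_mult_vec Pu[OF that] \<alpha>_def vector_sub_rdistrib)
  have ps: "partial_sum (flow i j t) k = partial_sum e k"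
    using equal k by (intro partial_sum_flow_ge[OF g]) auto
  have f1: "flow i j t $ ix (k + 1) = rot P t ** e $ ix (k + 1) ** rot P (- t)"
    using equal hP by (simp add: flow_def P_def cadjoint_rot)
  have f2: "flow i j t $ ix (k + 2) = e $ ix (k + 2)"
    using equal k by (intro flow_ix_gt) auto
  have 1: "outer (u a) ** rot P t = mat (cnj (\<alpha> a)) ** outer (u a)" if "a < CARD('d)" for a
    unfolding rank1_self[symmetric] rank1_mult cadjoint_rot[OF hP] Ru[OF that]
    by (simp add: vec_eq_iff mat_mult_component rank1_def mult_ac)
  have 2: "rot P (- t) ** outer (u a) = mat (\<alpha> a) ** outer (u a)" if "a < CARD('d)" for a
    unfolding mult_outer Ru[OF that] mat_mult_vec ..
  have la: "l - 1 < CARD('d)" "l < CARD('d)" using l by auto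
  have m: "A ** (mat c ** B) = mat c ** (A ** B)" for A B :: "complex^'d^'d" and c
    by (metis mat_mult_commute matrix_mul_assoc)
  define X where "X = e $ ix (k + 1)"
  define Y where "Y = e $ ix (k + 2)"
  define a where "a = outer (u (l - 1))"
  define b where "b = outer (u l)"
  have "four_point k l (flow i j t) = trace (a ** (rot P t ** X ** rot P (- t)) ** (b ** Y))"
    unfolding four_point_def ps f1 f2 spectral_proj_diff[OF u] a_def b_def X_def Y_def ..
  also have "a ** (rot P t ** X ** rot P (- t)) ** (b ** Y) = (a ** rot P t) ** X ** (rot P (- t) ** b) ** Y"
    by (simp only: matrix_mul_assoc)
  also have "\<dots> = mat (cnj (\<alpha> (l - 1))) ** (mat (\<alpha> l) ** (a ** X ** (b ** Y)))"
    unfolding a_def b_def 1[OF la(1)] 2[OF la(2)]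
    by (simp only: matrix_mul_assoc[symmetric] m[of X] m[of "outer (u (l - 1))"])
  also have "trace \<dots> = cnj (\<alpha> (l - 1)) * \<alpha> l * four_point k l e"
    unfolding four_point_def spectral_proj_diff[OF u] a_def b_def X_def Y_def
    by (simp add: trace_mat_mult)
  also have "cnj (\<alpha> (l - 1)) * \<alpha> l = cis ((if j = l then 1 else 0) * t)"
    using l(1) by (auto simp: \<alpha>_def cis_cnj cis_mult)
  finally show ?thesis using equal by simp
qed

text \<open>\<open>four_point_flow\<close> gives the angle modulo \<open>2 * pi\<close>. The
  discrepancy \<open>\<phi>\<close> is continuous in \<open>t\<close> and starts at 0, so it is
  below 1 near 0 and must vanish there.\<close>

lemma angle_along_flow:
  assumes V: "angle_branch r k l V \<theta>" "orbit e \<in> V"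
    and g: "gap (partial_sum e i) j" "j \<le> CARD('d)" and i: "i + 1 \<le> CARD('n)"
  shows "\<forall>\<^sub>F t in nhds 0. \<theta> (orbit (flow i j t)) = \<theta> (orbit e) + (if i = k \<and> j = l then 1 else 0) * t"
proof -
  define S where "S = {x \<in> M_tilde0 r. orbit x \<in> V}"
  have S: "openin (top_of_set (M_tilde0 r)) S" "continuous_on S (\<theta> \<circ> orbit)"
    using V(1) by (simp_all add: angle_branch_def S_def)
  define \<tau> where "\<tau> = (if i = k \<and> j = l then 1 else 0 :: real)"
  obtain W where W: "open W" "S = M_tilde0 r \<inter> W" using S(1) by (auto simp: openin_open)
  define T where "T = flow i j -` W"
  have T: "open T" "0 \<in> T" "flow i j ` T \<subseteq> S"
    using open_vimage[OF W(1) continuous_on_flow] W e V(2) flow_M_tilde0[OF g i]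
    by (auto simp: T_def flow_0 S_def)
  have "continuous_on T ((\<theta> \<circ> orbit) \<circ> flow i j)"
    using continuous_on_subset[OF continuous_on_flow] continuous_on_subset[OF S(2) T(3)]
    by (intro continuous_on_compose) auto
  moreover define \<phi> where "\<phi> t = \<theta> (orbit (flow i j t)) - (\<theta> (orbit e) + \<tau> * t)" for t
  ultimately have "continuous_on T \<phi>"
    unfolding \<phi>_def[abs_def] by (intro continuous_intros) (simp add: o_def)
  then have "isCont \<phi> 0" using T by (simp add: continuous_on_eq_continuous_at)
  then have "(\<phi> \<longlongrightarrow> \<phi> 0) (nhds 0)" by (simp add: isCont_def tendsto_at_iff_tendsto_nhds)
  then have "\<forall>\<^sub>F t in nhds 0. dist (\<phi> t) (\<phi> 0) < 1" by (rule tendstoD) simp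
  moreover have "\<forall>\<^sub>F t in nhds 0. t \<in> T" using T by (simp add: eventually_nhds_in_open)
  ultimately show ?thesis
  proof eventually_elim
    case (elim t)
    define x where "x = flow i j t"
    have x: "x \<in> M_tilde0 r" "orbit x \<in> V" using elim(2) T(3) by (auto simp: x_def S_def)
    obtain w' where w': "angle_tuple r x w' k l" using angle_tuple_at[OF x(1)] by blast
    have "is_Arg (four_point k l x) (\<theta> (orbit x))"
      using angle_tuple.is_Arg_four_point[OF w' V(1) x(2)] .
    moreover have "is_Arg (four_point k l x) (\<theta> (orbit e) + \<tau> * t)"
      unfolding x_def four_point_flow[OF g i] \<tau>_def by (rule is_Arg_mult_cis[OF is_Arg_four_point[OF V]])
    moreover have "four_point k l x \<noteq> 0" using angle_tuple.four_point_nonzero[OF w'] .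
    ultimately have "\<theta> (orbit x) = \<theta> (orbit e) + \<tau> * t"
      using elim(1) pi_gt3 by (intro is_Arg_eqI) (auto simp: x_def \<phi>_def flow_0 dist_real_def)
    then show ?case by (simp add: x_def \<tau>_def)
  qed
qed

end

text \<open>\<open>D\<close> stands for \<open>CARD('d)\<close>. Unforcedness gives
  \<open>i + 2 \<le> n\<close> when combined with \<open>j \<le> m\<close>, and \<open>D < n\<close>
  when combined with \<open>j \<le> i\<close>; so the dimension condition behind surjectivity holds
  whenever \<open>index_set m n\<close> is nonempty.\<close>

lemma index_setD:
  assumes "(i, j) \<in> index_set m n" "D = m + 1"
  shows "1 \<le> i" "i + 2 \<le> n" "1 \<le> j" "j \<le> i" "D + i + 1 < j + n" "j + 1 \<le> D" "D < n"
  using assms by (auto simp: index_set_def forced_Lambda_def forced_zero_def)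

context angle_tuple
begin

lemma lie_poisson_action_angle:
  assumes V: "angle_branch r k l V \<theta>" "orbit e \<in> V"
    and g: "gap (partial_sum e i) j" "j \<le> CARD('d)" and i: "i + 1 \<le> CARD('n)"
    and F: "invariant_extension r (action i j) e F" "has_gradient F D e"
    and G: "invariant_extension r \<theta> e G" "has_gradient G D' e"
  shows "lie_poisson D D' e = (if i = k \<and> j = l then 1 else 0)"
proof -
  let ?F = "\<lambda>x. \<Sum>a = 1..j. lam x i a"
  let ?\<tau> = "if i = k \<and> j = l then 1 else 0 :: real"
  have n: "CARD('d) < CARD('n)" using k l by linarith
  have eN: "e \<in> N_tilde r" using e by (simp add: M_tilde0_def M_tilde_def)
  obtain VF where VF: "open VF" "e \<in> VF" "\<And>x. x \<in> VF \<inter> M_tilde0 r \<Longrightarrow> F x = action i j (orbit x)"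
    using F(1) unfolding invariant_extension_def by blast
  obtain VG where VG: "open VG" "e \<in> VG" "\<And>x. x \<in> VG \<inter> M_tilde0 r \<Longrightarrow> G x = \<theta> (orbit x)"
    "\<And>g. unitary g \<Longrightarrow> G (conj_act g e) = G e"
    using G(1) eN unfolding invariant_extension_def by blast
  have "lie_poisson D D' e = lie_poisson (action_gradient i j) D' e"
  proof (rule lie_poisson_depends_on_restriction[OF n F(2) has_gradient_action[OF g i] VF(1,2) _ G(2) VG(4)])
    fix x assume x: "x \<in> VF \<inter> M_tilde0 r"
    then have "x \<in> hermitian_tuples" using M_tilde0_hermitian by blast
    then show "F x = ?F x" using VF(3)[OF x] by (simp add: action_orbit)
  qed
  also have "\<dots> = ?\<tau>"
  proof -
    have d: "((\<lambda>t. G (flow i j t)) has_real_derivative lie_poisson (action_gradient i j) D' e) (at 0)"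
      unfolding lie_poisson_def
      by (rule has_gradient_curve[OF G(2) flow_has_vector_derivative[OF g] flow_0 flow_hermitian])
    have "open (flow i j -` VG)" "0 \<in> flow i j -` VG"
      using open_vimage[OF VG(1) continuous_on_flow] VG(2) by (auto simp: flow_0)
    then have "\<forall>\<^sub>F t in nhds 0. t \<in> flow i j -` VG" by (rule eventually_nhds_in_open)
    then have "\<forall>\<^sub>F t in nhds 0. G (flow i j t) = \<theta> (orbit e) + ?\<tau> * t"
      using angle_along_flow[OF V g i]
    proof eventually_elim
      case (elim t)
      then show ?case using VG(3)[of "flow i j t"] flow_M_tilde0[OF g i] by simp
    qed
    then have "((\<lambda>t. \<theta> (orbit e) + ?\<tau> * t) has_real_derivative lie_poisson (action_gradient i j) D' e) (at 0)"
      by (rule iffD1[OF DERIV_cong_ev[OF refl _ refl] d])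
    moreover have "((\<lambda>t. \<theta> (orbit e) + ?\<tau> * t) has_real_derivative ?\<tau>) (at 0)"
      by (auto intro!: derivative_eq_intros)
    ultimately show ?thesis by (rule DERIV_unique)
  qed
  finally show ?thesis .
qed

end

theorem proposition7p2p7:
  fixes m n :: nat
    and r :: "real^'n::{finite,linorder}"
    and p :: "('d::finite, 'n) tuple set"
    and V :: "('d, 'n) tuple set set"
    and \<theta> :: "('d, 'n) tuple set \<Rightarrow> real"
    and i j k l :: nat
  assumes "CARD('d) = m + 1" and "CARD('n) = n"
    and "\<forall>a. r $ a > 0"
    and "(i, j) \<in> index_set m n" and "(k, l) \<in> index_set m n"
    and "p \<in> M_quot0 r"
    and "angle_branch r k l V \<theta>" and "p \<in> V"
  shows "has_reduced_bracket r (action i j) \<theta> p (if i = k \<and> j = l then 1 else 0)"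
proof -
  note ij = index_setD[OF assms(4,1), folded assms(2)]
  note kl = index_setD[OF assms(5,1), folded assms(2)]
  \<comment> \<open>\<open>has_reduced_bracket\<close> ranges over all representatives of
    \<open>p\<close>, so strictness and the gap are carried along the orbit to each of them.\<close>
  have "\<exists>w. angle_tuple r e w k l \<and> gap (partial_sum e i) j" and orb: "orbit e = p" if "e \<in> p" for e
  proof -
    obtain e0 where e0: "e0 \<in> M_tilde0 r" "p = orbit e0" using assms(6) by (auto simp: M_quot0_def)
    from that e0(2) obtain g where g: "unitary g" "e = conj_act g e0" by (auto simp: orbit_def)
    show "orbit e = p" by (simp add: g orbit_conj_act e0(2))
    have e: "e \<in> M_tilde0 r" unfolding g(2) by (rule conj_act_M_tilde0[OF e0(1) g(1)])
    obtain w where w: "strict_tuple r e w" using strict_tuple_exists[OF e] assms(3) by blast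
    have "gap (partial_sum e i) j" using ij by (intro strict_tuple.gap_at(1)[OF w]) auto
    moreover have "angle_tuple r e w k l"
      using w kl by (simp add: angle_tuple_def angle_tuple_axioms_def)
    ultimately show "\<exists>w. angle_tuple r e w k l \<and> gap (partial_sum e i) j" by blast
  qed
  note at = this
  have j: "j \<le> CARD('d)" "i + 1 \<le> CARD('n)" using ij by auto
  show ?thesis
    unfolding has_reduced_bracket_def
  proof (intro conjI allI ballI impI)
    obtain e where e: "e \<in> p" using assms(6) orbit_refl by (auto simp: M_quot0_def)
    obtain w where w: "angle_tuple r e w k l" "gap (partial_sum e i) j" using at(1)[OF e] by blast
    have "\<exists>F. invariant_extension r (action i j) e F"
      using strict_tuple.action_extension[OF angle_tuple.axioms(1)[OF w(1)] w(2) j(1)] by blast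
    moreover have "\<exists>G. invariant_extension r \<theta> e G"
      using angle_tuple.angle_extension[OF w(1) assms(7)] assms(8) at(2)[OF e] by blast
    ultimately show "\<exists>e\<in>p. (\<exists>F. invariant_extension r (action i j) e F) \<and> (\<exists>G. invariant_extension r \<theta> e G)"
      using e by blast
  next
    fix e F G D D'
    assume e: "e \<in> p" and FG: "invariant_extension r (action i j) e F \<and> invariant_extension r \<theta> e G \<and>
        has_gradient F D e \<and> has_gradient G D' e"
    obtain w where w: "angle_tuple r e w k l" "gap (partial_sum e i) j" using at(1)[OF e] by blast
    have "orbit e \<in> V" using at(2)[OF e] assms(8) by simp
    then show "lie_poisson D D' e = (if i = k \<and> j = l then 1 else 0)"
      using FG by (intro angle_tuple.lie_poisson_action_angle[OF w(1) assms(7) _ w(2) j]) auto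
  qed
qed

end
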